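(* Let $a<b$ be real numbers and let $f:(a,b)\to\mathbb{R}$ be a locally integrable function. Suppose that the function $I\mapsto\operatorname{osc}(f,I)$, defined on the nonempty open intervals $I\subset\subset(a,b)$, extends to a positive Borel measure $\mu$ on $(a,b)$, that is, $\mu$ is a positive Borel measure on $(a,b)$ with $\mu(I)=\operatorname{osc}(f,I)$ for every nonempty open interval $I\subset\subset(a,b)$. Then $\mu=\frac14|Df|$ and $f$ is affine.
   Context: Locally integrable functions are identified up to Lebesgue-null sets, so "$f$ is affine" means that there are $\alpha,\beta\in\mathbb{R}$ with $f(x)=\alpha x+\beta$ for almost every $x\in(a,b)$. The notation $I\subset\subset(a,b)$ means that the closure of $I$ is a compact subset of $(a,b)$. For a nonempty open interval $I\subset\subset(a,b)$ of length $|I|$, the mean value is $(f)_I:=\frac{1}{|I|}\int_I f\,dx$ and the mean oscillation is $\operatorname{osc}(f,I):=\frac{1}{|I|}\int_I|f-(f)_I|\,dx$. The total variation of the distributional derivative $Df$ on $I$ is $|Df|(I):=\sup\{\int_I f\varphi'\,dx:\varphi\in C_c^\infty(I),\ \|\varphi\|_{L^\infty(I)}\le 1\}\in[0,\infty]$; when this is finite for all such $I$, $Df$ is a signed Radon measure on $(a,b)$ and $|Df|$ denotes its total variation measure. The equality $\mu=\frac14|Df|$ is an equality of Borel measures on $(a,b)$ (in particular it asserts that $f\in BV_{\mathrm{loc}}((a,b))$). *)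

theory Defs
  imports "HOL-Analysis.Analysis"
begin

text \<open>Functions on \<open>(a,b)\<close> are modelled by total functions \<open>real \<Rightarrow> real\<close>; all notions below
  that refer to \<open>(a,b)\<close> depend only on the values there.\<close>

definition locally_integrable :: "real \<Rightarrow> real \<Rightarrow> (real \<Rightarrow> real) \<Rightarrow> bool" where
  "locally_integrable a b f \<longleftrightarrow>
     (\<forall>K. compact K \<and> K \<subseteq> {a<..<b} \<longrightarrow> set_integrable lebesgue K f)"

definition mean_value :: "(real \<Rightarrow> real) \<Rightarrow> real set \<Rightarrow> real" where
  "mean_value f I = (1 / measure lebesgue I) * (LINT x:I|lebesgue. f x)"

definition osc :: "(real \<Rightarrow> real) \<Rightarrow> real set \<Rightarrow> real" where
  "osc f I = (1 / measure lebesgue I) * (LINT x:I|lebesgue. \<bar>f x - mean_value f I\<bar>)"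

text \<open>The nonempty open intervals whose closure is a compact subset of \<open>(a,b)\<close>.\<close>

definition inner_intervals :: "real \<Rightarrow> real \<Rightarrow> real set set" where
  "inner_intervals a b = {{c<..<d} | c d. a < c \<and> c < d \<and> d < b}"

definition test_function :: "real set \<Rightarrow> (real \<Rightarrow> real) \<Rightarrow> bool" where
  "test_function S \<phi> \<longleftrightarrow>
     (\<forall>n x. (deriv ^^ n) \<phi> field_differentiable (at x)) \<and>
     compact (closure {x. \<phi> x \<noteq> 0}) \<and> closure {x. \<phi> x \<noteq> 0} \<subseteq> S"

text \<open>\<open>|Df|(S)\<close> for open \<open>S\<close>. The coercion \<open>ennreal\<close> truncates negative values to \<open>0\<close>, which does
  not change the supremum since \<open>\<phi> = 0\<close> is admissible. Test functions are continuous, so the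
  essential bound by \<open>1\<close> is the pointwise one.\<close>

definition total_variation :: "(real \<Rightarrow> real) \<Rightarrow> real set \<Rightarrow> ennreal" where
  "total_variation f S =
     (SUP \<phi>\<in>{\<phi>. test_function S \<phi> \<and> (\<forall>x\<in>S. \<bar>\<phi> x\<bar> \<le> 1)}.
        ennreal (LINT x:S|lebesgue. f x * deriv \<phi> x))"

definition BV_loc :: "real \<Rightarrow> real \<Rightarrow> (real \<Rightarrow> real) \<Rightarrow> bool" where
  "BV_loc a b f \<longleftrightarrow>
     locally_integrable a b f \<and> (\<forall>I\<in>inner_intervals a b. total_variation f I < \<infinity>)"

definition borel_measure_on :: "real \<Rightarrow> real \<Rightarrow> real measure \<Rightarrow> bool" where
  "borel_measure_on a b M \<longleftrightarrow> sets M = sets (restrict_space borel {a<..<b})"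

definition radon_measure_on :: "real \<Rightarrow> real \<Rightarrow> real measure \<Rightarrow> bool" where
  "radon_measure_on a b M \<longleftrightarrow>
     borel_measure_on a b M \<and> (\<forall>K. compact K \<and> K \<subseteq> {a<..<b} \<longrightarrow> emeasure M K < \<infinity>)"

text \<open>A signed Radon measure on \<open>(a,b)\<close> is represented as a difference \<open>P - N\<close> of positive Radon
  measures (not necessarily mutually singular); it is a real number on every Borel set that is
  relatively compact in \<open>(a,b)\<close>. The following says that \<open>Df = P - N\<close> as distributions.\<close>

definition has_distributional_derivative ::
    "real \<Rightarrow> real \<Rightarrow> (real \<Rightarrow> real) \<Rightarrow> real measure \<Rightarrow> real measure \<Rightarrow> bool" where
  "has_distributional_derivative a b f P N \<longleftrightarrow>
     radon_measure_on a b P \<and> radon_measure_on a b N \<and>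
     (\<forall>\<phi>. test_function {a<..<b} \<phi> \<longrightarrow>
        (LINT x:{a<..<b}|lebesgue. f x * deriv \<phi> x) = - ((LINT x|P. \<phi> x) - (LINT x|N. \<phi> x)))"

text \<open>The total variation measure \<open>|P - N|(B)\<close> of the signed measure \<open>P - N\<close>. The families are
  restricted to sets that are relatively compact in \<open>(a,b)\<close>, since elsewhere the difference may be
  \<open>\<infinity> - \<infinity>\<close>; by countable additivity finite families give the same supremum as countable
  partitions.\<close>

definition signed_variation ::
    "real \<Rightarrow> real \<Rightarrow> real measure \<Rightarrow> real measure \<Rightarrow> real set \<Rightarrow> ennreal" where
  "signed_variation a b P N B =
     (SUP \<D>\<in>{\<D>. finite \<D> \<and> disjoint \<D> \<and>
              (\<forall>D\<in>\<D>. D \<in> sets borel \<and> D \<subseteq> B \<and> compact (closure D) \<and> closure D \<subseteq> {a<..<b})}.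
        ennreal (\<Sum>D\<in>\<D>. \<bar>measure P D - measure N D\<bar>))"

definition is_affine_on :: "real \<Rightarrow> real \<Rightarrow> (real \<Rightarrow> real) \<Rightarrow> bool" where
  "is_affine_on a b f \<longleftrightarrow>
     (\<exists>\<alpha> \<beta>. AE x in lebesgue. x \<in> {a<..<b} \<longrightarrow> f x = \<alpha> * x + \<beta>)"

end

theory Submission
  imports Defs
begin

text \<open>Additivity rules out atoms of \<open>\<mu>\<close>: near a jump of size \<open>J\<close> the oscillation tends to \<open>J/2\<close> on
  symmetric intervals, but to \<open>3J/8\<close> on intervals divided in the ratio \<open>1:3\<close>. Hence
  \<open>osc f (c,d) = M d - M c\<close> for a continuous increasing \<open>M\<close>. Since averages over adjacent intervals of
  equal length differ by at most twice the oscillation on their union, telescoping gives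
  \<open>|f d - f c| \<le> 4 (M d - M c)\<close>, and \<open>f\<close> has a continuous representative.

  If \<open>f c = f d\<close>, the last inequality forces \<open>osc f (c,d) \<ge> (max f - min f)/2\<close>, whereas the opposite strict
  inequality holds for continuous nonconstant \<open>f\<close>. Together with a propagation argument for plateaus,
  \<open>f\<close> is constant or strictly monotone.

  For increasing \<open>f\<close> with primitive \<open>F\<close>, \<open>(d - c) osc f (c,d)\<close> is twice the maximal gap between the
  chord and the graph of \<open>F\<close>. Differentiating in \<open>c\<close> and \<open>d\<close> (envelope theorem) shows \<open>f' = 4 M' =: u\<close> and
  \[(X + Y)^2 + (d - c)^2 (u(c) X + u(d) Y) = 8 X Y,\]
  where \<open>X = (d - c) f d - (F d - F c)\<close> and \<open>Y = F d - F c - (d - c) f c\<close>. This makes \<open>u\<close> twice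
  differentiable, and its Taylor expansion for \<open>d \<longrightarrow> c\<close> yields \<open>3 u u'' = u'\<^sup>2\<close>. So \<open>u\<^sup>2\<^sup>/\<^sup>3\<close> is affine
  where \<open>u > 0\<close>, and inserting this into the identity leaves only constant \<open>u\<close>.\<close>

section \<open>Increasing functions\<close>

text \<open>The obstacle is regularity: \<open>M\<close> is given through a level point that depends
  only continuously on the end points, and \<open>f\<close> is only continuous. Two matching
  constants overcome it. Telescoping bounds increments of \<open>f\<close> by 4 times those of
  \<open>M\<close>: every point lies in two of the overlapping double intervals, and each double
  interval costs a factor 2. Conversely, the two end point formulas for the derivative of
  \<open>M\<close> bound the increments of \<open>f\<close> below with the same 4, because 1/q +
  1/(1 - q) is least at q = 1/2. As the constants agree, \<open>f\<close> is differentiable. Each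
  end point formula still contains the unknown position q of the level point; only their combination
  eliminates it. Letting d tend to c yields no more than the differential equation, which has the
  nonconstant solution x^(3/2). To exclude it, the identity must be evaluated at two points a finite
  distance apart. The factor 1/4 of the claim enters last: once \<open>f\<close> is affine, all
  measures involved are multiples of Lebesgue measure, and the mean oscillation of a line is a
  quarter of its increment.\<close>

text \<open>The identity satisfied by the density \<open>u\<close> fails for \<open>u(x) = x\<^sup>3\<^sup>/\<^sup>2\<close>; here \<open>s\<^sup>2\<close> and \<open>t\<^sup>2\<close> are the two end
  points, and \<open>x\<close>, \<open>y\<close> are \<open>35 X\<close>, \<open>35 Y\<close>.\<close>

lemma power_three_halves_identity_pos:
  fixes s t :: real
  assumes "0 < s" "0 < t" "s \<noteq> t"
  defines "x \<equiv> 10 * t ^ 7 - 14 * s\<^sup>2 * t ^ 5 + 4 * s ^ 7"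
    and "y \<equiv> 4 * t ^ 7 - 14 * t\<^sup>2 * s ^ 5 + 10 * s ^ 7"
  shows "8 * x * y < (x + y)\<^sup>2 + 35 * (t\<^sup>2 - s\<^sup>2)\<^sup>2 * (s ^ 3 * x + t ^ 3 * y)"
proof -
  \<comment> \<open>The defect vanishes to order 8 at s = t, two orders beyond the sixth order
    coefficient that yields the differential equation. Expansion to that order therefore cannot
    detect it.\<close>
  have "(x + y)\<^sup>2 + 35 * (t\<^sup>2 - s\<^sup>2)\<^sup>2 * (s ^ 3 * x + t ^ 3 * y) - 8 * x * y =
    (t - s) ^ 8 * (16 * t ^ 6 + 128 * t ^ 5 * s + 352 * t ^ 4 * s ^ 2 + 478 * t ^ 3 * s ^ 3
      + 352 * t ^ 2 * s ^ 4 + 128 * t * s ^ 5 + 16 * s ^ 6)"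
    unfolding x_def y_def by algebra
  also have "0 < \<dots>"
    using assms(1-3) by (intro mult_pos_pos add_pos_pos) (auto simp: zero_less_power_eq)
  finally show ?thesis by simp
qed

text \<open>The increasing case without integrals: \<open>gap\<close> is the oscillation identity
  after splitting the integral at the level point s, where \<open>f\<close> equals its mean over (c,
  d).\<close>

locale increasing_osc_additive =
  fixes a b :: real and F f M :: "real \<Rightarrow> real"
  assumes primitive: "\<And>x. a < x \<Longrightarrow> x < b \<Longrightarrow> (F has_real_derivative f x) (at x)"
    and cont: "\<And>x. a < x \<Longrightarrow> x < b \<Longrightarrow> isCont f x"
    and inc: "\<And>x y. a < x \<Longrightarrow> x < y \<Longrightarrow> y < b \<Longrightarrow> f x < f y"
    and gap: "\<And>c s d. a < c \<Longrightarrow> c < s \<Longrightarrow> s < d \<Longrightarrow> d < b \<Longrightarrow> f s = (F d - F c) / (d - c) \<Longrightarrow>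
               (d - c) * (M d - M c) = 2 * (F c + f s * (s - c) - F s)"
    and increment_le: "\<And>c d. a < c \<Longrightarrow> c < d \<Longrightarrow> d < b \<Longrightarrow> f d - f c \<le> 4 * (M d - M c)"
begin

abbreviation slope :: "real \<Rightarrow> real \<Rightarrow> real" where
  "slope c d \<equiv> (F d - F c) / (d - c)"

section \<open>Legendre duality and the derivatives of \<open>M\<close>\<close>

definition inv_f :: "real \<Rightarrow> real" where
  "inv_f m = (SOME x. a < x \<and> x < b \<and> f x = m)"

text \<open>The Legendre transform of the convex function \<open>F\<close>: on the range of
  \<open>f\<close> it is the supremum of m * x - F x, attained at \<open>inv_f m\<close>. It makes
  the maximal gap below a chord a function of the slope and one end point.\<close>

definition conjugate :: "real \<Rightarrow> real" where
  "conjugate m = m * inv_f m - F (inv_f m)"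

lemma inc_iff:
  assumes "a < x" "x < b" "a < y" "y < b"
  shows "f x < f y \<longleftrightarrow> x < y"
  using inc[of x y] inc[of y x] assms by (metis linorder_neqE_linordered_idom order.asym order_less_irrefl)

lemma inv_f_f:
  assumes "a < x" "x < b"
  shows "inv_f (f x) = x"
proof -
  have "a < inv_f (f x) \<and> inv_f (f x) < b \<and> f (inv_f (f x)) = f x"
    unfolding inv_f_def by (rule someI[of _ x]) (use assms in auto)
  then show ?thesis
    using inc_iff[of x "inv_f (f x)"] inc_iff[of "inv_f (f x)" x] assms by force
qed

lemma slope_bounds:
  assumes "a < c" "c < d" "d < b"
  shows "f c < slope c d" "slope c d < f d"
proof -
  obtain z where z: "c < z" "z < d" "F d - F c = (d - c) * f z"
    using MVT2[of c d F f] primitive assms by force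
  then have "slope c d = f z" using assms by simp
  then show "f c < slope c d" "slope c d < f d" using inc z assms by auto
qed

lemma level_point:
  assumes "a < c" "c < d" "d < b" "f c < m" "m < f d"
  obtains s where "c < s" "s < d" "f s = m" "inv_f m = s"
proof -
  have "\<exists>s\<ge>c. s \<le> d \<and> f s = m"
    by (rule IVT) (use assms cont in auto)
  then obtain s where "c \<le> s" "s \<le> d" "f s = m" by blast
  with assms have "c < s" "s < d" by (metis order_le_less order_less_irrefl)+
  then show thesis using that \<open>f s = m\<close> inv_f_f[of s] assms by auto
qed

lemma isCont_inv_f:
  assumes "a < s" "s < b"
  shows "isCont inv_f (f s)"
proof -
  obtain l r where lr: "a < l" "l < s" "s < r" "r < b"
    using assms dense by meson
  show ?thesis
    by (rule isCont_inverse_function2[of l s r]) (use lr inv_f_f cont in auto)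
qed

text \<open>Convexity of \<open>F\<close> in the form needed for \<open>conjugate\<close>: f s * t -
  F t is maximal at t = s, since its derivative f s - f t changes sign there.\<close>

lemma tangent_below:
  assumes "a < s" "s < b" "a < t" "t < b"
  shows "f s * t - F t \<le> f s * s - F s"
proof -
  consider "t < s" | "t = s" | "s < t" by linarith
  then show ?thesis
  proof cases
    case 1
    then obtain z where z: "t < z" "z < s" "F s - F t = (s - t) * f z"
      using MVT2[of t s F f] primitive assms by force
    have "(s - t) * f z \<le> (s - t) * f s"
      using inc[of z s] z assms 1 by (intro mult_left_mono) auto
    with z show ?thesis by (simp add: algebra_simps)
  next
    case 3
    then obtain z where z: "s < z" "z < t" "F t - F s = (t - s) * f z"
      using MVT2[of s t F f] primitive assms by force
    have "(t - s) * f s \<le> (t - s) * f z"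
      using inc[of s z] z assms 3 by (intro mult_left_mono) auto
    with z show ?thesis by (simp add: algebra_simps)
  qed simp
qed

text \<open>The envelope theorem: the maximiser itself is the derivative of the Legendre transform.\<close>

lemma DERIV_conjugate:
  assumes "a < s" "s < b"
  shows "(conjugate has_real_derivative s) (at (f s))"
proof -
  obtain l r where lr: "a < l" "l < s" "s < r" "r < b"
    using assms dense by meson
  let ?q = "\<lambda>m. (conjugate m - conjugate (f s)) / (m - f s)"
  have tend: "(inv_f \<longlongrightarrow> s) (at (f s))"
    using isCont_inv_f[OF assms] inv_f_f[OF assms] by (simp add: isCont_def)
  have fl: "f l < f s" "f s < f r" using inc lr assms by auto
  have ev: "eventually (\<lambda>m. m \<in> {f l<..<f r} - {f s}) (at (f s))"
    using fl by (intro eventually_at_in_open) auto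
  have bound: "\<bar>?q m - s\<bar> \<le> \<bar>inv_f m - s\<bar>" if m: "m \<in> {f l<..<f r} - {f s}" for m
  proof -
    obtain t where t: "l < t" "t < r" "f t = m" "inv_f m = t"
      using level_point[of l r m] m lr by auto
    \<comment> \<open>Each maximiser is a competitor in the problem of the other. This bounds the
      difference from above with t and from below with s, so the quotient lies between s and
      t.\<close>
    have 1: "conjugate m - conjugate (f s) \<le> t * (m - f s)"
      using tangent_below[of s t] t lr assms inv_f_f[OF assms]
      by (simp add: conjugate_def algebra_simps)
    have 2: "s * (m - f s) \<le> conjugate m - conjugate (f s)"
      using tangent_below[of t s] t lr assms inv_f_f[OF assms]
      by (simp add: conjugate_def algebra_simps)
    have "\<bar>conjugate m - conjugate (f s) - s * (m - f s)\<bar> \<le> \<bar>(t - s) * (m - f s)\<bar>"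
      using 1 2 by (simp add: algebra_simps)
    then have "\<bar>conjugate m - conjugate (f s) - s * (m - f s)\<bar> / \<bar>m - f s\<bar> \<le> \<bar>t - s\<bar>"
      using m by (subst pos_divide_le_eq) (auto simp: abs_mult)
    moreover have "?q m - s = (conjugate m - conjugate (f s) - s * (m - f s)) / (m - f s)"
      using m by (simp add: field_simps)
    ultimately show ?thesis using t by (simp add: abs_divide)
  qed
  have "((\<lambda>m. ?q m - s) \<longlongrightarrow> 0) (at (f s))"
  proof (rule Lim_null_comparison)
    show "((\<lambda>m. \<bar>inv_f m - s\<bar>) \<longlongrightarrow> 0) (at (f s))"
      using tendsto_rabs[OF tendsto_diff[OF tend tendsto_const[of s]]] by simp
    show "eventually (\<lambda>m. norm (?q m - s) \<le> \<bar>inv_f m - s\<bar>) (at (f s))"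
      using ev by eventually_elim (use bound in simp)
  qed
  then show ?thesis
    unfolding has_field_derivative_iff by (simp add: LIM_zero_iff)
qed

text \<open>The level point is hidden inside \<open>conjugate\<close>, which is differentiable
  although the level point is only known to be continuous. So both end points can be
  differentiated.\<close>

lemma M_eq:
  assumes "a < c" "c < d" "d < b"
  shows "M d - M c = 2 * (F c - slope c d * c + conjugate (slope c d)) / (d - c)"
proof -
  obtain s where s: "c < s" "s < d" "f s = slope c d" "inv_f (slope c d) = s"
    using level_point[OF assms slope_bounds[OF assms]] by metis
  have "(d - c) * (M d - M c) = 2 * (F c + f s * (s - c) - F s)"
    using gap s assms by auto
  moreover have "F c - slope c d * c + conjugate (slope c d) = F c + f s * (s - c) - F s"
    unfolding conjugate_def s(3,4) right_diff_distrib by linarith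
  ultimately have "(M d - M c) * (d - c) = 2 * (F c - slope c d * c + conjugate (slope c d))"
    by (metis mult.commute)
  then show ?thesis using assms by (metis diff_gt_0_iff_gt less_irrefl nonzero_eq_divide_eq)
qed

text \<open>By the envelope theorem the motion of the level point s does not contribute: the
  numerator in \<open>M_eq\<close> has derivative s - c times that of the slope. The other term of
  the quotient rule is the increment of \<open>M\<close> again.\<close>

lemma DERIV_M_right:
  assumes "a < c" "c < d" "d < b"
  shows "(M has_real_derivative
           (2 * (inv_f (slope c d) - c) * (f d - slope c d) / (d - c) - (M d - M c)) / (d - c)) (at d)"
proof -
  obtain s where s: "c < s" "s < d" "f s = slope c d" "inv_f (slope c d) = s"
    using level_point[OF assms slope_bounds[OF assms]] by metis
  have K: "(conjugate has_real_derivative s) (at (slope c d))"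
    using DERIV_conjugate[of s] s assms by simp
  define r where "r = (f d - slope c d) / (d - c)"
  have fr: "f d - slope c d = r * (d - c)" using assms by (simp add: r_def)
  have alg: "(2 * (x * y) * L - 2 * z * (1 - 0)) / (L * L) = (2 * x * (y * L) / L - 2 * z / L) / L"
    if "L \<noteq> 0" for x y z L :: real
    using that by (simp add: field_simps)
  have m: "((\<lambda>d. slope c d) has_real_derivative r) (at d)"
    unfolding r_def using assms primitive[of d]
    by (auto intro!: derivative_eq_intros simp: field_simps power2_eq_square)
  have N: "((\<lambda>d. F c - slope c d * c + conjugate (slope c d)) has_real_derivative
      (s - c) * r) (at d)"
    by (rule DERIV_cong[OF DERIV_add[OF DERIV_diff[OF DERIV_const DERIV_cmult_right[OF m]] DERIV_chain2[OF K m]]])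
      (simp add: left_diff_distrib)
  have "((\<lambda>d. M c + 2 * (F c - slope c d * c + conjugate (slope c d)) / (d - c)) has_real_derivative
           (2 * (s - c) * (f d - slope c d) / (d - c) - (M d - M c)) / (d - c)) (at d)"
    unfolding M_eq[OF assms] fr
    by (rule DERIV_cong[OF DERIV_add[OF DERIV_const DERIV_divide[OF DERIV_cmult[OF N, of 2]
          DERIV_diff[OF DERIV_ident DERIV_const]]]])
      (use assms in simp, simp only: add_0_left, rule alg, use assms in simp)
  moreover have "eventually (\<lambda>x. M x = M c + 2 * (F c - slope c x * c + conjugate (slope c x)) / (x - c)) (nhds d)"
  proof -
    have "eventually (\<lambda>x. x \<in> {c<..<b}) (nhds d)"
      using assms by (intro eventually_nhds_in_open) auto
    then show ?thesis
    proof eventually_elim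
      case (elim x)
      then show ?case using M_eq[of c x] assms by simp
    qed
  qed
  ultimately show ?thesis
    using DERIV_cong_ev[OF refl _ refl] s(4) by force
qed

lemma DERIV_M_left:
  assumes "a < c" "c < d" "d < b"
  shows "(M has_real_derivative
           (2 * (d - inv_f (slope c d)) * (slope c d - f c) / (d - c) - (M d - M c)) / (d - c)) (at c)"
proof -
  obtain s where s: "c < s" "s < d" "f s = slope c d" "inv_f (slope c d) = s"
    using level_point[OF assms slope_bounds[OF assms]] by metis
  have K: "(conjugate has_real_derivative s) (at (slope c d))"
    using DERIV_conjugate[of s] s assms by simp
  have alg: "0 - (2 * (- x * (y / L)) * L - 2 * z * (0 - 1)) / (L * L) = (2 * x * y / L - 2 * z / L) / L"
    if "L \<noteq> 0" for x y z L :: real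
    using that by (simp add: field_simps)
  have m: "((\<lambda>c. slope c d) has_real_derivative (slope c d - f c) / (d - c)) (at c)"
    using assms primitive[of c]
    by (auto intro!: derivative_eq_intros simp: field_simps power2_eq_square)
  define G where "G = (\<lambda>c. F c - slope c d * c + conjugate (slope c d))"
  define r where "r = (slope c d - f c) / (d - c)"
  have dc: "d - c \<noteq> 0" using assms by simp
  have "(G has_real_derivative f c - (r * c + 1 * slope c d) + s * r) (at c)"
    unfolding G_def r_def using assms
    by (intro DERIV_add[OF DERIV_diff[OF primitive DERIV_mult[OF m DERIV_ident]] DERIV_chain2[OF K m]]) auto
  \<comment> \<open>The moving end point adds f c - slope c d = - (d - c) * r, which turns (s - c) *
    r into - (d - s) * r.\<close>
  moreover have "f c - (r * c + 1 * slope c d) + s * r = - (d - s) * r"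
  proof -
    have "slope c d - f c = r * (d - c)" using dc by (simp add: r_def)
    then show ?thesis unfolding left_diff_distrib right_diff_distrib by (simp add: algebra_simps)
  qed
  ultimately have N: "(G has_real_derivative - (d - s) * r) (at c)" by simp
  have "((\<lambda>x. d - x) has_real_derivative 0 - 1) (at c)"
    by (intro DERIV_diff DERIV_const DERIV_ident)
  from DERIV_diff[OF DERIV_const[of "M d"] DERIV_divide[OF DERIV_cmult[OF N, of 2] this dc]]
  have "((\<lambda>c. M d - 2 * G c / (d - c)) has_real_derivative
      0 - (2 * (- (d - s) * r) * (d - c) - 2 * G c * (0 - 1)) / ((d - c) * (d - c))) (at c)" .
  also have "0 - (2 * (- (d - s) * r) * (d - c) - 2 * G c * (0 - 1)) / ((d - c) * (d - c)) =
      (2 * (d - s) * (slope c d - f c) / (d - c) - (M d - M c)) / (d - c)"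
    unfolding M_eq[OF assms] G_def r_def by (rule alg[OF dc])
  finally have "((\<lambda>c. M d - 2 * (F c - slope c d * c + conjugate (slope c d)) / (d - c)) has_real_derivative
           (2 * (d - s) * (slope c d - f c) / (d - c) - (M d - M c)) / (d - c)) (at c)"
    unfolding G_def .
  moreover have "eventually (\<lambda>x. M x = M d - 2 * (F x - slope x d * x + conjugate (slope x d)) / (d - x)) (nhds c)"
  proof -
    have "eventually (\<lambda>x. x \<in> {a<..<d}) (nhds c)"
      using assms by (intro eventually_nhds_in_open) auto
    then show ?thesis
    proof eventually_elim
      case (elim x)
      then show ?case using M_eq[of x d] assms by simp
    qed
  qed
  ultimately show ?thesis
    using DERIV_cong_ev[OF refl _ refl] s(4) by force
qed


section \<open>The density of \<open>M\<close> and the differentiability of \<open>f\<close>\<close>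

definition rate :: "real \<Rightarrow> real" where
  "rate x = deriv M x"

lemma DERIV_M:
  assumes "a < x" "x < b"
  shows "(M has_real_derivative rate x) (at x)"
proof -
  obtain c where "a < c" "c < x" using assms dense by blast
  from DERIV_M_right[OF this assms(2)] show ?thesis
    unfolding rate_def by (simp add: DERIV_imp_deriv)
qed

lemma rate_right:
  assumes "a < c" "c < d" "d < b"
  shows "rate d = (2 * (inv_f (slope c d) - c) * (f d - slope c d) / (d - c) - (M d - M c)) / (d - c)"
  unfolding rate_def by (rule DERIV_imp_deriv, rule DERIV_M_right) (use assms in auto)

lemma rate_left:
  assumes "a < c" "c < d" "d < b"
  shows "rate c = (2 * (d - inv_f (slope c d)) * (slope c d - f c) / (d - c) - (M d - M c)) / (d - c)"
  unfolding rate_def by (rule DERIV_imp_deriv, rule DERIV_M_left) (use assms in auto)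

lemma isCont_F: "a < x \<Longrightarrow> x < b \<Longrightarrow> isCont F x"
  using primitive DERIV_isCont by blast

lemma isCont_M: "a < x \<Longrightarrow> x < b \<Longrightarrow> isCont M x"
  using DERIV_M DERIV_isCont by blast

text \<open>For a fixed left end c, every ingredient of \<open>rate_right\<close> is continuous in
  d, the level point included.\<close>

lemma isCont_rate:
  assumes "a < d" "d < b"
  shows "isCont rate d"
proof -
  obtain c where c: "a < c" "c < d" using assms dense by blast
  obtain s where s: "c < s" "s < d" "f s = slope c d" "inv_f (slope c d) = s"
    using level_point[OF c assms(2) slope_bounds[OF c assms(2)]] by metis
  have sl: "isCont (\<lambda>x. slope c x) d"
    using c assms isCont_F by (intro continuous_intros) auto
  have "isCont inv_f (slope c d)"
    using isCont_inv_f[of s] s c assms by simp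
  from isCont_o2[OF sl this] have "isCont (\<lambda>x. inv_f (slope c x)) d" .
  then have 1: "isCont (\<lambda>x. (2 * (inv_f (slope c x) - c) * (f x - slope c x) / (x - c) - (M x - M c)) / (x - c)) d"
    using sl isCont_M[of d] cont[of d] isCont_F[of d] c assms by (intro continuous_intros) auto
  have 2: "eventually (\<lambda>x. (2 * (inv_f (slope c x) - c) * (f x - slope c x) / (x - c) - (M x - M c)) / (x - c) = rate x) (nhds d)"
  proof -
    have "eventually (\<lambda>x. x \<in> {c<..<b}) (nhds d)"
      using c assms by (intro eventually_nhds_in_open) auto
    then show ?thesis
    proof eventually_elim
      case (elim x)
      then show ?case using rate_right[of c x] c by simp
    qed
  qed
  show ?thesis
    by (rule iffD1[OF isCont_cong[OF 2] 1])
qed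

text \<open>The contributions of the two end points are divided by the fractions \<open>q\<close> and \<open>1 - q\<close> of the interval on
  either side of the level point, and \<open>1/q + 1/(1 - q) \<ge> 4\<close>.\<close>

lemma increment_ge:
  assumes cd: "a < c" "c < d" "d < b" and k: "\<And>x. c \<le> x \<Longrightarrow> x \<le> d \<Longrightarrow> k \<le> rate x"
  shows "4 * k * (d - c) \<le> f d - f c"
proof -
  obtain s where s: "c < s" "s < d" "f s = slope c d" "inv_f (slope c d) = s"
    using level_point[OF cd slope_bounds[OF cd]] by metis
  define L q m where "L = d - c" and "q = (s - c) / L" and "m = slope c d"
  have L: "L > 0" using cd L_def by simp
  have q: "0 < q" "q < 1" using s L by (auto simp: q_def L_def divide_simps)
  \<comment> \<open>The increment of \<open>M\<close> is itself L times a value of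
    \<open>rate\<close>, so the hypothesis bounds both terms of each end point formula by L *
    k.\<close>
  obtain z where z: "c < z" "z < d" "M d - M c = L * rate z"
    using MVT2[of c d M rate] DERIV_M cd unfolding L_def by force
  have q': "1 - q = (d - s) / L" using L by (simp add: q_def L_def field_simps)
  have "rate d = (2 * q * (f d - m) - L * rate z) / L"
    unfolding rate_right[OF cd] s(4) q_def m_def z(3) L_def by simp
  then have "2 * q * (f d - m) = L * rate d + L * rate z"
    using L by (simp add: field_simps)
  also have "\<dots> \<ge> L * k + L * k"
    using k[of d] k[of z] z cd L by (intro add_mono mult_left_mono) auto
  finally have 1: "L * k \<le> q * (f d - m)" by simp
  have "rate c = (2 * (1 - q) * (m - f c) - L * rate z) / L"
    unfolding rate_left[OF cd] s(4) q' m_def z(3) L_def by simp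
  then have "2 * (1 - q) * (m - f c) = L * rate c + L * rate z"
    using L by (simp add: field_simps)
  also have "\<dots> \<ge> L * k + L * k"
    using k[of c] k[of z] z cd L by (intro add_mono mult_left_mono) auto
  finally have 2: "L * k \<le> (1 - q) * (m - f c)" unfolding mult.assoc by linarith
  show ?thesis
  proof (cases "k \<le> 0")
    case True
    then have "4 * k * (d - c) \<le> 0" using cd by (simp add: mult_nonpos_nonneg)
    also have "0 \<le> f d - f c" using inc[of c d] cd by simp
    finally show ?thesis .
  next
    case False
    have "(L * k) / q + (L * k) / (1 - q) \<le> (f d - m) + (m - f c)"
      using 1 2 q by (intro add_mono) (auto simp: divide_simps mult.commute)
    moreover have "4 * (L * k) \<le> (L * k) / q + (L * k) / (1 - q)"
    proof -
      have "0 \<le> (1 - 2 * q)\<^sup>2" by simp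
      then have "4 * (q * (1 - q)) \<le> 1" by (simp add: power2_eq_square algebra_simps)
      then have "4 \<le> 1 / (q * (1 - q))" using q by (simp add: divide_simps)
      then have "4 * (L * k) \<le> 1 / (q * (1 - q)) * (L * k)"
        using False L by (intro mult_right_mono) auto
      also have "\<dots> = (L * k) / q + (L * k) / (1 - q)"
        using q by (simp add: divide_simps) (simp add: algebra_simps)
      finally show ?thesis .
    qed
    ultimately have "4 * (L * k) \<le> f d - f c" by linarith
    then show ?thesis by (simp add: L_def ac_simps)
  qed
qed

text \<open>The lower estimate is \<open>increment_ge\<close> with k - e, the upper one
  \<open>increment_le\<close> with the mean value theorem for \<open>M\<close>. Both carry the same
  constant 4, and this agreement makes \<open>f\<close> differentiable.\<close>

lemma increment_deviation:
  assumes cd: "a < c" "c < d" "d < b" and k: "\<And>x. c \<le> x \<Longrightarrow> x \<le> d \<Longrightarrow> \<bar>rate x - k\<bar> \<le> e"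
  shows "\<bar>f d - f c - 4 * k * (d - c)\<bar> \<le> 4 * e * (d - c)"
proof -
  have 1: "4 * (k - e) * (d - c) \<le> f d - f c"
    using k by (intro increment_ge cd) (force simp: abs_le_iff)
  obtain z where z: "c < z" "z < d" "M d - M c = (d - c) * rate z"
    using MVT2[of c d M rate] DERIV_M cd by force
  have "f d - f c \<le> 4 * (M d - M c)" by (rule increment_le[OF cd])
  also have "\<dots> \<le> 4 * ((d - c) * (k + e))"
    unfolding z(3) using k[of z] z cd by (intro mult_left_mono) auto
  finally show ?thesis using 1 by (simp add: algebra_simps abs_le_iff)
qed

lemma DERIV_f:
  assumes x: "a < x" "x < b"
  shows "(f has_real_derivative 4 * rate x) (at x)"
  unfolding has_field_derivative_def has_derivative_at_alt
proof (intro conjI allI impI)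
  show "bounded_linear ((*) (4 * rate x))"
    by (rule bounded_linear_mult_right)
next
  fix e :: real assume e: "0 < e"
  have "\<forall>e>0. \<exists>r>0. \<forall>y. dist y x < r \<longrightarrow> dist (rate y) (rate x) < e"
    using isCont_rate[OF x] unfolding continuous_at_eps_delta by (simp add: dist_real_def)
  then obtain r where r: "r > 0" "\<And>y. \<bar>y - x\<bar> < r \<Longrightarrow> \<bar>rate y - rate x\<bar> < e / 4"
    using e by (metis dist_real_def zero_less_divide_iff zero_less_numeral)
  show "\<exists>r>0. \<forall>y. norm (y - x) < r \<longrightarrow> norm (f y - f x - 4 * rate x * (y - x)) \<le> e * norm (y - x)"
  proof (intro exI[of _ "min r (min (x - a) (b - x))"] conjI allI impI)
    fix y assume y: "norm (y - x) < min r (min (x - a) (b - x))"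
    consider "y < x" | "y = x" | "x < y" by linarith
    then show "norm (f y - f x - 4 * rate x * (y - x)) \<le> e * norm (y - x)"
    proof cases
      case 1
      have "\<bar>f x - f y - 4 * rate x * (x - y)\<bar> \<le> 4 * (e / 4) * (x - y)"
        using y x 1 by (intro increment_deviation less_imp_le[OF r(2)]) auto
      then show ?thesis using 1 by (simp add: algebra_simps abs_minus_commute abs_le_iff)
    next
      case 3
      have "\<bar>f y - f x - 4 * rate x * (y - x)\<bar> \<le> 4 * (e / 4) * (y - x)"
        using y x 3 by (intro increment_deviation less_imp_le[OF r(2)]) auto
      then show ?thesis using 3 by simp
    qed simp
  qed (use r x in auto)
qed

lemma increment_eq:
  assumes "a < c" "c < d" "d < b"
  shows "f d - f c = 4 * (M d - M c)"
proof -
  have "\<exists>z>c. z < d \<and> (f d - 4 * M d) - (f c - 4 * M c) = (d - c) * (4 * rate z - 4 * rate z)"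
  proof (rule MVT2[OF assms(2)])
    fix x assume "c \<le> x" "x \<le> d"
    then have "a < x" "x < b" using assms by auto
    then show "((\<lambda>x. f x - 4 * M x) has_real_derivative 4 * rate x - 4 * rate x) (at x)"
      by (intro DERIV_diff DERIV_f DERIV_cmult DERIV_M)
  qed
  then show ?thesis by auto
qed

text \<open>With q the relative position of the level point, the end point formulas read
  \<open>L\<^sup>2 * u d = 8 * q * X - (X + Y)\<close> and
  \<open>L\<^sup>2 * u c = 8 * (1 - q) * Y - (X + Y)\<close>. Multiplying by \<open>Y\<close> and
  \<open>X\<close> and adding eliminates q.\<close>

lemma endpoint_identity:
  fixes c d :: real
  defines "L \<equiv> d - c" and "u \<equiv> \<lambda>x. 4 * rate x"
  defines "X \<equiv> L * f d - (F d - F c)" and "Y \<equiv> F d - F c - L * f c"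
  assumes cd: "a < c" "c < d" "d < b"
  shows "(X + Y)\<^sup>2 + L\<^sup>2 * (u c * X + u d * Y) = 8 * X * Y"
proof -
  obtain s where s: "c < s" "s < d" "f s = slope c d" "inv_f (slope c d) = s"
    using level_point[OF cd slope_bounds[OF cd]] by metis
  have L: "L > 0" using cd L_def by simp
  define q where "q = (s - c) / L"
  have q': "1 - q = (d - s) / L" using L by (simp add: q_def L_def field_simps)
  have M: "M d - M c = (f d - f c) / 4" using increment_eq[OF cd] by simp
  have X: "f d - slope c d = X / L" and Y: "slope c d - f c = Y / L"
    using L by (auto simp: X_def Y_def L_def field_simps)
  have XY: "X + Y = L * (f d - f c)" by (simp add: X_def Y_def algebra_simps)
  have "rate d = (2 * (s - c) * (X / L) / L - (f d - f c) / 4) / L"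
    using rate_right[OF cd] unfolding s(4) X M L_def .
  also have "\<dots> = (2 * q * (X / L) - (f d - f c) / 4) / L"
    by (simp add: q_def)
  finally have "L\<^sup>2 * u d = 8 * q * X - (X + Y)"
    unfolding XY u_def using L by (simp add: field_simps power2_eq_square)
  then have 1: "L\<^sup>2 * u d * Y = 8 * q * X * Y - (X + Y) * Y" by (simp add: left_diff_distrib)
  have "rate c = (2 * (d - s) * (Y / L) / L - (f d - f c) / 4) / L"
    using rate_left[OF cd] unfolding s(4) Y M L_def .
  also have "\<dots> = (2 * (1 - q) * (Y / L) - (f d - f c) / 4) / L"
    by (simp add: q')
  finally have "L\<^sup>2 * u c = 8 * (1 - q) * Y - (X + Y)"
    unfolding XY u_def using L by (simp add: field_simps power2_eq_square)
  then have 2: "L\<^sup>2 * u c * X = 8 * (1 - q) * Y * X - (X + Y) * X" by (simp only: left_diff_distrib[of "8 * (1 - q) * Y"])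
  have "L\<^sup>2 * (u c * X + u d * Y) = L\<^sup>2 * u c * X + L\<^sup>2 * u d * Y" by (simp add: algebra_simps)
  also have "\<dots> = 8 * X * Y - (X + Y)\<^sup>2"
    unfolding 1 2 by (simp add: algebra_simps power2_eq_square)
  finally show ?thesis by simp
qed


section \<open>Regularity of the density and its differential equation\<close>

definition u :: "real \<Rightarrow> real" where
  "u x = 4 * rate x"

text \<open>By parts, \<open>X c d\<close> is the integral of (t - c) * u t over (c, d) and
  \<open>Y c d\<close> that of (d - t) * u t. So \<open>XY_identity\<close> is an integral equation
  for \<open>u\<close>.\<close>

definition X :: "real \<Rightarrow> real \<Rightarrow> real" where
  "X c d = (d - c) * f d - (F d - F c)"

definition Y :: "real \<Rightarrow> real \<Rightarrow> real" where
  "Y c d = F d - F c - (d - c) * f c"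

lemma XY_identity:
  assumes "a < c" "c < d" "d < b"
  shows "(X c d + Y c d)\<^sup>2 + (d - c)\<^sup>2 * (u c * X c d + u d * Y c d) = 8 * X c d * Y c d"
  using endpoint_identity[OF assms] by (simp add: u_def X_def Y_def)

lemma DERIV_f_u: "a < x \<Longrightarrow> x < b \<Longrightarrow> (f has_real_derivative u x) (at x)"
  using DERIV_f by (simp add: u_def)

lemma u_nonneg:
  assumes "a < x" "x < b"
  shows "0 \<le> u x"
proof (rule ccontr)
  assume "\<not> 0 \<le> u x"
  then obtain e where e: "e > 0" "\<And>h. 0 < h \<Longrightarrow> h < e \<Longrightarrow> f (x + h) < f x"
    using DERIV_neg_dec_right[OF DERIV_f_u[OF assms]] by auto
  define h where "h = min (e / 2) ((b - x) / 2)"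
  have "0 < h" "h < e" "x + h < b" using e assms by (auto simp: h_def min_def field_simps)
  then show False using e(2)[of h] inc[of x "x + h"] assms by simp
qed

lemma DERIV_X: "a < d \<Longrightarrow> d < b \<Longrightarrow> (X c has_real_derivative (d - c) * u d) (at d)"
  unfolding X_def by (auto intro!: derivative_eq_intros primitive DERIV_f_u)

lemma DERIV_Y: "a < d \<Longrightarrow> d < b \<Longrightarrow> (Y c has_real_derivative f d - f c) (at d)"
  unfolding Y_def by (auto intro!: derivative_eq_intros primitive)

lemma Y_pos:
  assumes "a < c" "c < d" "d < b"
  shows "0 < Y c d"
  using slope_bounds(1)[OF assms] assms by (simp add: Y_def field_simps)

text \<open>Solving the identity for \<open>u d\<close> with \<open>c\<close> fixed expresses \<open>u\<close> through its own integrals, which bootstraps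
  its regularity.\<close>

definition num :: "real \<Rightarrow> real \<Rightarrow> real" where
  "num c d = 8 * X c d * Y c d - (X c d + Y c d)\<^sup>2 - u c * (d - c)\<^sup>2 * X c d"

definition den :: "real \<Rightarrow> real \<Rightarrow> real" where
  "den c d = (d - c)\<^sup>2 * Y c d"

definition num' :: "real \<Rightarrow> real \<Rightarrow> real" where
  "num' c d = 8 * ((d - c) * u d * Y c d + X c d * (f d - f c))
     - 2 * (X c d + Y c d) * ((d - c) * u d + (f d - f c))
     - u c * (2 * (d - c) * X c d + (d - c)\<^sup>2 * ((d - c) * u d))"

definition den' :: "real \<Rightarrow> real \<Rightarrow> real" where
  "den' c d = 2 * (d - c) * Y c d + (d - c)\<^sup>2 * (f d - f c)"

lemma den_pos:
  assumes "a < c" "c < d" "d < b"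
  shows "0 < den c d"
  using Y_pos[OF assms] assms by (simp add: den_def)

lemma u_eq:
  assumes "a < c" "c < d" "d < b"
  shows "u d = num c d / den c d"
proof -
  have "u d * den c d = num c d"
    using XY_identity[OF assms] unfolding num_def den_def by (simp add: algebra_simps)
  then show ?thesis using den_pos[OF assms] by (simp add: field_simps)
qed

lemma DERIV_num: "a < d \<Longrightarrow> d < b \<Longrightarrow> (num c has_real_derivative num' c d) (at d)"
  unfolding num_def num'_def
  by (auto intro!: derivative_eq_intros DERIV_X DERIV_Y simp: algebra_simps power2_eq_square)

lemma DERIV_den: "a < d \<Longrightarrow> d < b \<Longrightarrow> (den c has_real_derivative den' c d) (at d)"
  unfolding den_def den'_def
  by (auto intro!: derivative_eq_intros DERIV_Y simp: algebra_simps power2_eq_square)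

lemma eventually_between:
  assumes "c < d" "d < b"
  shows "eventually (\<lambda>x::real. c < x \<and> x < b) (nhds d)"
proof -
  have "eventually (\<lambda>x. x \<in> {c<..<b}) (nhds d)"
    using assms by (intro eventually_nhds_in_open) auto
  then show ?thesis by simp
qed

lemma DERIV_u:
  assumes "a < c" "c < d" "d < b"
  shows "(u has_real_derivative (num' c d * den c d - num c d * den' c d) / (den c d * den c d)) (at d)"
proof -
  have ev: "eventually (\<lambda>x. u x = num c x / den c x) (nhds d)"
    using eventually_between[OF assms(2,3)] by eventually_elim (use u_eq assms in auto)
  show ?thesis
    unfolding DERIV_cong_ev[OF refl ev refl]
    using assms den_pos[OF assms] by (intro DERIV_divide DERIV_num DERIV_den) auto
qed

lemma DERIV_deriv_u:
  assumes "a < d" "d < b"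
  shows "(u has_real_derivative deriv u d) (at d)"
proof -
  obtain c where c: "a < c" "c < d" using assms dense by blast
  show ?thesis
    using DERIV_u[OF c assms(2)] DERIV_imp_deriv by metis
qed

text \<open>\<open>num'\<close> and \<open>den'\<close> are built from \<open>u\<close>,
  \<open>f\<close>, \<open>X\<close> and \<open>Y\<close>, all of which are differentiable by now,
  so the quotient formula for \<open>deriv u\<close> can be differentiated once more.\<close>

lemma DERIV_deriv2_u:
  assumes "a < d" "d < b"
  obtains u2 where "(deriv u has_real_derivative u2) (at d)"
proof -
  obtain c where c: "a < c" "c < d" using assms dense by blast
  have ev: "eventually (\<lambda>x. deriv u x = (num' c x * den c x - num c x * den' c x) / (den c x * den c x)) (nhds d)"
    using eventually_between[OF c(2) assms(2)]
    by eventually_elim (use DERIV_imp_deriv[OF DERIV_u] c in auto)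
  have diff: "X c differentiable at d" "Y c differentiable at d" "u differentiable at d" "f differentiable at d"
      "num c differentiable at d" "den c differentiable at d"
    by (rule iffD2[OF real_differentiable_def], rule exI, rule DERIV_X DERIV_Y DERIV_deriv_u DERIV_f_u DERIV_num DERIV_den; rule assms)+
  have "num' c differentiable at d" "den' c differentiable at d"
    unfolding num'_def den'_def by (intro derivative_intros diff)+
  then have "(\<lambda>x. (num' c x * den c x - num c x * den' c x) / (den c x * den c x)) differentiable at d"
    using den_pos[OF c assms(2)] by (intro derivative_intros diff) auto
  then obtain D where "((\<lambda>x. (num' c x * den c x - num c x * den' c x) / (den c x * den c x)) has_real_derivative D) (at d)"
    using real_differentiable_def by blast
  then show thesis
    using that DERIV_cong_ev[OF refl ev refl] by blast
qed

text \<open>On (c, c + h) the terms of order h^4 and h^5 in the identity cancel by themselves; the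
  coefficient of h^6 tends to u0 * u2 / 12 - u1^2 / 36.\<close>

lemma second_order_ode:
  assumes c: "a < c" "c < b" and u2: "(deriv u has_real_derivative u2) (at c)"
  shows "3 * u c * u2 = (deriv u c)\<^sup>2"
proof -
  let ?R = "at_right (0::real)"
  define u0 u1 where "u0 = u c" and "u1 = deriv u c"
  have ev: "eventually (\<lambda>h. 0 < h \<and> h < b - c) ?R"
    using eventually_at_right_real[of 0 "b - c"] c by simp
  have ev_n0: "eventually (\<lambda>h. k * h ^ n \<noteq> 0) ?R" if "k \<noteq> 0" for n and k :: real
    using ev by eventually_elim (use that in auto)
  have ev_D: "eventually (\<lambda>h. DERIV (\<lambda>h. g (c + h)) h :> g' (c + h)) ?R"
    if "\<And>x. a < x \<Longrightarrow> x < b \<Longrightarrow> DERIV g x :> g' x" for g g' :: "real \<Rightarrow> real"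
    using ev
  proof eventually_elim
    case (elim h)
    then have "DERIV g (h + c) :> g' (h + c)" using that c by simp
    then show ?case using DERIV_shift[of g _ h c] by (simp add: add.commute)
  qed
  have lim0: "((\<lambda>h. g (c + h)) \<longlongrightarrow> g c) ?R" if "isCont g c" for g :: "real \<Rightarrow> real"
    using that by (simp add: isCont_iff filterlim_at_split)
  have cont_c: "isCont u c" "isCont f c" "isCont (X c) c" "isCont (Y c) c"
    by (rule DERIV_isCont, rule DERIV_deriv_u DERIV_f_u DERIV_X DERIV_Y; rule c)+

  have ev_deriv:
    "eventually (\<lambda>h. DERIV (\<lambda>h. u (c + h)) h :> deriv u (c + h)) ?R"
    "eventually (\<lambda>h. DERIV (\<lambda>h. f (c + h)) h :> u (c + h)) ?R"
    "eventually (\<lambda>h. DERIV (\<lambda>h. X c (c + h)) h :> (c + h - c) * u (c + h)) ?R"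
    "eventually (\<lambda>h. DERIV (\<lambda>h. Y c (c + h)) h :> f (c + h) - f c) ?R"
    by (rule ev_D, rule DERIV_deriv_u DERIV_f_u DERIV_X DERIV_Y; assumption)+

  \<comment> \<open>\<open>v2\<close>, \<open>x2\<close>, \<open>f2\<close> and \<open>y2\<close>
    are normalised Taylor remainders. The first limit comes from the definition of u2, those of
    \<open>x2\<close> and \<open>f2\<close> from \<open>v2\<close>, and that of \<open>y2\<close>
    from \<open>f2\<close>, so the second derivative is used at c only.\<close>
  define v2 where "v2 h = (u (c + h) - u0 - u1 * h) / h\<^sup>2" for h
  have v2: "(v2 \<longlongrightarrow> u2 / 2) ?R"
    unfolding v2_def
  proof (rule lhopital_right_0)
    show "((\<lambda>h. u (c + h) - u0 - u1 * h) \<longlongrightarrow> 0) ?R"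
      by (rule tendsto_eq_intros lim0 cont_c refl)+ (simp add: u0_def)
    show "((\<lambda>h. h\<^sup>2) \<longlongrightarrow> (0::real)) ?R" by (rule tendsto_eq_intros refl)+ simp
    show "eventually (\<lambda>h::real. h\<^sup>2 \<noteq> 0) ?R" "eventually (\<lambda>h::real. 2 * h \<noteq> 0) ?R"
      using ev_n0[of 1 2] ev_n0[of 2 1] by auto
    show "eventually (\<lambda>h. DERIV (\<lambda>h. u (c + h) - u0 - u1 * h) h :> deriv u (c + h) - u1) ?R"
      using ev_deriv(1) by eventually_elim (auto intro!: derivative_eq_intros)
    show "eventually (\<lambda>h. DERIV (\<lambda>h. h\<^sup>2) h :> 2 * h) ?R"
      by (auto intro!: derivative_eq_intros always_eventually)
    have "((\<lambda>h. (deriv u (c + h) - deriv u c) / h) \<longlongrightarrow> u2) ?R"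
      using u2 unfolding DERIV_def filterlim_at_split by blast
    from tendsto_mult[OF this tendsto_const[of "1/2"]]
    show "((\<lambda>h. (deriv u (c + h) - u1) / (2 * h)) \<longlongrightarrow> u2 / 2) ?R"
      by (simp add: u1_def mult.commute)
  qed

  define x2 where "x2 h = (X c (c + h) - u0 * h\<^sup>2 / 2 - u1 * h ^ 3 / 3) / h ^ 4" for h
  have x2: "(x2 \<longlongrightarrow> u2 / 8) ?R"
    unfolding x2_def
  proof (rule lhopital_right_0)
    show "((\<lambda>h. X c (c + h) - u0 * h\<^sup>2 / 2 - u1 * h ^ 3 / 3) \<longlongrightarrow> 0) ?R"
      by (rule tendsto_eq_intros lim0 cont_c refl | simp add: X_def)+
    show "((\<lambda>h. h ^ 4) \<longlongrightarrow> (0::real)) ?R" by (rule tendsto_eq_intros refl)+ simp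
    show "eventually (\<lambda>h::real. h ^ 4 \<noteq> 0) ?R" "eventually (\<lambda>h::real. 4 * h ^ 3 \<noteq> 0) ?R"
      using ev_n0[of 1 4] ev_n0[of 4 3] by auto
    show "eventually (\<lambda>h. DERIV (\<lambda>h. X c (c + h) - u0 * h\<^sup>2 / 2 - u1 * h ^ 3 / 3) h :>
        (c + h - c) * u (c + h) - u0 * h - u1 * h\<^sup>2) ?R"
      using ev_deriv(3) by eventually_elim (auto intro!: derivative_eq_intros simp: power2_eq_square)
    show "eventually (\<lambda>h. DERIV (\<lambda>h. h ^ 4) h :> 4 * h ^ 3) ?R"
      by (auto intro!: derivative_eq_intros always_eventually)
    have "((\<lambda>h. v2 h / 4) \<longlongrightarrow> u2 / 2 / 4) ?R" by (intro tendsto_intros v2) simp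
    moreover have "eventually (\<lambda>h. v2 h / 4 = ((c + h - c) * u (c + h) - u0 * h - u1 * h\<^sup>2) / (4 * h ^ 3)) ?R"
      using ev by eventually_elim (simp add: v2_def divide_simps power2_eq_square power3_eq_cube algebra_simps)
    ultimately show "((\<lambda>h. ((c + h - c) * u (c + h) - u0 * h - u1 * h\<^sup>2) / (4 * h ^ 3)) \<longlongrightarrow> u2 / 8) ?R"
      using Lim_transform_eventually by fastforce
  qed

  define f2 where "f2 h = (f (c + h) - f c - u0 * h - u1 * h\<^sup>2 / 2) / h ^ 3" for h
  have f2: "(f2 \<longlongrightarrow> u2 / 6) ?R"
    unfolding f2_def
  proof (rule lhopital_right_0)
    show "((\<lambda>h. f (c + h) - f c - u0 * h - u1 * h\<^sup>2 / 2) \<longlongrightarrow> 0) ?R"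
      by (rule tendsto_eq_intros lim0 cont_c refl | simp)+
    show "((\<lambda>h. h ^ 3) \<longlongrightarrow> (0::real)) ?R" by (rule tendsto_eq_intros refl)+ simp
    show "eventually (\<lambda>h::real. h ^ 3 \<noteq> 0) ?R" "eventually (\<lambda>h::real. 3 * h ^ 2 \<noteq> 0) ?R"
      using ev_n0[of 1 3] ev_n0[of 3 2] by auto
    show "eventually (\<lambda>h. DERIV (\<lambda>h. f (c + h) - f c - u0 * h - u1 * h\<^sup>2 / 2) h :> u (c + h) - u0 - u1 * h) ?R"
      using ev_deriv(2) by eventually_elim (auto intro!: derivative_eq_intros)
    show "eventually (\<lambda>h. DERIV (\<lambda>h. h ^ 3) h :> 3 * h ^ 2) ?R"
      by (auto intro!: derivative_eq_intros always_eventually)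
    have "((\<lambda>h. v2 h / 3) \<longlongrightarrow> u2 / 2 / 3) ?R" by (intro tendsto_intros v2) simp
    then show "((\<lambda>h. (u (c + h) - u0 - u1 * h) / (3 * h\<^sup>2)) \<longlongrightarrow> u2 / 6) ?R"
      by (simp add: v2_def mult.commute)
  qed

  define y2 where "y2 h = (Y c (c + h) - u0 * h\<^sup>2 / 2 - u1 * h ^ 3 / 6) / h ^ 4" for h
  have y2: "(y2 \<longlongrightarrow> u2 / 24) ?R"
    unfolding y2_def
  proof (rule lhopital_right_0)
    show "((\<lambda>h. Y c (c + h) - u0 * h\<^sup>2 / 2 - u1 * h ^ 3 / 6) \<longlongrightarrow> 0) ?R"
      by (rule tendsto_eq_intros lim0 cont_c refl | simp add: Y_def)+
    show "((\<lambda>h. h ^ 4) \<longlongrightarrow> (0::real)) ?R" by (rule tendsto_eq_intros refl)+ simp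
    show "eventually (\<lambda>h::real. h ^ 4 \<noteq> 0) ?R" "eventually (\<lambda>h::real. 4 * h ^ 3 \<noteq> 0) ?R"
      using ev_n0[of 1 4] ev_n0[of 4 3] by auto
    show "eventually (\<lambda>h. DERIV (\<lambda>h. Y c (c + h) - u0 * h\<^sup>2 / 2 - u1 * h ^ 3 / 6) h :>
        f (c + h) - f c - u0 * h - u1 * h\<^sup>2 / 2) ?R"
      using ev_deriv(4) by eventually_elim (auto intro!: derivative_eq_intros simp: power2_eq_square)
    show "eventually (\<lambda>h. DERIV (\<lambda>h. h ^ 4) h :> 4 * h ^ 3) ?R"
      by (auto intro!: derivative_eq_intros always_eventually)
    have "((\<lambda>h. f2 h / 4) \<longlongrightarrow> u2 / 6 / 4) ?R" by (intro tendsto_intros f2) simp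
    then show "((\<lambda>h. (f (c + h) - f c - u0 * h - u1 * h\<^sup>2 / 2) / (4 * h ^ 3)) \<longlongrightarrow> u2 / 24) ?R"
      by (simp add: f2_def mult.commute)
  qed

  \<comment> \<open>The exact quotient of the defect of the identity by h^6, with the remainders
    substituted; no term is truncated.\<close>
  define K where "K h = - u0 * (x2 h + y2 h) + u0 * v2 h / 2 - u1\<^sup>2 / 36
     + h * (2 * (x2 h + y2 h) * u1 / 2 + u1 * y2 h + v2 h * u1 / 6 - 8 * (u1 / 3 * y2 h + u1 / 6 * x2 h))
     + h\<^sup>2 * ((x2 h + y2 h)\<^sup>2 + v2 h * y2 h - 8 * x2 h * y2 h)" for h
  have "eventually (\<lambda>h. K h = 0) ?R"
    using ev
  proof eventually_elim
    case (elim h)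
    define p q r where "p = x2 h" and "q = y2 h" and "r = v2 h"
    have h0: "h \<noteq> 0" using elim by simp
    have Xh: "X c (c + h) = h\<^sup>2 * (u0 / 2 + u1 * h / 3 + p * h\<^sup>2)"
      using h0 by (simp add: x2_def p_def field_simps power2_eq_square power3_eq_cube power4_eq_xxxx)
    have Yh: "Y c (c + h) = h\<^sup>2 * (u0 / 2 + u1 * h / 6 + q * h\<^sup>2)"
      using h0 by (simp add: y2_def q_def field_simps power2_eq_square power3_eq_cube power4_eq_xxxx)
    have uh: "u (c + h) = u0 + u1 * h + r * h\<^sup>2"
      using h0 by (simp add: v2_def r_def)
    have "0 = (X c (c + h) + Y c (c + h))\<^sup>2 + h\<^sup>2 * (u c * X c (c + h) + u (c + h) * Y c (c + h))
        - 8 * X c (c + h) * Y c (c + h)"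
      using XY_identity[of c "c + h"] elim c by simp
    also have "\<dots> = h ^ 6 * K h"
      unfolding Xh Yh uh K_def u0_def[symmetric] p_def[symmetric] q_def[symmetric] r_def[symmetric]
      by (simp add: field_simps eval_nat_numeral)
    finally show "K h = 0" using h0 by simp
  qed
  then have "(K \<longlongrightarrow> 0) ?R" by (simp add: tendsto_eventually)
  moreover have "(K \<longlongrightarrow> - u0 * (u2 / 8 + u2 / 24) + u0 * (u2 / 2) / 2 - u1\<^sup>2 / 36) ?R"
    unfolding K_def by (rule tendsto_eq_intros x2 y2 v2 refl | simp)+
  ultimately have "- u0 * (u2 / 8 + u2 / 24) + u0 * (u2 / 2) / 2 - u1\<^sup>2 / 36 = 0"
    using tendsto_unique[of ?R] by fastforce
  then show ?thesis by (simp add: u0_def u1_def field_simps)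
qed


lemma deriv_u_eq_0:
  assumes x0: "a < x0" "x0 < b"
  shows "deriv u x0 = 0"
proof (rule ccontr)
  assume nz: "deriv u x0 \<noteq> 0"
  have ode: "3 * u x * u2 = (deriv u x)\<^sup>2" if "a < x" "x < b" "(deriv u has_real_derivative u2) (at x)" for x u2
    using second_order_ode that by blast
  \<comment> \<open>The differential equation forces \<open>deriv u\<close> to vanish wherever
    \<open>u\<close> does, so \<open>u\<close> is positive near x0 and real powers of it are smooth
    enough to differentiate.\<close>
  have "u x0 \<noteq> 0"
    using nz ode[OF x0] DERIV_deriv2_u[OF x0] by (metis mult_zero_left mult_zero_right power_eq_0_iff)
  then have "u x0 > 0" using u_nonneg[OF x0] by simp
  have "isCont u x0" using DERIV_deriv_u[OF x0] DERIV_isCont by blast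
  then have "eventually (\<lambda>x. u x > 0) (nhds x0)"
    using order_tendstoD(1)[of u "u x0" "nhds x0" 0] \<open>u x0 > 0\<close> by (simp add: continuous_at tendsto_nhds_iff)
  moreover have "eventually (\<lambda>x. x \<in> {a<..<b}) (nhds x0)"
    using x0 by (intro eventually_nhds_in_open) auto
  ultimately have "eventually (\<lambda>x. u x > 0 \<and> a < x \<and> x < b) (nhds x0)"
    by eventually_elim auto
  then obtain e where e: "e > 0" "\<And>x. dist x x0 < e \<Longrightarrow> u x > 0 \<and> a < x \<and> x < b"
    unfolding eventually_nhds_metric by blast
  define J where "J = {x0 - e<..<x0 + e}"
  have J: "0 < u x" "a < x" "x < b" if "x \<in> J" for x
    using e(2)[of x] that by (auto simp: J_def dist_real_def)
  have const: "g x = g y"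
    if "\<And>x. x \<in> J \<Longrightarrow> (g has_real_derivative 0) (at x)" "x \<in> J" "y \<in> J" for g :: "real \<Rightarrow> real" and x y
    using DERIV_isconst3[of "x0 - e" "x0 + e" x y g] that e(1) by (auto simp: J_def)
  have x0J: "x0 \<in> J" using e by (simp add: J_def)

  \<comment> \<open>This is 3/2 times the derivative of u^(2/3). Differentiating it produces the
    factor that vanishes by the differential equation.\<close>
  define w1 where "w1 x = u x powr (-1/3) * deriv u x" for x
  have "(w1 has_real_derivative 0) (at x)" if x: "x \<in> J" for x
  proof -
    obtain u2 where u2: "(deriv u has_real_derivative u2) (at x)"
      using DERIV_deriv2_u J[OF x] by blast
    have "((\<lambda>x. u x powr (-1/3)) has_real_derivative (-1/3) * u x powr (-1/3 - 1) * deriv u x) (at x)"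
      by (rule DERIV_chain2[OF has_real_derivative_powr DERIV_deriv_u]) (use J[OF x] in auto)
    from DERIV_mult[OF this u2]
    have "(w1 has_real_derivative ((-1/3) * u x powr (-1/3 - 1) * deriv u x) * deriv u x + u2 * u x powr (-1/3)) (at x)"
      unfolding w1_def .
    moreover have "u x powr (-1/3) = u x powr (-1/3 - 1) * u x"
      using J(1)[OF x] powr_add[of "u x" "-1/3 - 1" 1] by simp
    then have "((-1/3) * u x powr (-1/3 - 1) * deriv u x) * deriv u x + u2 * u x powr (-1/3) =
        u x powr (-1/3 - 1) * (3 * u x * u2 - (deriv u x)\<^sup>2) / 3"
      by (simp add: power2_eq_square algebra_simps)
    then have "((-1/3) * u x powr (-1/3 - 1) * deriv u x) * deriv u x + u2 * u x powr (-1/3) = 0"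
      using ode[OF J(2,3)[OF x] u2] by (simp only: diff_self mult_zero_right div_0)
    ultimately show ?thesis by (simp only:)
  qed
  then have w1: "w1 x = w1 x0" if "x \<in> J" for x
    using const[of w1 x x0] that x0J by blast
  define \<alpha> where "\<alpha> = 2 / 3 * w1 x0"
  have "w1 x0 \<noteq> 0" using nz \<open>u x0 > 0\<close> by (simp add: w1_def)
  then have \<alpha>: "\<alpha> \<noteq> 0" by (simp add: \<alpha>_def)

  \<comment> \<open>The square of v is u^(2/3), affine with slope \<alpha>. As dx = (2 / \<alpha>) *
    v dv, integrating u = v^3 once and twice gives the coefficients 2 / (5 * \<alpha>) and 4 / (35 *
    \<alpha>^2) below.\<close>
  define v where "v x = u x powr (1/3)" for x
  have v_pos: "v x > 0" if "x \<in> J" for x using J(1)[OF that] by (simp add: v_def)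
  have v3: "v x ^ 3 = u x" if "x \<in> J" for x
    using J(1)[OF that] by (simp add: v_def powr_power)
  have DERIV_v: "(v has_real_derivative \<alpha> / (2 * v x)) (at x)" if x: "x \<in> J" for x
  proof -
    have "(v has_real_derivative (1/3) * u x powr (1/3 - 1) * deriv u x) (at x)"
      unfolding v_def by (rule DERIV_chain2[OF has_real_derivative_powr DERIV_deriv_u]) (use J[OF x] in auto)
    moreover have "(1/3) * u x powr (1/3 - 1) * deriv u x = \<alpha> / (2 * v x)"
    proof -
      have "u x powr (1/3 - 1) * v x = u x powr (-1/3)"
        using powr_add[of "u x" "1/3 - 1" "1/3"] by (simp add: v_def)
      then have "(1/3) * u x powr (1/3 - 1) * deriv u x * v x = w1 x / 3"
        by (simp add: w1_def algebra_simps)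
      then show ?thesis using v_pos[OF x] w1[OF x] by (simp add: \<alpha>_def field_simps)
    qed
    ultimately show ?thesis by simp
  qed

  have DERIV_v_power: "((\<lambda>x. v x ^ (n + 2)) has_real_derivative (real n + 2) * \<alpha> / 2 * v x ^ n) (at x)"
    if x: "x \<in> J" for x n
    using DERIV_power[OF DERIV_v[OF x], of "n + 2"] v_pos[OF x] by (simp add: field_simps)

  have v2: "v x ^ 2 - \<alpha> * x = v x0 ^ 2 - \<alpha> * x0" if "x \<in> J" for x
  proof (rule const[OF _ that x0J])
    fix x assume x: "x \<in> J"
    show "((\<lambda>x. v x ^ 2 - \<alpha> * x) has_real_derivative 0) (at x)"
      using v_pos[OF x] by (auto intro!: derivative_eq_intros DERIV_v[OF x])
  qed
  have f5: "f x - 2 / (5 * \<alpha>) * v x ^ 5 = f x0 - 2 / (5 * \<alpha>) * v x0 ^ 5" if "x \<in> J" for x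
  proof (rule const[OF _ that x0J])
    fix x assume x: "x \<in> J"
    show "((\<lambda>x. f x - 2 / (5 * \<alpha>) * v x ^ 5) has_real_derivative 0) (at x)"
      using DERIV_diff[OF DERIV_f_u[OF J(2)[OF x] J(3)[OF x]] DERIV_cmult[OF DERIV_v_power[OF x, of 3], of "2 / (5 * \<alpha>)"]]
        v3[OF x] \<alpha> by simp
  qed
  define k where "k = f x0 - 2 / (5 * \<alpha>) * v x0 ^ 5"
  have f5: "f x = 2 / (5 * \<alpha>) * v x ^ 5 + k" if "x \<in> J" for x
    using f5[OF that] by (simp add: k_def)
  have F7: "F x - 4 / (35 * \<alpha>\<^sup>2) * v x ^ 7 - k * x = F x0 - 4 / (35 * \<alpha>\<^sup>2) * v x0 ^ 7 - k * x0" if "x \<in> J" for x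
  proof (rule const[OF _ that x0J])
    fix x assume x: "x \<in> J"
    show "((\<lambda>x. F x - 4 / (35 * \<alpha>\<^sup>2) * v x ^ 7 - k * x) has_real_derivative 0) (at x)"
      using DERIV_diff[OF DERIV_diff[OF primitive[OF J(2)[OF x] J(3)[OF x]]
            DERIV_cmult[OF DERIV_v_power[OF x, of 5], of "4 / (35 * \<alpha>\<^sup>2)"]] DERIV_cmult[OF DERIV_ident, of k]]
        f5[OF x] \<alpha> by (simp add: power2_eq_square)
  qed

  define d where "d = x0 + e / 2"
  have dJ: "d \<in> J" and d: "x0 < d" using e(1) by (auto simp: d_def J_def)
  define s t A where "s = v x0" and "t = v d" and "A = 1 / \<alpha>"
  have L: "d - x0 = A * (t\<^sup>2 - s\<^sup>2)"
    using v2[OF dJ] \<alpha> by (simp add: s_def t_def A_def field_simps)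
  have A: "2 / (5 * \<alpha>) = 2 / 5 * A" "4 / (35 * \<alpha>\<^sup>2) = 4 / 35 * A\<^sup>2"
    by (simp_all add: A_def power2_eq_square)
  have fd: "f d = 2 / 5 * A * t ^ 5 + k" "f x0 = 2 / 5 * A * s ^ 5 + k"
    using f5[OF dJ] f5[OF x0J] unfolding A s_def t_def by auto
  have Fd: "F d - F x0 = 4 / 35 * A\<^sup>2 * (t ^ 7 - s ^ 7) + k * (A * (t\<^sup>2 - s\<^sup>2))"
    using F7[OF dJ] unfolding A s_def[symmetric] t_def[symmetric] L[symmetric]
    by (simp add: algebra_simps diff_divide_distrib)
  define x y where "x = 10 * t ^ 7 - 14 * s\<^sup>2 * t ^ 5 + 4 * s ^ 7"
    and "y = 4 * t ^ 7 - 14 * t\<^sup>2 * s ^ 5 + 10 * s ^ 7"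
  have Xd: "X x0 d = A\<^sup>2 / 35 * x"
    unfolding X_def L Fd fd x_def by algebra
  have Yd: "Y x0 d = A\<^sup>2 / 35 * y"
    unfolding Y_def L Fd fd y_def by algebra
  \<comment> \<open>The integration constant k has dropped out of \<open>X\<close> and
    \<open>Y\<close>. Lengths scale with A, and \<open>X\<close> and \<open>Y\<close> with A^2, so
    A^4 splits off and the normalised expression in s and t remains.\<close>
  have scale: "(A\<^sup>2 / 35 * x + A\<^sup>2 / 35 * y)\<^sup>2 + (A * l)\<^sup>2 * (p * (A\<^sup>2 / 35 * x) + q * (A\<^sup>2 / 35 * y))
        - 8 * (A\<^sup>2 / 35 * x) * (A\<^sup>2 / 35 * y)
      = A ^ 4 / 1225 * ((x + y)\<^sup>2 + 35 * l\<^sup>2 * (p * x + q * y) - 8 * x * y)" for x y l p q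
    by (simp add: field_simps eval_nat_numeral)
  have "0 = (X x0 d + Y x0 d)\<^sup>2 + (d - x0)\<^sup>2 * (u x0 * X x0 d + u d * Y x0 d) - 8 * X x0 d * Y x0 d"
    using XY_identity[of x0 d] d x0 J(3)[OF dJ] by simp
  also have "\<dots> = A ^ 4 / 1225 * ((x + y)\<^sup>2 + 35 * (t\<^sup>2 - s\<^sup>2)\<^sup>2 * (s ^ 3 * x + t ^ 3 * y) - 8 * x * y)"
    unfolding L Xd Yd v3[OF x0J, symmetric] v3[OF dJ, symmetric] s_def[symmetric] t_def[symmetric]
    by (rule scale)
  finally have "(x + y)\<^sup>2 + 35 * (t\<^sup>2 - s\<^sup>2)\<^sup>2 * (s ^ 3 * x + t ^ 3 * y) - 8 * x * y = 0"
    using \<alpha> by (simp add: A_def)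
  moreover have "s \<noteq> t" using L d by auto
  ultimately show False
    using power_three_halves_identity_pos[of s t] v_pos[OF x0J] v_pos[OF dJ]
    unfolding x_def y_def s_def[symmetric] t_def[symmetric] by force
qed

lemma f_affine: "\<exists>\<alpha> \<beta>. \<forall>x. a < x \<and> x < b \<longrightarrow> f x = \<alpha> * x + \<beta>"
proof (cases "a < b")
  case True
  then obtain c where c: "a < c" "c < b" using dense by blast
  have const: "g x = g c" if "\<And>x. a < x \<Longrightarrow> x < b \<Longrightarrow> (g has_real_derivative 0) (at x)" "a < x" "x < b"
    for g :: "real \<Rightarrow> real" and x
    using DERIV_isconst3[of a b x c g] that c True by simp
  have u: "u x = u c" if "a < x" "x < b" for x
  proof (rule const[OF _ that])
    show "(u has_real_derivative 0) (at y)" if "a < y" "y < b" for y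
      using DERIV_deriv_u[OF that] deriv_u_eq_0[OF that] by simp
  qed
  have "f x - u c * x = f c - u c * c" if "a < x" "x < b" for x
  proof (rule const[OF _ that])
    show "((\<lambda>x. f x - u c * x) has_real_derivative 0) (at y)" if "a < y" "y < b" for y
      using DERIV_diff[OF DERIV_f_u[OF that] DERIV_cmult[OF DERIV_ident, of "u c"]] u[OF that] by simp
  qed
  then have "\<forall>x. a < x \<and> x < b \<longrightarrow> f x = u c * x + (f c - u c * c)"
    by (simp add: algebra_simps)
  then show ?thesis by blast
qed auto

end

section \<open>Continuous functions\<close>

text \<open>The convex function |v - m| lies below its chord over the range of \<open>f\<close>.
  Integrating the chord gives at most half of (d - c) times the range, with equality only if m is
  the midpoint and \<open>f\<close> takes extreme values only; continuity excludes the
  latter.\<close>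

lemma integral_abs_deviation_less:
  fixes f :: "real \<Rightarrow> real"
  assumes cd: "c < d" and cont: "continuous_on {c..d} f"
    and x1: "x1 \<in> {c..d}" and x2: "x2 \<in> {c..d}"
    and bounds: "\<And>x. x \<in> {c..d} \<Longrightarrow> f x1 \<le> f x \<and> f x \<le> f x2"
    and lt: "f x1 < f x2"
  defines "m \<equiv> integral {c..d} f / (d - c)"
  shows "integral {c..d} (\<lambda>x. \<bar>f x - m\<bar>) < (d - c) * (f x2 - f x1) / 2"
proof (rule ccontr)
  define L V where "L = d - c" and "V = f x2 - f x1"
  assume "\<not> ?thesis"
  then have ge: "L * V / 2 \<le> integral {c..d} (\<lambda>x. \<bar>f x - m\<bar>)" by (simp add: L_def V_def)
  have L: "L > 0" and V: "V > 0" using cd lt by (auto simp: L_def V_def)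
  have int_f: "f integrable_on {c..d}" by (rule integrable_continuous_real[OF cont])
  have m: "integral {c..d} f = L * m" using L by (simp add: m_def L_def)
  have "L * f x1 \<le> integral {c..d} f"
    using integral_le[OF integrable_const_ivl int_f, of "f x1"] bounds cd by (simp add: L_def)
  moreover have "integral {c..d} f \<le> L * f x2"
    using integral_le[OF int_f integrable_const_ivl, of "f x2"] bounds cd by (simp add: L_def)
  ultimately have m_bounds: "f x1 \<le> m" "m \<le> f x2"
    unfolding m using L by auto
  \<comment> \<open>\<open>h\<close> is \<open>V\<close> times the gap between the convex function \<open>|v - m|\<close> and its chord over the range of \<open>f\<close>.\<close>
  define h where "h x = (f x2 - f x) * (m - f x1) + (f x - f x1) * (f x2 - m) - V * \<bar>f x - m\<bar>" for x
  have cont_h: "continuous_on {c..d} h"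
    unfolding h_def by (intro continuous_intros cont)
  have h_nonneg: "0 \<le> h x" if "x \<in> {c..d}" for x
  proof (cases "m \<le> f x")
    case True
    then have "h x = 2 * ((f x2 - f x) * (m - f x1))" by (simp add: h_def V_def algebra_simps)
    then show ?thesis using bounds[OF that] m_bounds by simp
  next
    case False
    then have "h x = 2 * ((f x - f x1) * (f x2 - m))" by (simp add: h_def V_def algebra_simps)
    then show ?thesis using bounds[OF that] m_bounds by simp
  qed
  have h_eq: "h x = f x * (f x1 + f x2 - 2 * m) + (f x2 * (m - f x1) - f x1 * (f x2 - m)) - V * \<bar>f x - m\<bar>" for x
    by (simp add: h_def algebra_simps)
  have "integral {c..d} h = L * m * (f x1 + f x2 - 2 * m) + L * (f x2 * (m - f x1) - f x1 * (f x2 - m))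
      - V * integral {c..d} (\<lambda>x. \<bar>f x - m\<bar>)"
  proof -
    have "((\<lambda>x. f x * (f x1 + f x2 - 2 * m) + (f x2 * (m - f x1) - f x1 * (f x2 - m)) - V * \<bar>f x - m\<bar>) has_integral
       (L * m * (f x1 + f x2 - 2 * m) + L * (f x2 * (m - f x1) - f x1 * (f x2 - m))
      - V * integral {c..d} (\<lambda>x. \<bar>f x - m\<bar>))) {c..d}"
    proof (intro has_integral_diff has_integral_add has_integral_mult_left has_integral_mult_right)
      show "(f has_integral L * m) {c..d}"
        using int_f m by (simp add: has_integral_integrable_integral)
      show "((\<lambda>x. f x2 * (m - f x1) - f x1 * (f x2 - m)) has_integral L * (f x2 * (m - f x1) - f x1 * (f x2 - m))) {c..d}"
        using has_integral_const_real[of "f x2 * (m - f x1) - f x1 * (f x2 - m)" c d] cd by (simp add: L_def)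
      show "((\<lambda>x. \<bar>f x - m\<bar>) has_integral integral {c..d} (\<lambda>x. \<bar>f x - m\<bar>)) {c..d}"
        by (intro integrable_integral integrable_continuous_real continuous_intros cont)
    qed
    then show ?thesis unfolding h_eq[abs_def] by (rule integral_unique)
  qed
  also have "\<dots> \<le> L * m * (f x1 + f x2 - 2 * m) + L * (f x2 * (m - f x1) - f x1 * (f x2 - m)) - V * (L * V / 2)"
    using ge V by (intro diff_left_mono mult_left_mono) auto
  also have "\<dots> = - (L * (f x1 + f x2 - 2 * m)\<^sup>2 / 2)"
    by (simp add: V_def power2_eq_square field_simps)
  finally have le: "integral {c..d} h \<le> - (L * (f x1 + f x2 - 2 * m)\<^sup>2 / 2)" .
  have "0 \<le> integral {c..d} h"
    by (intro Henstock_Kurzweil_Integration.integral_nonneg integrable_continuous_real cont_h h_nonneg)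
  moreover have "0 \<le> L * (f x1 + f x2 - 2 * m)\<^sup>2 / 2" using L by simp
  ultimately have "integral {c..d} h = 0" and "L * (f x1 + f x2 - 2 * m)\<^sup>2 / 2 = 0"
    using le by linarith+
  then have m_eq: "f x1 + f x2 = 2 * m" and h0: "\<And>x. x \<in> {c..d} \<Longrightarrow> h x = 0"
    using L integral_eq_0_iff[of c d h] cont_h h_nonneg cd by auto
  \<comment> \<open>In the case of equality m is the midpoint of the range. \<open>f\<close> attains
    it, and there the gap \<open>h\<close> is positive.\<close>
  have "{f x1..f x2} \<subseteq> f ` {c..d}"
    by (intro connected_contains_Icc connected_continuous_image cont) (use x1 x2 in auto)
  then obtain z where z: "z \<in> {c..d}" "f z = m" using m_bounds by (metis atLeastAtMost_iff imageE subsetD)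
  have "h z = 2 * (V / 2) * (V / 2)"
  proof -
    have eqs: "f x2 - m = V / 2" "m - f x1 = V / 2" using m_eq by (auto simp: V_def)
    show ?thesis unfolding h_def z(2) eqs by simp
  qed
  then show False using h0[OF z(1)] V by simp
qed

locale continuous_osc_additive =
  fixes a b :: real and f M :: "real \<Rightarrow> real"
  assumes cont: "continuous_on {a<..<b} f"
    and osc_eq: "\<And>c d. a < c \<Longrightarrow> c < d \<Longrightarrow> d < b \<Longrightarrow>
      integral {c..d} (\<lambda>x. \<bar>f x - integral {c..d} f / (d - c)\<bar>) = (d - c) * (M d - M c)"
    and increment: "\<And>c d. a < c \<Longrightarrow> c < d \<Longrightarrow> d < b \<Longrightarrow> \<bar>f d - f c\<bar> \<le> 4 * (M d - M c)"
begin

lemma cont_ivl: "a < c \<Longrightarrow> d < b \<Longrightarrow> continuous_on {c..d} f"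
  by (rule continuous_on_subset[OF cont]) auto

lemma increment_weak: "a < c \<Longrightarrow> c \<le> d \<Longrightarrow> d < b \<Longrightarrow> \<bar>f d - f c\<bar> \<le> 4 * (M d - M c)"
  using increment[of c d] by (cases "c = d") auto

text \<open>Transfers the propagation of plateaus from left to right. The outer sign keeps the new
  \<open>M\<close> increasing.\<close>

lemma reflect: "continuous_osc_additive (- b) (- a) (\<lambda>x. f (- x)) (\<lambda>x. - M (- x))"
proof
  show "continuous_on {- b<..<- a} (\<lambda>x. f (- x))"
    by (intro continuous_on_compose2[OF cont] continuous_intros) auto
  fix c d assume cd: "- b < c" "c < d" "d < - a"
  have refl: "integral {c..d} (\<lambda>x. g (- x)) = integral {- d..- c} g" for g :: "real \<Rightarrow> real"
    using Henstock_Kurzweil_Integration.integral_reflect_real[of "- c" "- d" g] by simp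
  show "integral {c..d} (\<lambda>x. \<bar>f (- x) - integral {c..d} (\<lambda>x. f (- x)) / (d - c)\<bar>) = (d - c) * (- M (- d) - - M (- c))"
    using osc_eq[of "- d" "- c"] cd refl[of "\<lambda>x. \<bar>f x - integral {- d..- c} f / (d - c)\<bar>"] refl[of f] by simp
  show "\<bar>f (- d) - f (- c)\<bar> \<le> 4 * (- M (- d) - - M (- c))"
    using increment[of "- d" "- c"] cd by (simp add: abs_minus_commute)
qed

lemma negate: "continuous_osc_additive a b (\<lambda>x. - f x) M"
proof
  show "continuous_on {a<..<b} (\<lambda>x. - f x)" by (intro continuous_intros cont)
  fix c d assume cd: "a < c" "c < d" "d < b"
  show "integral {c..d} (\<lambda>x. \<bar>- f x - integral {c..d} (\<lambda>x. - f x) / (d - c)\<bar>) = (d - c) * (M d - M c)"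
    using osc_eq[OF cd] by (simp add: abs_minus_commute)
  show "\<bar>- f d - - f c\<bar> \<le> 4 * (M d - M c)" using increment[OF cd] by (simp add: abs_minus_commute)
qed

lemma constant_between_equal_values:
  assumes cd: "a < c" "c < d" "d < b" and eq: "f c = f d" and x: "x \<in> {c..d}"
  shows "f x = f c"
proof -
  have cont_cd: "continuous_on {c..d} f" using cont_ivl cd by simp
  obtain x1 where x1: "x1 \<in> {c..d}" "\<And>y. y \<in> {c..d} \<Longrightarrow> f x1 \<le> f y"
    using continuous_attains_inf[OF compact_Icc _ cont_cd] cd by auto
  obtain x2 where x2: "x2 \<in> {c..d}" "\<And>y. y \<in> {c..d} \<Longrightarrow> f y \<le> f x2"
    using continuous_attains_sup[OF compact_Icc _ cont_cd] cd by auto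
  have "\<not> f x1 < f x2"
  proof
    assume lt: "f x1 < f x2"
    have "(d - c) * (M d - M c) < (d - c) * (f x2 - f x1) / 2"
      using integral_abs_deviation_less[OF cd(2) cont_cd x1(1) x2(1) _ lt] x1 x2 osc_eq[OF cd] by simp
    then have "(d - c) * (M d - M c) < (d - c) * ((f x2 - f x1) / 2)" by simp
    then have "M d - M c < (f x2 - f x1) / 2" using cd by simp
    \<comment> \<open>Running from c through both extrema to d, in either order, three applications
      of the increment bound collect a variation of 2 * (f x2 - f x1), because f c = f d.\<close>
    moreover have "(f x2 - f x1) / 2 \<le> M d - M c"
    proof (cases "x1 \<le> x2")
      case True
      then show ?thesis
        using increment_weak[of c x1] increment_weak[of x1 x2] increment_weak[of x2 d] x1(1) x2(1) cd eq by auto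
    next
      case False
      then show ?thesis
        using increment_weak[of c x2] increment_weak[of x2 x1] increment_weak[of x1 d] x1(1) x2(1) cd eq by auto
    qed
    ultimately show False by simp
  qed
  moreover have "c \<in> {c..d}" using cd by simp
  ultimately show ?thesis
    using x1(2)[of c] x1(2)[OF x] x2(2)[of c] x2(2)[OF x] by linarith
qed

text \<open>Just left of a plateau, the oscillation over the interval that includes the plateau is small compared
  with the largest deviation from \<open>k\<close>, whereas \<open>increment\<close> bounds it from below by a quarter of that
  deviation.\<close>

lemma plateau_extends_left:
  assumes cd: "a < c" "c < d" "d < b" and const: "\<And>y. y \<in> {c..d} \<Longrightarrow> f y = k"
    and x: "a < x" "x \<le> c" "c - x \<le> (d - c) / 9"
  shows "f x = k"
proof -
  have cont_k: "continuous_on {x..d} (\<lambda>y. \<bar>f y - k\<bar>)"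
    by (intro continuous_intros cont_ivl) (use x cd in auto)
  have "\<exists>y\<in>{x..c}. \<forall>z\<in>{x..c}. \<bar>f z - k\<bar> \<le> \<bar>f y - k\<bar>"
    by (intro continuous_attains_sup continuous_on_subset[OF cont_k]) (use x cd in auto)
  then obtain y where y: "y \<in> {x..c}" "\<And>z. z \<in> {x..c} \<Longrightarrow> \<bar>f z - k\<bar> \<le> \<bar>f y - k\<bar>" by blast
  define \<delta> where "\<delta> = \<bar>f y - k\<bar>"
  have fc: "f c = k" using const cd by simp
  have "\<delta> \<le> 4 * (M c - M y)"
    using increment_weak[of y c] y(1) x cd fc by (auto simp: \<delta>_def abs_minus_commute)
  moreover have "0 \<le> M y - M x" using increment_weak[of x y] y(1) x cd by auto
  moreover have "0 \<le> M d - M c" using increment_weak[of c d] cd by auto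
  ultimately have \<delta>_le: "\<delta> \<le> 4 * (M d - M x)" by (simp add: field_simps)
  define m where "m = integral {x..d} f / (d - x)"
  have dx: "x < d" using x cd by simp
  have cont_f: "continuous_on {x..d} f" using cont_ivl x cd by simp
  have int_k: "(\<lambda>y. \<bar>f y - k\<bar>) integrable_on {x..d}" by (rule integrable_continuous_real[OF cont_k])
  have "(d - x) * (M d - M x) = integral {x..d} (\<lambda>y. \<bar>f y - m\<bar>)"
    using osc_eq[of x d] x cd by (simp add: m_def)
  also have "\<dots> \<le> integral {x..d} (\<lambda>y. \<bar>f y - k\<bar> + \<bar>k - m\<bar>)"
    by (intro integral_le integrable_continuous_real continuous_intros cont_f) auto
  also have "\<dots> = integral {x..d} (\<lambda>y. \<bar>f y - k\<bar>) + (d - x) * \<bar>k - m\<bar>"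
    using dx int_k by (subst Henstock_Kurzweil_Integration.integral_add) auto
  also have "(d - x) * \<bar>k - m\<bar> = \<bar>integral {x..d} (\<lambda>y. f y - k)\<bar>"
  proof -
    have "integral {x..d} (\<lambda>y. f y - k) = integral {x..d} f - k * (d - x)"
      using dx by (subst Henstock_Kurzweil_Integration.integral_diff) (auto intro: integrable_continuous_real cont_f)
    also have "integral {x..d} f = (d - x) * m" using dx by (simp add: m_def)
    also have "(d - x) * m - k * (d - x) = (d - x) * (m - k)" by (simp add: algebra_simps)
    finally show ?thesis using dx by (simp add: abs_mult abs_minus_commute)
  qed
  also have "\<bar>integral {x..d} (\<lambda>y. f y - k)\<bar> \<le> integral {x..d} (\<lambda>y. \<bar>f y - k\<bar>)"
  proof -
    have "norm (integral {x..d} (\<lambda>y. f y - k)) \<le> integral {x..d} (\<lambda>y. \<bar>f y - k\<bar>)"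
      by (rule integral_norm_bound_integral[OF _ int_k]) (auto intro!: integrable_continuous_real continuous_intros cont_f)
    then show ?thesis by simp
  qed
  also have "integral {x..d} (\<lambda>y. \<bar>f y - k\<bar>) = integral {x..c} (\<lambda>y. \<bar>f y - k\<bar>) + integral {c..d} (\<lambda>y. \<bar>f y - k\<bar>)"
    using Henstock_Kurzweil_Integration.integral_combine[of x c d "\<lambda>y. \<bar>f y - k\<bar>"] x cd int_k by simp
  also have "integral {c..d} (\<lambda>y. \<bar>f y - k\<bar>) = 0"
    using integral_cong[of "{c..d}" "\<lambda>y. \<bar>f y - k\<bar>" "\<lambda>_. 0"] const by simp
  also have "integral {x..c} (\<lambda>y. \<bar>f y - k\<bar>) \<le> integral {x..c} (\<lambda>y. \<delta>)"
    by (rule integral_le)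
      (use y(2) cd x in \<open>auto simp: \<delta>_def intro!: integrable_continuous_real continuous_on_subset[OF cont_k]\<close>)
  also have "integral {x..c} (\<lambda>y. \<delta>) = (c - x) * \<delta>" using x by simp
  finally have le: "(d - x) * (M d - M x) \<le> 2 * ((c - x) * \<delta>)" by (simp add: mult.commute)
  have "(d - x) * \<delta> \<le> (d - x) * (4 * (M d - M x))"
    using \<delta>_le dx by (intro mult_left_mono) auto
  also have "\<dots> = 4 * ((d - x) * (M d - M x))" by simp
  also have "\<dots> \<le> 4 * (2 * ((c - x) * \<delta>))" using le by (intro mult_left_mono) auto
  finally have "(d - x) * \<delta> \<le> 8 * (c - x) * \<delta>" by (simp only: mult.assoc)
  \<comment> \<open>The 8 is 4 from \<open>increment\<close> times 2 from replacing the mean m by k.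
    The bound (d - c) / 9 makes the part outside the plateau too short for a positive
    \<delta>.\<close>
  moreover have "8 * (c - x) < d - x" using x cd by (simp add: field_simps)
  ultimately have "\<delta> \<le> 0"
    using mult_strict_right_mono[of "8 * (c - x)" "d - x" \<delta>] by linarith
  then have "\<bar>f x - k\<bar> \<le> 0" using y(2)[of x] x by (simp add: \<delta>_def)
  then show ?thesis by simp
qed

text \<open>The plateau only grows, so each application of \<open>plateau_extends_left\<close> may
  gain the same length e, and finitely many reach any given point right of a.\<close>

lemma plateau_left:
  assumes cd: "a < c" "c < d" "d < b" and const: "\<And>y. y \<in> {c..d} \<Longrightarrow> f y = k"
    and x: "a < x" "x \<le> d"
  shows "f x = k"
proof -
  define e where "e = (d - c) / 9"
  have e: "e > 0" using cd by (simp add: e_def)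
  have claim: "\<forall>x. a < x \<and> c - real n * e \<le> x \<and> x \<le> d \<longrightarrow> f x = k" for n
  proof (induction n)
    case 0
    then show ?case using const by simp
  next
    case (Suc n)
    show ?case
    proof (intro allI impI)
      fix x assume x: "a < x \<and> c - real (Suc n) * e \<le> x \<and> x \<le> d"
      define c' where "c' = c - real n * e"
      have c': "c' \<le> c" using e by (simp add: c'_def)
      show "f x = k"
      proof (cases "c' \<le> x")
        case True
        then show ?thesis using Suc x by (simp add: c'_def)
      next
        case False
        show ?thesis
        proof (rule plateau_extends_left[of c' d])
          show "c' - x \<le> (d - c') / 9"
            using x c' by (simp add: c'_def e_def field_simps)
          show "f y = k" if "y \<in> {c'..d}" for y
            using Suc that False x by (auto simp: c'_def)
        qed (use x False c' cd in auto)
      qed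
    qed
  qed
  obtain n where "(c - x) / e < real n" using reals_Archimedean2 by blast
  then have "c - real n * e \<le> x" using e by (simp add: field_simps)
  then show ?thesis using claim[of n] x by blast
qed

lemma plateau:
  assumes cd: "a < c" "c < d" "d < b" and const: "\<And>y. y \<in> {c..d} \<Longrightarrow> f y = k"
    and x: "a < x" "x < b"
  shows "f x = k"
proof (cases "x \<le> d")
  case True
  then show ?thesis using plateau_left cd const x by blast
next
  case False
  interpret r: continuous_osc_additive "- b" "- a" "\<lambda>x. f (- x)" "\<lambda>x. - M (- x)"
    by (rule reflect)
  have "f (- (- x)) = k"
  proof (rule r.plateau_left[of "- d" "- c"])
    show "f (- y) = k" if "y \<in> {- d..- c}" for y
      using const[of "- y"] that by auto
  qed (use cd x False in auto)
  then show ?thesis by simp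
qed

lemma affine_if_increasing:
  assumes inc: "\<And>x y. a < x \<Longrightarrow> x < y \<Longrightarrow> y < b \<Longrightarrow> f x < f y"
  shows "\<exists>\<alpha> \<beta>. \<forall>x. a < x \<and> x < b \<longrightarrow> f x = \<alpha> * x + \<beta>"
proof (cases "a < b")
  case True
  have isCont: "isCont f x" if "a < x" "x < b" for x
    using cont that by (simp add: continuous_on_eq_continuous_at)
  have "\<exists>F. \<forall>x::real. ereal a < x \<longrightarrow> x < ereal b \<longrightarrow> (F has_vector_derivative f x) (at x)"
    by (rule einterval_antiderivative) (use True isCont in auto)
  then obtain F where F: "\<And>x. a < x \<Longrightarrow> x < b \<Longrightarrow> (F has_real_derivative f x) (at x)"
    by (auto simp: has_real_derivative_iff_has_vector_derivative)
  have int_f: "(f has_integral F d - F c) {c..d}" if "a < c" "c \<le> d" "d < b" for c d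
    using that F by (intro fundamental_theorem_of_calculus)
      (auto simp: has_real_derivative_iff_has_vector_derivative[symmetric] intro: has_field_derivative_at_within)
  interpret increasing_osc_additive a b F f M
  proof
    fix c s d assume *: "a < c" "c < s" "s < d" "d < b" "f s = (F d - F c) / (d - c)"
    have mean: "integral {c..d} f / (d - c) = f s"
      using int_f[of c d] * by (simp add: integral_unique)
    \<comment> \<open>Since f s is the mean, the parts of the deviation left and right of s are
      equal; hence the factor 2 in \<open>gap\<close>.\<close>
    have 1: "((\<lambda>x. f s - f x) has_integral (s - c) * f s - (F s - F c)) {c..s}"
      using has_integral_diff[OF has_integral_const_real[of "f s" c s] int_f[of c s]] * by simp
    have 2: "((\<lambda>x. f x - f s) has_integral (F d - F s) - (d - s) * f s) {s..d}"
      using has_integral_diff[OF int_f[of s d] has_integral_const_real[of "f s" s d]] * by simp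
    have 1: "((\<lambda>x. \<bar>f x - f s\<bar>) has_integral (s - c) * f s - (F s - F c)) {c..s}"
      by (rule has_integral_eq[OF _ 1]) (use * inc[of _ s] in \<open>force simp: less_eq_real_def\<close>)
    have 2: "((\<lambda>x. \<bar>f x - f s\<bar>) has_integral (F d - F s) - (d - s) * f s) {s..d}"
      by (rule has_integral_eq[OF _ 2]) (use * inc[of s] in \<open>force simp: less_eq_real_def\<close>)
    have "integral {c..d} (\<lambda>x. \<bar>f x - f s\<bar>) = (s - c) * f s - (F s - F c) + ((F d - F s) - (d - s) * f s)"
      by (rule integral_unique, rule has_integral_combine[OF _ _ 1 2]) (use * in auto)
    moreover have "F d - F c = f s * (d - c)" using * by simp
    moreover have "integral {c..d} (\<lambda>x. \<bar>f x - f s\<bar>) = (d - c) * (M d - M c)"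
      using osc_eq[of c d] *(1-4) unfolding mean by simp
    ultimately show "(d - c) * (M d - M c) = 2 * (F c + f s * (s - c) - F s)"
      by (simp add: right_diff_distrib left_diff_distrib mult.commute)
  next
    show "f d - f c \<le> 4 * (M d - M c)" if "a < c" "c < d" "d < b" for c d
      using increment[OF that] by linarith
  qed (rule F isCont inc; assumption)+
  show ?thesis by (rule f_affine)
qed auto

lemma affine: "\<exists>\<alpha> \<beta>. \<forall>x. a < x \<and> x < b \<longrightarrow> f x = \<alpha> * x + \<beta>"
proof (cases "inj_on f {a<..<b}")
  case True
  then consider "strict_mono_on {a<..<b} f" | "strict_antimono_on {a<..<b} f"
    using injective_eq_monotone_map[OF _ cont] by (auto simp: is_interval_oo)
  then show ?thesis
  proof cases
    case 1
    then show ?thesis by (intro affine_if_increasing) (auto simp: strict_mono_on_def)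
  next
    case 2
    interpret n: continuous_osc_additive a b "\<lambda>x. - f x" M by (rule negate)
    have "\<exists>\<alpha> \<beta>. \<forall>x. a < x \<and> x < b \<longrightarrow> - f x = \<alpha> * x + \<beta>"
      using 2 by (intro n.affine_if_increasing) (auto simp: monotone_on_def)
    then obtain \<alpha> \<beta> where "\<forall>x. a < x \<and> x < b \<longrightarrow> - f x = \<alpha> * x + \<beta>" by blast
    then have "\<forall>x. a < x \<and> x < b \<longrightarrow> f x = (- \<alpha>) * x + (- \<beta>)"
      by (metis minus_add_distrib minus_minus mult_minus_left)
    then show ?thesis by blast
  qed
next
  case False
  then obtain p q where pq: "a < p" "p < b" "a < q" "q < b" "f p = f q" "p \<noteq> q"
    by (auto simp: inj_on_def)
  obtain c d where cd: "a < c" "c < d" "d < b" "f c = f d"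
  proof (cases "p < q")
    case True
    then show thesis using that[of p q] pq by simp
  next
    case False
    then show thesis using that[of q p] pq by simp
  qed
  have "f x = f c" if "a < x" "x < b" for x
    using plateau[OF cd(1-3) constant_between_equal_values[OF cd]] that by blast
  then have "\<forall>x. a < x \<and> x < b \<longrightarrow> f x = 0 * x + f c" by simp
  then show ?thesis by blast
qed

end

section \<open>Locally integrable functions\<close>

text \<open>\<open>average\<close> and \<open>deviation\<close> are \<open>mean_value\<close> and
  \<open>osc\<close> as gauge integrals over closed intervals, for which splitting at a point is
  direct. \<open>osc_eq_deviation\<close> connects the two versions.\<close>

definition average :: "(real \<Rightarrow> real) \<Rightarrow> real \<Rightarrow> real \<Rightarrow> real" where
  "average f c d = integral {c..d} f / (d - c)"

definition deviation :: "(real \<Rightarrow> real) \<Rightarrow> real \<Rightarrow> real \<Rightarrow> real" where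
  "deviation f c d = integral {c..d} (\<lambda>x. \<bar>f x - average f c d\<bar>) / (d - c)"

lemma abs_diff_integrable:
  fixes f :: "real \<Rightarrow> real"
  assumes "f absolutely_integrable_on {c..d}"
  shows "f integrable_on {c..d}" "(\<lambda>x. f x - k) integrable_on {c..d}" "(\<lambda>x. \<bar>f x - k\<bar>) integrable_on {c..d}"
proof -
  have "(\<lambda>x. f x - k) absolutely_integrable_on {c..d}"
    using assms by (intro set_integral_diff) auto
  then show "f integrable_on {c..d}" "(\<lambda>x. f x - k) integrable_on {c..d}" "(\<lambda>x. \<bar>f x - k\<bar>) integrable_on {c..d}"
    using assms by (auto simp: absolutely_integrable_on_def)
qed

lemma deviation_nonneg:
  assumes "f absolutely_integrable_on {c..d}" "c \<le> d"
  shows "0 \<le> deviation f c d"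
proof -
  have "0 \<le> integral {c..d} (\<lambda>x. \<bar>f x - average f c d\<bar>)"
    by (rule Henstock_Kurzweil_Integration.integral_nonneg[OF abs_diff_integrable(3)[OF assms(1)]]) simp
  then show ?thesis using assms(2) by (simp add: deviation_def)
qed

text \<open>Pointwise, |f x - m| and |k - p| differ by at most |f x - k| + |m - p|. Applied where
  \<open>f\<close> is close to k in the mean and m is close to p.\<close>

lemma integral_abs_diff_approx:
  fixes f :: "real \<Rightarrow> real"
  assumes f: "f absolutely_integrable_on {c..d}" and cd: "c \<le> d"
  shows "\<bar>integral {c..d} (\<lambda>x. \<bar>f x - m\<bar>) - (d - c) * \<bar>k - p\<bar>\<bar> \<le> integral {c..d} (\<lambda>x. \<bar>f x - k\<bar>) + (d - c) * \<bar>m - p\<bar>"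
proof -
  have "integral {c..d} (\<lambda>x. \<bar>f x - m\<bar>) - (d - c) * \<bar>k - p\<bar> = integral {c..d} (\<lambda>x. \<bar>f x - m\<bar> - \<bar>k - p\<bar>)"
    using cd abs_diff_integrable[OF f] by (subst Henstock_Kurzweil_Integration.integral_diff) auto
  moreover have "norm (integral {c..d} (\<lambda>x. \<bar>f x - m\<bar> - \<bar>k - p\<bar>)) \<le> integral {c..d} (\<lambda>x. \<bar>f x - k\<bar> + \<bar>m - p\<bar>)"
    by (intro integral_norm_bound_integral Henstock_Kurzweil_Integration.integrable_diff
          Henstock_Kurzweil_Integration.integrable_add abs_diff_integrable f integrable_const_ivl) auto
  moreover have "integral {c..d} (\<lambda>x. \<bar>f x - k\<bar> + \<bar>m - p\<bar>) = integral {c..d} (\<lambda>x. \<bar>f x - k\<bar>) + (d - c) * \<bar>m - p\<bar>"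
    using cd abs_diff_integrable[OF f] by (subst Henstock_Kurzweil_Integration.integral_add) auto
  ultimately show ?thesis by simp
qed

lemma abs_integral_diff_le:
  fixes f :: "real \<Rightarrow> real"
  assumes f: "f absolutely_integrable_on {c..d}" and cd: "c \<le> d"
  shows "\<bar>integral {c..d} f - (d - c) * k\<bar> \<le> integral {c..d} (\<lambda>x. \<bar>f x - k\<bar>)"
proof -
  have "integral {c..d} f - (d - c) * k = integral {c..d} (\<lambda>x. f x - k)"
    using cd abs_diff_integrable[OF f] by (subst Henstock_Kurzweil_Integration.integral_diff) auto
  moreover have "norm (integral {c..d} (\<lambda>x. f x - k)) \<le> integral {c..d} (\<lambda>x. \<bar>f x - k\<bar>)"
    by (intro integral_norm_bound_integral abs_diff_integrable f) auto
  ultimately show ?thesis by simp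
qed

text \<open>Compares \<open>f\<close> with the step function that is \<open>k'\<close> left of \<open>e\<close> and \<open>k\<close> right of \<open>e\<close>.\<close>

lemma deviation_near_jump:
  fixes f :: "real \<Rightarrow> real"
  assumes f: "f absolutely_integrable_on {c..d}" and e: "c < e" "e < d"
  shows "\<bar>(d - c) * deviation f c d - 2 * (e - c) * (d - e) / (d - c) * \<bar>k - k'\<bar>\<bar>
    \<le> 2 * (integral {c..e} (\<lambda>x. \<bar>f x - k'\<bar>) + integral {e..d} (\<lambda>x. \<bar>f x - k\<bar>))"
proof -
  \<comment> \<open>p is the mean of the step function with values k' and k, and the subtracted main
    term is its integrated deviation from p. The errors enter twice: directly, and through the
    distance of m from p.\<close>
  define m p where "m = average f c d" and "p = ((e - c) * k' + (d - e) * k) / (d - c)"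
  define E E' where "E = integral {c..e} (\<lambda>x. \<bar>f x - k'\<bar>)" and "E' = integral {e..d} (\<lambda>x. \<bar>f x - k\<bar>)"
  have fl: "f absolutely_integrable_on {c..e}" and fr: "f absolutely_integrable_on {e..d}"
    using e by (auto intro: absolutely_integrable_on_subinterval[OF f])
  have "(d - c) * deviation f c d = integral {c..d} (\<lambda>x. \<bar>f x - m\<bar>)"
    using e by (simp add: deviation_def m_def)
  also have "\<dots> = integral {c..e} (\<lambda>x. \<bar>f x - m\<bar>) + integral {e..d} (\<lambda>x. \<bar>f x - m\<bar>)"
    using Henstock_Kurzweil_Integration.integral_combine[of c e d "\<lambda>x. \<bar>f x - m\<bar>"] e abs_diff_integrable[OF f] by simp
  finally have dev: "(d - c) * deviation f c d = integral {c..e} (\<lambda>x. \<bar>f x - m\<bar>) + integral {e..d} (\<lambda>x. \<bar>f x - m\<bar>)" .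
  have "\<bar>integral {c..e} (\<lambda>x. \<bar>f x - m\<bar>) - (e - c) * \<bar>k' - p\<bar>\<bar> \<le> E + (e - c) * \<bar>m - p\<bar>"
    using integral_abs_diff_approx[OF fl] e by (simp add: E_def)
  moreover have "\<bar>integral {e..d} (\<lambda>x. \<bar>f x - m\<bar>) - (d - e) * \<bar>k - p\<bar>\<bar> \<le> E' + (d - e) * \<bar>m - p\<bar>"
    using integral_abs_diff_approx[OF fr] e by (simp add: E'_def)
  ultimately have 1: "\<bar>(d - c) * deviation f c d - ((e - c) * \<bar>k' - p\<bar> + (d - e) * \<bar>k - p\<bar>)\<bar>
      \<le> (E + (e - c) * \<bar>m - p\<bar>) + (E' + (d - e) * \<bar>m - p\<bar>)"
    unfolding dev add_diff_add by (rule order_trans[OF abs_triangle_ineq add_mono])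
  have "(e - c) * \<bar>m - p\<bar> + (d - e) * \<bar>m - p\<bar> = \<bar>(d - c) * (m - p)\<bar>"
  proof -
    have "\<bar>d - c\<bar> = (e - c) + (d - e)" using e by simp
    then show ?thesis by (simp only: abs_mult distrib_right)
  qed
  also have "(d - c) * (m - p) = (integral {c..e} f - (e - c) * k') + (integral {e..d} f - (d - e) * k)"
  proof -
    have "(d - c) * m = integral {c..e} f + integral {e..d} f"
      using Henstock_Kurzweil_Integration.integral_combine[of c e d f] e abs_diff_integrable(1)[OF f]
      by (simp add: m_def average_def)
    moreover have "(d - c) * p = (e - c) * k' + (d - e) * k" using e by (simp add: p_def)
    ultimately show ?thesis by (simp add: right_diff_distrib[of "d - c"])
  qed
  also have "\<bar>\<dots>\<bar> \<le> E + E'"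
    unfolding E_def E'_def using e
    by (intro order_trans[OF abs_triangle_ineq add_mono] abs_integral_diff_le fl fr) auto
  finally have 2: "(e - c) * \<bar>m - p\<bar> + (d - e) * \<bar>m - p\<bar> \<le> E + E'" .
  have "k' - p = (d - e) / (d - c) * (k' - k)" "k - p = (e - c) / (d - c) * (k - k')"
    using e by (simp_all add: p_def divide_simps) (simp_all add: algebra_simps)
  moreover have "\<bar>(d - e) / (d - c)\<bar> = (d - e) / (d - c)" "\<bar>(e - c) / (d - c)\<bar> = (e - c) / (d - c)"
    using e by simp_all
  ultimately have "\<bar>k' - p\<bar> = (d - e) / (d - c) * \<bar>k - k'\<bar>" "\<bar>k - p\<bar> = (e - c) / (d - c) * \<bar>k - k'\<bar>"
    by (simp_all only: abs_mult abs_minus_commute[of k'])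
  then have "(e - c) * \<bar>k' - p\<bar> + (d - e) * \<bar>k - p\<bar> = 2 * (e - c) * (d - e) / (d - c) * \<bar>k - k'\<bar>"
    by (simp add: mult.commute)
  then have "\<bar>(d - c) * deviation f c d - 2 * (e - c) * (d - e) / (d - c) * \<bar>k - k'\<bar>\<bar>
      \<le> (E + (e - c) * \<bar>m - p\<bar>) + (E' + (d - e) * \<bar>m - p\<bar>)"
    using 1 by (simp only:)
  also have "\<dots> \<le> 2 * (E + E')" using 2 by (simp add: algebra_simps)
  finally show ?thesis by (simp only: E_def E'_def)
qed

text \<open>Both halves are compared with the mean over the union; the factor 2 is the ratio of the
  lengths 2 * h and h.\<close>

lemma adjacent_averages:
  fixes f :: "real \<Rightarrow> real"
  assumes f: "f absolutely_integrable_on {x..x + 2 * h}" and h: "h > 0"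
  shows "\<bar>average f (x + h) (x + 2 * h) - average f x (x + h)\<bar> \<le> 2 * deviation f x (x + 2 * h)"
proof -
  define m where "m = average f x (x + 2 * h)"
  have fl: "f absolutely_integrable_on {x..x + h}" and fr: "f absolutely_integrable_on {x + h..x + 2 * h}"
    using h by (auto intro: absolutely_integrable_on_subinterval[OF f])
  have "2 * h * deviation f x (x + 2 * h) = integral {x..x + 2 * h} (\<lambda>y. \<bar>f y - m\<bar>)"
    using h by (simp add: deviation_def m_def)
  also have "\<dots> = integral {x..x + h} (\<lambda>y. \<bar>f y - m\<bar>) + integral {x + h..x + 2 * h} (\<lambda>y. \<bar>f y - m\<bar>)"
    using Henstock_Kurzweil_Integration.integral_combine[of x "x + h" "x + 2 * h" "\<lambda>y. \<bar>f y - m\<bar>"] h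
      abs_diff_integrable[OF f] by simp
  finally have "\<bar>integral {x..x + h} f - h * m\<bar> + \<bar>integral {x + h..x + 2 * h} f - h * m\<bar> \<le> 2 * h * deviation f x (x + 2 * h)"
    using abs_integral_diff_le[OF fl, of m] abs_integral_diff_le[OF fr, of m] h by simp
  then have "\<bar>integral {x + h..x + 2 * h} f - integral {x..x + h} f\<bar> \<le> 2 * h * deviation f x (x + 2 * h)"
    by linarith
  moreover have "integral {x + h..x + 2 * h} f - integral {x..x + h} f = h * (average f (x + h) (x + 2 * h) - average f x (x + h))"
    using h by (simp add: average_def right_diff_distrib)
  ultimately have "h * \<bar>average f (x + h) (x + 2 * h) - average f x (x + h)\<bar> \<le> h * (2 * deviation f x (x + 2 * h))"
    using h by (simp add: abs_mult mult_ac)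
  then show ?thesis using h by simp
qed

lemma deviation_cong_ae:
  assumes "negligible N" "\<And>x. x \<in> {c..d} - N \<Longrightarrow> f x = g x"
  shows "deviation f c d = deviation g c d"
proof -
  have "average f c d = average g c d"
    unfolding average_def using integral_spike[OF assms(1), of "{c..d}" g f] assms(2) by simp
  then show ?thesis
    unfolding deviation_def
    using integral_spike[OF assms(1), of "{c..d}" "\<lambda>x. \<bar>g x - average g c d\<bar>" "\<lambda>x. \<bar>f x - average g c d\<bar>"] assms(2)
    by simp
qed

section \<open>Absence of atoms and the distribution function of \<open>\<mu>\<close>\<close>

locale deviation_measure =
  fixes a b :: real and f :: "real \<Rightarrow> real" and \<mu> :: "real measure"
  assumes ab: "a < b"
    and f: "\<And>c d. a < c \<Longrightarrow> d < b \<Longrightarrow> f absolutely_integrable_on {c..d}"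
    and sets_\<mu>: "sets \<mu> = sets (restrict_space borel {a<..<b})"
    and emeasure_ivl: "\<And>c d. a < c \<Longrightarrow> c < d \<Longrightarrow> d < b \<Longrightarrow> emeasure \<mu> {c<..<d} = ennreal (deviation f c d)"
begin

lemma in_sets: "A \<in> sets borel \<Longrightarrow> A \<subseteq> {a<..<b} \<Longrightarrow> A \<in> sets \<mu>"
  unfolding sets_\<mu> by (subst sets_restrict_space_iff) auto

lemma measure_ivl: "a < c \<Longrightarrow> c < d \<Longrightarrow> d < b \<Longrightarrow> measure \<mu> {c<..<d} = deviation f c d"
  by (simp add: measure_def emeasure_ivl deviation_nonneg f)

lemma emeasure_finite: "a < c \<Longrightarrow> d < b \<Longrightarrow> A \<subseteq> {c<..<d} \<Longrightarrow> emeasure \<mu> A \<noteq> \<infinity>"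
proof -
  assume *: "a < c" "d < b" "A \<subseteq> {c<..<d}"
  show ?thesis
  proof (cases "c < d")
    case True
    then have "emeasure \<mu> A \<le> emeasure \<mu> {c<..<d}"
      using * by (intro emeasure_mono in_sets) auto
    then show ?thesis using emeasure_ivl[of c d] True * by (auto simp: top_unique)
  next
    case False
    then have "A = {}" using * by auto
    then show ?thesis by simp
  qed
qed

text \<open>Continuity of the measure from above. The weights p and q fix the ratio in which x
  divides the intervals; a zero weight gives intervals with end point x, whose intersection is empty
  because they are open.\<close>

lemma deviation_limit:
  assumes x: "a < x - p * h" "x + q * h < b" and h: "0 < h" and pq: "0 \<le> p" "0 \<le> q" "0 < p + q"
  shows "(\<lambda>n. deviation f (x - p * (h / (real n + 1))) (x + q * (h / (real n + 1))))
    \<longlonglongrightarrow> measure \<mu> (\<Inter>n. {x - p * (h / (real n + 1))<..<x + q * (h / (real n + 1))})"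
proof -
  define H where "H n = h / (real n + 1)" for n
  define A where "A n = {x - p * H n<..<x + q * H n}" for n
  have H: "0 < H n" "H n \<le> h" for n using h by (auto simp: H_def divide_simps)
  have H_mono: "H n \<le> H m" if "m \<le> n" for m n using h that by (auto simp: H_def intro!: divide_left_mono)
  have bd: "p * H n \<le> p * h" "q * H n \<le> q * h" "0 < (p + q) * H n" for n
    using H pq by (auto intro: mult_left_mono)
  have ivl: "a < x - p * H n" "x - p * H n < x + q * H n" "x + q * H n < b" for n
    using bd[of n] x by (auto simp: algebra_simps)
  have "(\<lambda>n. measure \<mu> (A n)) \<longlonglongrightarrow> measure \<mu> (\<Inter>n. A n)"
  proof (rule Lim_measure_decseq)
    show "range A \<subseteq> sets \<mu>"
    proof safe
      show "A n \<in> sets \<mu>" for n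
        unfolding A_def using ivl[of n] by (intro in_sets) auto
    qed
    show "decseq A"
      unfolding decseq_def A_def
    proof (intro allI impI)
      fix m n :: nat assume "m \<le> n"
      then have "p * H n \<le> p * H m" "q * H n \<le> q * H m" using H_mono pq by (auto intro: mult_left_mono)
      then show "{x - p * H n<..<x + q * H n} \<subseteq> {x - p * H m<..<x + q * H m}" by auto
    qed
    show "emeasure \<mu> (A i) \<noteq> \<infinity>" for i using emeasure_finite[OF ivl(1)[of i] ivl(3)[of i], of "A i"] by (simp add: A_def)
  qed
  then show ?thesis using ivl by (simp add: A_def measure_ivl H_def)
qed

lemma INT_shrinking:
  assumes h: "0 < h" and "0 \<le> p" "0 \<le> q"
  shows "(\<Inter>n. {x - p * (h / (real n + 1))<..<x + q * (h / (real n + 1))}) = (if p = 0 \<or> q = 0 then {} else {x::real})"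
proof -
  have lim: "(\<lambda>n. k * (h / (real n + 1))) \<longlonglongrightarrow> 0" for k
    using tendsto_mult_right_zero[OF LIMSEQ_ignore_initial_segment[OF lim_const_over_n[of h], of 1]] by (simp add: add.commute)
  have "y \<le> x" if "\<And>n. y < x + q * (h / (real n + 1))" for y
    using LIMSEQ_le_const[OF tendsto_add[OF tendsto_const[of x] lim[of q]], of y] that by (auto intro: less_imp_le)
  moreover have "x \<le> y" if "\<And>n. x - p * (h / (real n + 1)) < y" for y
    using LIMSEQ_le_const2[OF tendsto_diff[OF tendsto_const[of x] lim[of p]], of y] that by (auto intro: less_imp_le)
  ultimately have "y = x" if "y \<in> (\<Inter>n. {x - p * (h / (real n + 1))<..<x + q * (h / (real n + 1))})" for y
    using that by (auto intro!: antisym)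
  moreover have "x \<in> (\<Inter>n. {x - p * (h / (real n + 1))<..<x + q * (h / (real n + 1))})" if "p \<noteq> 0" "q \<noteq> 0"
    using that assms by simp
  moreover have "x \<notin> (\<Inter>n. {x - p * (h / (real n + 1))<..<x + q * (h / (real n + 1))})" if "p = 0 \<or> q = 0"
    using that by auto
  ultimately show ?thesis
    by (cases "p = 0 \<or> q = 0") (simp_all only: if_True if_False, blast+)
qed

text \<open>If \<open>f\<close> jumps by \<open>J\<close> at \<open>x\<close>, the oscillation on \<open>(x - h, x + h)\<close> tends to \<open>J/2\<close>, but that on
  \<open>(x - h, x + 3h)\<close> tends to \<open>3J/8\<close>.\<close>

lemma no_atoms:
  assumes x: "a < x" "x < b"
  shows "measure \<mu> {x} = 0"
proof -
  define h where "h = min (x - a) (b - x) / 4"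
  have "h > 0" "h \<le> (x - a) / 4" "h \<le> (b - x) / 4" using x by (auto simp: h_def)
  then have h: "h > 0" "a < x - 3 * h" "x + 3 * h < b" using x by (auto simp: field_simps)
  define H where "H n = h / (real n + 1)" for n
  have H: "0 < H n" "H n \<le> h" for n using h by (auto simp: H_def divide_simps)
  \<comment> \<open>One-sided oscillations tend to 0 even if x is an atom, as their intervals shrink
    to the empty set. Hence \<open>f\<close> is close in the mean to a constant on either side of
    x.\<close>
  define \<delta> where "\<delta> n = deviation f x (x + 3 * H n)" for n
  define \<delta>' where "\<delta>' n = deviation f (x - 3 * H n) x" for n
  define D1 where "D1 n = deviation f (x - H n) (x + H n)" for n
  define D2 where "D2 n = deviation f (x - H n) (x + 3 * H n)" for n
  have D1: "D1 \<longlonglongrightarrow> measure \<mu> {x}"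
    using deviation_limit[of x 1 h 1] h INT_shrinking[of h 1 1 x] by (simp add: D1_def[abs_def] H_def)
  have D2: "D2 \<longlonglongrightarrow> measure \<mu> {x}"
    using deviation_limit[of x 1 h 3] h INT_shrinking[of h 1 3 x] by (simp add: D2_def[abs_def] H_def)
  have \<delta>: "\<delta> \<longlonglongrightarrow> 0"
    using deviation_limit[of x 0 h 3] h x INT_shrinking[of h 0 3 x] by (simp add: \<delta>_def[abs_def] H_def)
  have \<delta>': "\<delta>' \<longlonglongrightarrow> 0"
    using deviation_limit[of x 3 h 0] h x INT_shrinking[of h 3 0 x] by (simp add: \<delta>'_def[abs_def] H_def)
  \<comment> \<open>Up to errors of order \<delta> n + \<delta>' n, 2 * D1 n is J and 4 * D2 n is 3
    / 2 * J. The combination eliminates J, which depends on n and whose convergence is not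
    known.\<close>
  have D_le: "\<bar>3 / 4 * D1 n - D2 n\<bar> \<le> 4 * (\<delta> n + \<delta>' n)" for n
  proof -
    define r where "r = H n"
    have r: "r > 0" "a < x - 3 * r" "x + 3 * r < b" using H[of n] h by (auto simp: r_def)
    define k k' where "k = average f x (x + 3 * r)" and "k' = average f (x - 3 * r) x"
    define J where "J = \<bar>k - k'\<bar>"
    have R: "integral {x..x + s} (\<lambda>y. \<bar>f y - k\<bar>) \<le> 3 * r * \<delta> n" if "s \<le> 3 * r" for s
    proof -
      have "integral {x..x + s} (\<lambda>y. \<bar>f y - k\<bar>) \<le> integral {x..x + 3 * r} (\<lambda>y. \<bar>f y - k\<bar>)"
        using that r x by (intro integral_subset_le abs_diff_integrable f) auto
      also have "\<dots> = 3 * r * \<delta> n" using r by (simp add: \<delta>_def deviation_def k_def r_def[symmetric])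
      finally show ?thesis .
    qed
    have L: "integral {x - r..x} (\<lambda>y. \<bar>f y - k'\<bar>) \<le> 3 * r * \<delta>' n"
    proof -
      have "integral {x - r..x} (\<lambda>y. \<bar>f y - k'\<bar>) \<le> integral {x - 3 * r..x} (\<lambda>y. \<bar>f y - k'\<bar>)"
        using r x by (intro integral_subset_le abs_diff_integrable f) auto
      also have "\<dots> = 3 * r * \<delta>' n" using r by (simp add: \<delta>'_def deviation_def k'_def r_def[symmetric])
      finally show ?thesis .
    qed
    have "\<bar>(x + r - (x - r)) * deviation f (x - r) (x + r) - 2 * (x - (x - r)) * (x + r - x) / (x + r - (x - r)) * \<bar>k - k'\<bar>\<bar>
      \<le> 2 * (integral {x - r..x} (\<lambda>y. \<bar>f y - k'\<bar>) + integral {x..x + r} (\<lambda>y. \<bar>f y - k\<bar>))"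
      using r by (intro deviation_near_jump f) auto
    also have "\<dots> \<le> 2 * (3 * r * \<delta>' n + 3 * r * \<delta> n)"
      using L R[of r] r by (intro mult_left_mono add_mono) auto
    also have "(x + r - (x - r)) * deviation f (x - r) (x + r) - 2 * (x - (x - r)) * (x + r - x) / (x + r - (x - r)) * \<bar>k - k'\<bar>
        = r * (2 * D1 n - J)"
      using r by (simp add: D1_def r_def[symmetric] J_def[symmetric] field_simps)
    also have "2 * (3 * r * \<delta>' n + 3 * r * \<delta> n) = r * (6 * (\<delta> n + \<delta>' n))" by (simp add: algebra_simps)
    finally have "r * \<bar>2 * D1 n - J\<bar> \<le> r * (6 * (\<delta> n + \<delta>' n))" using r by (simp add: abs_mult)
    then have 1: "\<bar>2 * D1 n - J\<bar> \<le> 6 * (\<delta> n + \<delta>' n)" using r by simp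
    have "\<bar>(x + 3 * r - (x - r)) * deviation f (x - r) (x + 3 * r) - 2 * (x - (x - r)) * (x + 3 * r - x) / (x + 3 * r - (x - r)) * \<bar>k - k'\<bar>\<bar>
      \<le> 2 * (integral {x - r..x} (\<lambda>y. \<bar>f y - k'\<bar>) + integral {x..x + 3 * r} (\<lambda>y. \<bar>f y - k\<bar>))"
      using r by (intro deviation_near_jump f) auto
    also have "\<dots> \<le> 2 * (3 * r * \<delta>' n + 3 * r * \<delta> n)"
      using L R[of "3 * r"] r by (intro mult_left_mono add_mono) auto
    also have "(x + 3 * r - (x - r)) * deviation f (x - r) (x + 3 * r) - 2 * (x - (x - r)) * (x + 3 * r - x) / (x + 3 * r - (x - r)) * \<bar>k - k'\<bar>
        = r * (4 * D2 n - 3 / 2 * J)"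
      using r by (simp add: D2_def r_def[symmetric] J_def[symmetric] field_simps)
    also have "2 * (3 * r * \<delta>' n + 3 * r * \<delta> n) = r * (6 * (\<delta> n + \<delta>' n))" by (simp add: algebra_simps)
    finally have "r * \<bar>4 * D2 n - 3 / 2 * J\<bar> \<le> r * (6 * (\<delta> n + \<delta>' n))" using r by (simp add: abs_mult)
    then have 2: "\<bar>4 * D2 n - 3 / 2 * J\<bar> \<le> 6 * (\<delta> n + \<delta>' n)" using r by simp
    have "3 / 4 * D1 n - D2 n = 3 / 8 * (2 * D1 n - J) - 1 / 4 * (4 * D2 n - 3 / 2 * J)" by (simp add: field_simps)
    also have "\<bar>\<dots>\<bar> \<le> 3 / 8 * \<bar>2 * D1 n - J\<bar> + 1 / 4 * \<bar>4 * D2 n - 3 / 2 * J\<bar>"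
      by (rule order_trans[OF abs_triangle_ineq4]) (simp only: abs_mult abs_divide abs_numeral abs_one order_refl)
    also have "\<dots> \<le> 3 / 8 * (6 * (\<delta> n + \<delta>' n)) + 1 / 4 * (6 * (\<delta> n + \<delta>' n))"
      using 1 2 by (intro add_mono mult_left_mono) auto
    also have "\<dots> = 15 / 4 * (\<delta> n + \<delta>' n)" by (simp add: field_simps)
    also have "\<dots> \<le> 4 * (\<delta> n + \<delta>' n)"
      using order_trans[OF abs_ge_zero 1] by (intro mult_right_mono) auto
    finally show ?thesis .
  qed
  have "(\<lambda>n. 4 * (\<delta> n + \<delta>' n)) \<longlonglongrightarrow> 0"
    by (rule tendsto_mult_right_zero[OF tendsto_add_zero[OF \<delta> \<delta>']])
  then have "(\<lambda>n. 3 / 4 * D1 n - D2 n) \<longlonglongrightarrow> 0"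
    by (rule Lim_null_comparison[rotated]) (simp only: real_norm_def D_le always_eventually simp_thms)
  moreover have "(\<lambda>n. 3 / 4 * D1 n - D2 n) \<longlonglongrightarrow> 3 / 4 * measure \<mu> {x} - measure \<mu> {x}"
    by (intro tendsto_intros D1 D2)
  ultimately have "3 / 4 * measure \<mu> {x} - measure \<mu> {x} = 0"
    by (intro LIMSEQ_unique)
  then show ?thesis by simp
qed

lemma deviation_additive:
  assumes "a < c" "c < e" "e < d" "d < b"
  shows "deviation f c d = deviation f c e + deviation f e d"
proof -
  have fin: "emeasure \<mu> A \<noteq> \<infinity>" if "A \<subseteq> {c<..<d}" for A
    using emeasure_finite[of c d A] that assms by simp
  have meas: "{c<..<e} \<in> sets \<mu>" "{e} \<in> sets \<mu>" "{e<..<d} \<in> sets \<mu>" "{e..<d} \<in> sets \<mu>"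
    using assms by (auto intro!: in_sets)
  have "measure \<mu> {e..<d} = measure \<mu> {e} + measure \<mu> {e<..<d}"
  proof -
    have "{e..<d} = {e} \<union> {e<..<d}" using assms by auto
    moreover have "{e} \<inter> {e<..<d} = {}" by auto
    moreover have "{e} \<subseteq> {c<..<d}" "{e<..<d} \<subseteq> {c<..<d}" using assms by auto
    ultimately show ?thesis using measure_Union[of \<mu> "{e}" "{e<..<d}"] meas fin by metis
  qed
  moreover have "measure \<mu> {c<..<d} = measure \<mu> {c<..<e} + measure \<mu> {e..<d}"
  proof -
    have "{c<..<d} = {c<..<e} \<union> {e..<d}" using assms by auto
    moreover have "{c<..<e} \<inter> {e..<d} = {}" by auto
    moreover have "{c<..<e} \<subseteq> {c<..<d}" "{e..<d} \<subseteq> {c<..<d}" using assms by auto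
    ultimately show ?thesis using measure_Union[of \<mu> "{c<..<e}" "{e..<d}"] meas fin by metis
  qed
  ultimately show ?thesis using no_atoms[of e] assms by (simp add: measure_ivl)
qed

text \<open>A distribution function of \<open>\<mu>\<close> based at an interior point, because
  \<open>\<mu>\<close> is so far known to be finite only away from a and b.\<close>

definition M :: "real \<Rightarrow> real" where
  "M x = (let x0 = (a + b) / 2 in if x0 < x then deviation f x0 x else if x < x0 then - deviation f x x0 else 0)"

lemma M_diff:
  assumes "a < c" "c < d" "d < b"
  shows "M d - M c = deviation f c d"
proof -
  define x0 where "x0 = (a + b) / 2"
  have x0: "a < x0" "x0 < b" using ab by (auto simp: x0_def)
  show ?thesis
  proof (cases x0 c rule: linorder_cases)
    case less
    then show ?thesis
      using assms x0 deviation_additive[of x0 c d] by (simp add: M_def Let_def x0_def[symmetric])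
  next
    case equal
    then show ?thesis using assms by (simp add: M_def Let_def x0_def[symmetric])
  next
    case c: greater
    show ?thesis
    proof (cases x0 d rule: linorder_cases)
      case less
      then show ?thesis
        using c assms deviation_additive[of c x0 d] by (simp add: M_def Let_def x0_def[symmetric])
    next
      case equal
      then show ?thesis using c by (simp add: M_def Let_def x0_def[symmetric])
    next
      case greater
      then show ?thesis
        using c assms x0 deviation_additive[of c d x0] by (simp add: M_def Let_def x0_def[symmetric])
    qed
  qed
qed

lemma M_mono: "a < c \<Longrightarrow> c \<le> d \<Longrightarrow> d < b \<Longrightarrow> M c \<le> M d"
  using M_diff[of c d] deviation_nonneg[of c d f] f[of c d] by (cases "c = d") auto

lemma isCont_M:
  assumes x: "a < x" "x < b"
  shows "isCont M x"
  unfolding continuous_at_eps_delta dist_real_def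
proof (intro allI impI)
  fix e :: real assume e: "e > 0"
  define h where "h = min (x - a) (b - x) / 2"
  have "h > 0" "h \<le> (x - a) / 2" "h \<le> (b - x) / 2" using x by (auto simp: h_def)
  then have h: "h > 0" "a < x - h" "x + h < b" using x by (auto simp: field_simps)
  have "(\<lambda>n. deviation f (x - h / (real n + 1)) (x + h / (real n + 1))) \<longlonglongrightarrow> 0"
    using deviation_limit[of x 1 h 1] h INT_shrinking[of h 1 1 x] no_atoms[OF x] by simp
  from order_tendstoD(2)[OF this e] obtain n where n: "deviation f (x - h / (real n + 1)) (x + h / (real n + 1)) < e"
    by (auto simp: eventually_sequentially)
  define r where "r = h / (real n + 1)"
  have "0 < r" "r \<le> h" using h by (auto simp: r_def divide_simps)
  then have r: "0 < r" "a < x - r" "x + r < b" using h by auto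
  have lt: "M (x + r) - M (x - r) < e" using M_diff[of "x - r" "x + r"] r n by (simp add: r_def)
  show "\<exists>d>0. \<forall>y. \<bar>y - x\<bar> < d \<longrightarrow> \<bar>M y - M x\<bar> < e"
  proof (intro exI[of _ r] conjI allI impI)
    fix y assume "\<bar>y - x\<bar> < r"
    then have y: "x - r < y" "y < x + r" by auto
    then show "\<bar>M y - M x\<bar> < e"
      using M_mono[of "x - r" y] M_mono[of y "x + r"] M_mono[of "x - r" x] M_mono[of x "x + r"] r lt
      by (simp add: abs_less_iff)
  qed (rule r)
qed

text \<open>The double intervals of neighbouring steps overlap: summing the increments of
  \<open>M\<close> over two steps covers nearly every piece twice. This is why two consecutive
  values of \<open>M\<close> occur at each end, and why the limit has constant 4.\<close>

lemma averages_telescope: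
  assumes "a < x" "0 < h" "x + real (Suc n) * h < b"
  shows "\<bar>average f (x + real n * h) (x + real (Suc n) * h) - average f x (x + h)\<bar>
    \<le> 2 * (M (x + real (Suc n) * h) + M (x + real n * h) - M (x + h) - M x)"
  using assms(3)
proof (induction n)
  case (Suc n)
  define y where "y = x + real n * h"
  have y: "x + real (Suc n) * h = y + h" "x + real (Suc (Suc n)) * h = y + 2 * h"
    by (simp_all add: y_def algebra_simps)
  have xy: "a < y" using assms(1,2) by (simp add: y_def add_pos_nonneg less_le_trans)
  have "\<bar>average f y (y + h) - average f x (x + h)\<bar> \<le> 2 * (M (y + h) + M y - M (x + h) - M x)"
    using Suc assms(2) unfolding y y_def[symmetric] by simp
  moreover have "\<bar>average f (y + h) (y + 2 * h) - average f y (y + h)\<bar> \<le> 2 * (M (y + 2 * h) - M y)"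
    using adjacent_averages[of y h f] f[of y "y + 2 * h"] M_diff[of y "y + 2 * h"] xy assms(2) Suc.prems
    unfolding y by simp
  ultimately show ?case unfolding y abs_le_iff right_diff_distrib distrib_left by linarith
qed simp

section \<open>Lebesgue points and the continuous representative\<close>

definition lebesgue_point :: "real \<Rightarrow> bool" where
  "lebesgue_point x \<longleftrightarrow> ((\<lambda>h. average f x (x + h)) \<longlongrightarrow> f x) (at_right 0)"

lemma increment_at_lebesgue_points:
  assumes "a < x" "x < y" "y < b" "lebesgue_point x" "lebesgue_point y"
  shows "\<bar>f y - f x\<bar> \<le> 4 * (M y - M x)"
proof -
  \<comment> \<open>This step size makes y the grid point number n + 1, so the last average of the
    telescope starts exactly at y.\<close>
  define H where "H n = (y - x) / (real n + 1)" for n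
  have H: "H n > 0" for n using assms by (simp add: H_def)
  have "H \<longlonglongrightarrow> 0"
    using LIMSEQ_ignore_initial_segment[OF lim_const_over_n[of "y - x"], of 1] by (simp add: H_def[abs_def] add.commute)
  then have H0: "filterlim H (at_right 0) sequentially"
    unfolding filterlim_at using H by (auto intro!: always_eventually less_imp_neq[THEN not_sym])
  have lim: "(\<lambda>n. average f z (z + H n)) \<longlonglongrightarrow> f z" if "lebesgue_point z" for z
    using filterlim_compose[OF that[unfolded lebesgue_point_def] H0] .
  have limM: "(\<lambda>n. M (z + H n)) \<longlonglongrightarrow> M z" if "a < z" "z < b" for z
    using isCont_tendsto_compose[OF isCont_M[OF that], of "\<lambda>n. z + H n"] tendsto_add[OF tendsto_const[of z] \<open>H \<longlonglongrightarrow> 0\<close>]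
    by simp
  have "(\<lambda>n. \<bar>average f y (y + H n) - average f x (x + H n)\<bar>) \<longlonglongrightarrow> \<bar>f y - f x\<bar>"
    by (intro tendsto_intros lim assms)
  moreover have "(\<lambda>n. 2 * (M (y + H n) + M y - M (x + H n) - M x)) \<longlonglongrightarrow> 2 * (M y + M y - M x - M x)"
    by (intro tendsto_intros limM) (use assms in auto)
  moreover have "eventually (\<lambda>n. \<bar>average f y (y + H n) - average f x (x + H n)\<bar> \<le> 2 * (M (y + H n) + M y - M (x + H n) - M x)) sequentially"
  proof -
    have "eventually (\<lambda>n. H n < b - y) sequentially"
      using order_tendstoD(2)[OF \<open>H \<longlonglongrightarrow> 0\<close>, of "b - y"] assms by simp
    then show ?thesis
    proof eventually_elim
      case (elim n)
      have e: "x + real (Suc n) * H n = y" "x + real (Suc (Suc n)) * H n = y + H n"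
        by (simp_all add: H_def field_simps)
      show ?case
        using averages_telescope[of x "H n" "Suc n"] assms(1) H[of n] elim unfolding e by simp
    qed
  qed
  ultimately have "\<bar>f y - f x\<bar> \<le> 2 * (M y + M y - M x - M x)"
    by (intro tendsto_le[OF trivial_limit_sequentially])
  then show ?thesis by simp
qed

lemma ae_lebesgue_point: "\<exists>N. negligible N \<and> (\<forall>x\<in>{a<..<b} - N. lebesgue_point x)"
proof -
  \<comment> \<open>\<open>f\<close> is integrable only on compact subintervals, whereas the
    differentiation theorem asks for integrability on every box. So \<open>f\<close> is cut off on
    intervals exhausting (a, b).\<close>
  define c d where "c n = a + (b - a) / (real n + 3)" and "d n = b - (b - a) / (real n + 3)" for n
  define g where "g n x = (if x \<in> {c n..d n} then f x else 0)" for n x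
  have cd: "a < c n" "d n < b" for n using ab by (auto simp: c_def d_def)
  have "g n integrable_on cbox p q" for n p q
  proof -
    have "f integrable_on {c n..d n}" by (rule abs_diff_integrable(1)[OF f[OF cd]])
    then have "g n integrable_on UNIV" unfolding g_def[abs_def] integrable_restrict_UNIV .
    then show ?thesis by (rule integrable_on_subcbox) simp
  qed
  then have "\<exists>N. negligible N \<and> (\<forall>x e. x \<notin> N \<and> 0 < e \<longrightarrow> (\<exists>r>0. \<forall>h. 0 < h \<and> h < r \<longrightarrow>
      norm (integral (cbox x (x + h *\<^sub>R One)) (g n) /\<^sub>R h ^ DIM(real) - g n x) < e))" for n
    using integrable_ccontinuous_explicit[of "g n"] by metis
  then obtain N where N: "\<And>n. negligible (N n)" "\<And>n x e. x \<notin> N n \<Longrightarrow> 0 < e \<Longrightarrow> (\<exists>r>0. \<forall>h. 0 < h \<and> h < r \<longrightarrow>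
      norm (integral (cbox x (x + h *\<^sub>R One)) (g n) /\<^sub>R h ^ DIM(real) - g n x) < e)"
    by metis
  have "lebesgue_point x" if x: "x \<in> {a<..<b} - (\<Union>n. N n)" for x
  proof -
    have "(\<lambda>n. (b - a) / (real n + 3)) \<longlonglongrightarrow> 0"
      using LIMSEQ_ignore_initial_segment[OF lim_const_over_n[of "b - a"], of 3] by (simp add: add.commute)
    then have "eventually (\<lambda>n. (b - a) / (real n + 3) < min (x - a) (b - x)) sequentially"
      using x by (intro order_tendstoD(2)) auto
    then obtain n where "(b - a) / (real n + 3) < min (x - a) (b - x)" by (auto simp: eventually_sequentially)
    then have n: "c n < x" "x < d n" by (auto simp: c_def d_def)
    show ?thesis
      unfolding lebesgue_point_def tendsto_iff
    proof (intro allI impI)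
      fix e :: real assume e: "e > 0"
      obtain r where r: "r > 0" "\<And>h. 0 < h \<Longrightarrow> h < r \<Longrightarrow> norm (integral (cbox x (x + h *\<^sub>R One)) (g n) /\<^sub>R h ^ DIM(real) - g n x) < e"
        using N(2)[of x n e] x e by auto
      have "eventually (\<lambda>h. h \<in> {0<..<min r (d n - x)}) (at_right 0)"
        using r n by (intro eventually_at_right_real) auto
      then show "eventually (\<lambda>h. dist (average f x (x + h)) (f x) < e) (at_right 0)"
      proof eventually_elim
        case (elim h)
        have "integral {x..x + h} (g n) = integral {x..x + h} f"
          using elim n by (intro integral_cong) (auto simp: g_def)
        moreover have "g n x = f x" using n by (simp add: g_def)
        ultimately show ?case
          using r(2)[of h] elim by (simp add: average_def dist_real_def divide_inverse mult.commute)
      qed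
    qed
  qed
  moreover have "negligible (\<Union>n. N n)" using N(1) by (intro negligible_countable_Union) auto
  ultimately show ?thesis by blast
qed

text \<open>McShane's extension with modulus of continuity \<open>4 |M x - M y|\<close> turns the restriction of \<open>f\<close> to its
  Lebesgue points into a continuous representative.\<close>

lemma continuous_representative:
  obtains N g where "negligible N" "\<And>x. x \<in> {a<..<b} - N \<Longrightarrow> f x = g x"
    "\<And>x y. x \<in> {a<..<b} \<Longrightarrow> y \<in> {a<..<b} \<Longrightarrow> \<bar>g x - g y\<bar> \<le> 4 * \<bar>M x - M y\<bar>"
proof -
  obtain N where N: "negligible N" "\<And>x. x \<in> {a<..<b} - N \<Longrightarrow> lebesgue_point x"
    using ae_lebesgue_point by blast
  define E where "E = {a<..<b} - N"
  have f_le: "\<bar>f x - f y\<bar> \<le> 4 * \<bar>M x - M y\<bar>" if "x \<in> E" "y \<in> E" for x y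
  proof (cases x y rule: linorder_cases)
    case less
    then show ?thesis
      using increment_at_lebesgue_points[of x y] N(2) that M_mono[of x y] by (auto simp: E_def abs_minus_commute)
  next
    case greater
    then show ?thesis
      using increment_at_lebesgue_points[of y x] N(2) that M_mono[of y x] by (auto simp: E_def abs_minus_commute)
  qed simp
  have "E \<noteq> {}"
  proof
    assume "E = {}"
    then have "{a<..<b} \<subseteq> N" by (auto simp: E_def)
    then have "negligible {a<..<b}" using N(1) negligible_subset by blast
    then show False using ab open_not_negligible[of "{a<..<b}"] by auto
  qed
  then obtain z where z: "z \<in> E" by blast
  define g where "g x = (INF y\<in>E. f y + 4 * \<bar>M x - M y\<bar>)" for x
  have bdd: "bdd_below ((\<lambda>y. f y + 4 * \<bar>M x - M y\<bar>) ` E)" for x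
  proof (rule bdd_belowI2)
    fix y assume "y \<in> E"
    then have "f z - f y \<le> 4 * \<bar>M z - M y\<bar>" using f_le[OF z, of y] by (simp add: abs_le_iff)
    moreover have "\<bar>M z - M y\<bar> \<le> \<bar>M x - M z\<bar> + \<bar>M x - M y\<bar>" by linarith
    ultimately show "f z - 4 * \<bar>M x - M z\<bar> \<le> f y + 4 * \<bar>M x - M y\<bar>" by simp
  qed
  have "f x = g x" if "x \<in> E" for x
  proof (rule antisym)
    show "g x \<le> f x" unfolding g_def using cINF_lower[OF bdd that, of x] by simp
    show "f x \<le> g x" unfolding g_def
    proof (rule cINF_greatest[OF \<open>E \<noteq> {}\<close>])
      show "f x \<le> f y + 4 * \<bar>M x - M y\<bar>" if "y \<in> E" for y
        using f_le[OF \<open>x \<in> E\<close> that] by (simp add: abs_le_iff)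
    qed
  qed
  moreover have g_le: "g x \<le> g y + 4 * \<bar>M x - M y\<bar>" for x y
  proof -
    have "g x - 4 * \<bar>M x - M y\<bar> \<le> g y"
      unfolding g_def[of y]
    proof (rule cINF_greatest[OF \<open>E \<noteq> {}\<close>])
      fix w assume "w \<in> E"
      then have "g x \<le> f w + 4 * \<bar>M x - M w\<bar>" unfolding g_def by (intro cINF_lower bdd)
      moreover have "\<bar>M x - M w\<bar> \<le> \<bar>M x - M y\<bar> + \<bar>M y - M w\<bar>" by linarith
      ultimately show "g x - 4 * \<bar>M x - M y\<bar> \<le> f w + 4 * \<bar>M y - M w\<bar>" by simp
    qed
    then show ?thesis by simp
  qed
  have "\<bar>g x - g y\<bar> \<le> 4 * \<bar>M x - M y\<bar>" for x y
    using g_le[of x y] g_le[of y x] by (simp add: abs_le_iff abs_minus_commute)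
  ultimately show thesis using that[of N g] N(1) by (simp add: E_def)
qed

lemma ae_affine: "\<exists>\<alpha> \<beta> N. negligible N \<and> (\<forall>x\<in>{a<..<b} - N. f x = \<alpha> * x + \<beta>)"
proof -
  obtain N g where N: "negligible N" and fg: "\<And>x. x \<in> {a<..<b} - N \<Longrightarrow> f x = g x"
    and g: "\<And>x y. x \<in> {a<..<b} \<Longrightarrow> y \<in> {a<..<b} \<Longrightarrow> \<bar>g x - g y\<bar> \<le> 4 * \<bar>M x - M y\<bar>"
    using continuous_representative by blast
  interpret continuous_osc_additive a b g M
  proof
    show "continuous_on {a<..<b} g"
      unfolding continuous_on_def
    proof
      fix x assume x: "x \<in> {a<..<b}"
      have "(M \<longlongrightarrow> M x) (at x within {a<..<b})"
        using isCont_M[of x] x by (auto simp: isCont_def intro: filterlim_mono[OF _ order_refl at_le])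
      then have "((\<lambda>y. 4 * \<bar>M y - M x\<bar>) \<longlongrightarrow> 4 * \<bar>M x - M x\<bar>) (at x within {a<..<b})"
        by (intro tendsto_intros)
      then have lim: "((\<lambda>y. 4 * \<bar>M y - M x\<bar>) \<longlongrightarrow> 0) (at x within {a<..<b})" by simp
      have "((\<lambda>y. g y - g x) \<longlongrightarrow> 0) (at x within {a<..<b})"
        by (rule Lim_null_comparison[OF _ lim]) (use g x in \<open>auto simp: eventually_at_filter intro: always_eventually\<close>)
      then show "(g \<longlongrightarrow> g x) (at x within {a<..<b})" by (simp add: LIM_zero_iff)
    qed
  next
    fix c d assume cd: "a < c" "c < d" "d < b"
    have "deviation f c d = deviation g c d"
      using cd by (intro deviation_cong_ae[OF N] fg) auto
    then show "integral {c..d} (\<lambda>x. \<bar>g x - integral {c..d} g / (d - c)\<bar>) = (d - c) * (M d - M c)"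
      using M_diff[OF cd] cd by (simp add: deviation_def average_def)
    show "\<bar>g d - g c\<bar> \<le> 4 * (M d - M c)"
      using g[of d c] cd M_mono[of c d] by simp
  qed
  obtain \<alpha> \<beta> where "\<forall>x. a < x \<and> x < b \<longrightarrow> g x = \<alpha> * x + \<beta>" using affine by blast
  then have "\<forall>x\<in>{a<..<b} - N. f x = \<alpha> * x + \<beta>" using fg by auto
  then show ?thesis using N by blast
qed

end

section \<open>Test functions\<close>

text \<open>exp_flat 0 is the standard smooth function that is flat at 0. The powers of 1 / x are
  included because the derivative of each member is a linear combination of further members.\<close>

definition exp_flat :: "nat \<Rightarrow> real \<Rightarrow> real" where
  "exp_flat n x = (if 0 < x then (1 / x) ^ n * exp (- (1 / x)) else 0)"

lemma isCont_exp_flat_0: "isCont (exp_flat n) 0"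
proof -
  have "((\<lambda>x::real. inverse x ^ n / exp (inverse x)) \<longlongrightarrow> 0) (at_right 0)"
    by (rule filterlim_compose[OF tendsto_power_div_exp_0 filterlim_inverse_at_top_right])
  moreover have "eventually (\<lambda>x. inverse x ^ n / exp (inverse x) = exp_flat n x) (at_right 0)"
    using eventually_at_right_less[of "0::real"]
    by eventually_elim (simp add: exp_flat_def exp_minus divide_inverse)
  ultimately have R: "(exp_flat n \<longlongrightarrow> 0) (at_right 0)"
    by (rule Lim_transform_eventually)
  have "eventually (\<lambda>x. 0 = exp_flat n x) (at_left 0)"
    by (auto simp: eventually_at_filter exp_flat_def)
  then have "(exp_flat n \<longlongrightarrow> 0) (at_left 0)"
    by (rule Lim_transform_eventually[OF tendsto_const])
  then show ?thesis using R by (simp add: isCont_def filterlim_at_split exp_flat_def)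
qed

lemma DERIV_exp_flat:
  "(exp_flat n has_real_derivative exp_flat (n + 2) x - real n * exp_flat (n + 1) x) (at x)"
proof (cases x "0::real" rule: linorder_cases)
  case less
  have "eventually (\<lambda>y. y \<in> {..<0}) (nhds x)" using less by (intro eventually_nhds_in_open) auto
  then have "eventually (\<lambda>y. exp_flat n y = 0) (nhds x)" by eventually_elim (simp add: exp_flat_def)
  from DERIV_cong_ev[OF refl this refl] have "(exp_flat n has_real_derivative 0) (at x)" by simp
  then show ?thesis using less by (simp add: exp_flat_def)
next
  case equal
  \<comment> \<open>At 0 the difference quotient of exp_flat n is exp_flat (n + 1), so continuity of
    the next member suffices.\<close>
  have "((\<lambda>h. (exp_flat n (0 + h) - exp_flat n 0) / h) \<longlongrightarrow> 0) (at 0)"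
  proof (rule Lim_transform_eventually)
    show "(exp_flat (n + 1) \<longlongrightarrow> 0) (at 0)"
      using isCont_exp_flat_0[of "n + 1"] by (simp add: isCont_def exp_flat_def)
    show "eventually (\<lambda>h. exp_flat (n + 1) h = (exp_flat n (0 + h) - exp_flat n 0) / h) (at 0)"
      by (auto simp: eventually_at_filter exp_flat_def)
  qed
  then show ?thesis using equal by (simp add: DERIV_def exp_flat_def)
next
  case greater
  have "eventually (\<lambda>y. y \<in> {0<..}) (nhds x)" using greater by (intro eventually_nhds_in_open) auto
  then have ev: "eventually (\<lambda>y. exp_flat n y = (1 / y) ^ n * exp (- (1 / y))) (nhds x)"
    by eventually_elim (simp add: exp_flat_def)
  have inv: "((\<lambda>y. 1 / y) has_real_derivative - ((1 / x) ^ 2)) (at x)"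
    using greater by (auto intro!: derivative_eq_intros simp: power2_eq_square)
  have pow: "((\<lambda>y. (1 / y) ^ n) has_real_derivative - (real n * (1 / x) ^ (n + 1))) (at x)"
    using DERIV_power[OF inv, of n] by (cases n) (auto simp: power2_eq_square mult_ac)
  have "((\<lambda>y. (1 / y) ^ n * exp (- (1 / y))) has_real_derivative
      - (real n * (1 / x) ^ (n + 1)) * exp (- (1 / x)) + exp (- (1 / x)) * - (- ((1 / x) ^ 2)) * (1 / x) ^ n) (at x)"
    by (rule DERIV_mult[OF pow DERIV_fun_exp[OF DERIV_minus[OF inv]]])
  then show ?thesis
    unfolding DERIV_cong_ev[OF refl ev refl] using greater
    by (simp add: exp_flat_def power_add algebra_simps power2_eq_square)
qed

text \<open>A class of functions closed under \<open>deriv\<close> and large enough for the bumps.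
  Closure gives differentiability of all iterated derivatives by induction.\<close>

inductive smooth_term :: "(real \<Rightarrow> real) \<Rightarrow> bool" where
  "smooth_term (\<lambda>x. exp_flat n (k * x + l))"
| "smooth_term f \<Longrightarrow> smooth_term g \<Longrightarrow> smooth_term (\<lambda>x. f x + g x)"
| "smooth_term f \<Longrightarrow> smooth_term g \<Longrightarrow> smooth_term (\<lambda>x. f x * g x)"
| "smooth_term f \<Longrightarrow> smooth_term (\<lambda>x. c * f x)"

lemma smooth_term_DERIV:
  "smooth_term f \<Longrightarrow> \<exists>f'. smooth_term f' \<and> (\<forall>x. (f has_real_derivative f' x) (at x))"
proof (induction rule: smooth_term.induct)
  case (1 n k l)
  let ?f' = "\<lambda>x. k * (exp_flat (n + 2) (k * x + l) + (- real n) * exp_flat (n + 1) (k * x + l))"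
  have "smooth_term ?f'" by (intro smooth_term.intros)
  moreover have "((\<lambda>x. exp_flat n (k * x + l)) has_real_derivative ?f' x) (at x)" for x
  proof -
    have "((\<lambda>x. k * x + l) has_real_derivative k) (at x)" by (auto intro!: derivative_eq_intros)
    from DERIV_chain2[OF DERIV_exp_flat[of n "k * x + l"] this] show ?thesis by (simp add: mult.commute)
  qed
  ultimately show ?case by blast
next
  case (2 f g)
  then obtain f' g' where "smooth_term f'" "smooth_term g'" "\<And>x. (f has_real_derivative f' x) (at x)"
    "\<And>x. (g has_real_derivative g' x) (at x)" by blast
  then show ?case by (intro exI[of _ "\<lambda>x. f' x + g' x"]) (auto intro: smooth_term.intros DERIV_add)
next
  case (3 f g)
  then obtain f' g' where *: "smooth_term f'" "smooth_term g'" "\<And>x. (f has_real_derivative f' x) (at x)"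
    "\<And>x. (g has_real_derivative g' x) (at x)" by blast
  have "((\<lambda>x. f x * g x) has_real_derivative f' x * g x + g' x * f x) (at x)" for x
    by (rule DERIV_mult[OF *(3,4)])
  moreover have "smooth_term (\<lambda>x. f' x * g x + g' x * f x)" using * 3 by (intro smooth_term.intros)
  ultimately show ?case by blast
next
  case (4 f c)
  then obtain f' where "smooth_term f'" "\<And>x. (f has_real_derivative f' x) (at x)" by blast
  then show ?case by (intro exI[of _ "\<lambda>x. c * f' x"]) (auto intro: smooth_term.intros DERIV_cmult)
qed

lemma smooth_term_deriv: "smooth_term f \<Longrightarrow> smooth_term (deriv f)"
proof -
  assume "smooth_term f"
  then obtain f' where f': "smooth_term f'" "\<And>x. (f has_real_derivative f' x) (at x)"
    using smooth_term_DERIV by blast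
  then have "deriv f = f'" by (intro ext DERIV_imp_deriv)
  then show ?thesis using f' by simp
qed

lemma smooth_term_field_differentiable:
  assumes "smooth_term f"
  shows "(deriv ^^ n) f field_differentiable (at x)"
proof -
  have "smooth_term ((deriv ^^ n) f)" using assms by (induction n) (auto intro: smooth_term_deriv)
  then show ?thesis using smooth_term_DERIV unfolding field_differentiable_def by blast
qed

text \<open>The scaling by k moves the support to within 1 / k of the end points and, since exp (- 1
  / y) tends to 1 for large y, makes the bumps converge to the indicator of (c, d).\<close>

definition bump :: "real \<Rightarrow> real \<Rightarrow> nat \<Rightarrow> real \<Rightarrow> real" where
  "bump c d k x = exp_flat 0 (real k * (x - c) - 1) * exp_flat 0 (real k * (d - x) - 1)"

lemma exp_flat_0_bounds: "0 \<le> exp_flat 0 x" "exp_flat 0 x \<le> 1"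
  by (auto simp: exp_flat_def)

lemma bump_bounds: "0 \<le> bump c d k x" "bump c d k x \<le> 1"
  unfolding bump_def using exp_flat_0_bounds by (auto intro: mult_le_one)

lemma bump_eq_0: "x \<notin> {c + 1 / real k..d - 1 / real k} \<Longrightarrow> bump c d k x = 0"
  by (cases "k = 0") (auto simp: bump_def exp_flat_def field_simps)

lemma inner_Icc_subset:
  assumes "0 < k"
  shows "{c + 1 / real k..d - 1 / real k} \<subseteq> {c<..<d}"
proof
  fix t assume t: "t \<in> {c + 1 / real k..d - 1 / real k}"
  have "0 < 1 / real k" using assms by simp
  moreover have "c + 1 / real k \<le> t" "t \<le> d - 1 / real k" using t by auto
  ultimately have "c < t" "t < d" by linarith+
  then show "t \<in> {c<..<d}" by simp
qed

lemma test_function_bump: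
  assumes "c < d" "0 < k"
  shows "test_function {c<..<d} (\<lambda>x. e * bump c d k x)"
proof -
  have "(\<lambda>x. e * bump c d k x) = (\<lambda>x. e * (exp_flat 0 (real k * x + (- real k * c - 1)) * exp_flat 0 (- real k * x + (real k * d - 1))))"
    by (auto simp: bump_def algebra_simps)
  then have "smooth_term (\<lambda>x. e * bump c d k x)"
    by (simp only:) (intro smooth_term.intros)
  moreover have sub: "closure {x. e * bump c d k x \<noteq> 0} \<subseteq> {c + 1 / real k..d - 1 / real k}"
    using bump_eq_0 by (intro closure_minimal) (auto simp del: atLeastAtMost_iff)
  moreover have "{c + 1 / real k..d - 1 / real k} \<subseteq> {c<..<d}"
    by (rule inner_Icc_subset[OF assms(2)])
  moreover have "compact (closure {x. e * bump c d k x \<noteq> 0})"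
    unfolding compact_closure
    by (rule bounded_subset[OF bounded_closed_interval order_trans[OF closure_subset sub]])
  ultimately show ?thesis
    unfolding test_function_def using smooth_term_field_differentiable by blast
qed

lemma integrable_indicator_Ioo: "integrable lborel (indicator {c<..<d::real} :: real \<Rightarrow> real)"
  by (rule integrable_real_indicator) (cases "c \<le> d"; simp)+

lemma integral_bump_tendsto:
  assumes "c < d"
  shows "(\<lambda>k. integral\<^sup>L lborel (bump c d (Suc k))) \<longlonglongrightarrow> d - c"
proof -
  have shrink: "{c + 1 / real (Suc k)..d - 1 / real (Suc k)} \<subseteq> {c<..<d}" for k
    by (rule inner_Icc_subset) simp
  have [measurable]: "exp_flat 0 \<in> borel_measurable borel"
    unfolding exp_flat_def[abs_def] by measurable
  have "(\<lambda>k. integral\<^sup>L lborel (bump c d (Suc k))) \<longlonglongrightarrow> integral\<^sup>L lborel (indicator {c<..<d} :: real \<Rightarrow> real)"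
  proof (rule integral_dominated_convergence[where w = "indicator {c<..<d}"])
    show "integrable lborel (indicator {c<..<d} :: real \<Rightarrow> real)" by (rule integrable_indicator_Ioo)
    show "bump c d (Suc k) \<in> borel_measurable lborel" for k
      unfolding bump_def[abs_def] by measurable
    show "AE x in lborel. norm (bump c d (Suc k) x) \<le> indicator {c<..<d} x" for k
    proof (rule AE_I2)
      fix x
      have "bump c d (Suc k) x = 0" if "x \<notin> {c<..<d}"
        using that shrink by (intro bump_eq_0) blast
      then show "norm (bump c d (Suc k) x) \<le> indicator {c<..<d} x"
        using bump_bounds[of c d "Suc k" x] by (auto simp: indicator_def)
    qed
    have lim: "(\<lambda>k. exp_flat 0 (real (Suc k) * y - 1)) \<longlonglongrightarrow> 1" if "0 < y" for y
    proof -
      have top: "filterlim (\<lambda>k. real (Suc k) * y - 1) at_top sequentially"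
      proof -
        have "filterlim (\<lambda>k. (y - 1) + y * real k) at_top sequentially"
          using that by (intro filterlim_tendsto_add_at_top[OF tendsto_const]
              filterlim_tendsto_pos_mult_at_top[OF tendsto_const] filterlim_real_sequentially)
        then show ?thesis by (simp add: algebra_simps)
      qed
      then have "(\<lambda>k. exp (- inverse (real (Suc k) * y - 1))) \<longlonglongrightarrow> exp (- 0)"
        by (intro tendsto_intros tendsto_inverse_0_at_top)
      moreover have "eventually (\<lambda>k. exp (- inverse (real (Suc k) * y - 1)) = exp_flat 0 (real (Suc k) * y - 1)) sequentially"
        using filterlim_at_top_dense[THEN iffD1, OF top, rule_format, of 0]
        by eventually_elim (simp add: exp_flat_def divide_inverse)
      ultimately show ?thesis using Lim_transform_eventually by fastforce
    qed
    show "AE x in lborel. (\<lambda>k. bump c d (Suc k) x) \<longlonglongrightarrow> indicator {c<..<d} x"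
    proof (rule AE_I2)
      fix x
      show "(\<lambda>k. bump c d (Suc k) x) \<longlonglongrightarrow> indicator {c<..<d} x"
      proof (cases "x \<in> {c<..<d}")
        case True
        then show ?thesis
          using tendsto_mult[OF lim[of "x - c"] lim[of "d - x"]] by (simp add: bump_def)
      next
        case False
        then have "bump c d (Suc k) x = 0" for k
          using shrink by (intro bump_eq_0) blast
        then show ?thesis using False by simp
      qed
    qed
  qed simp
  also have "integral\<^sup>L lborel (indicator {c<..<d} :: real \<Rightarrow> real) = d - c" using assms by simp
  finally show ?thesis .
qed

text \<open>Integration by parts against an affine function, carried out on a compact interval
  around the support and then transferred to S.\<close>

lemma test_function_integrals:
  assumes test: "test_function S \<phi>"
  shows "continuous_on UNIV \<phi>" "integrable lborel \<phi>"
    "((\<lambda>x. (\<alpha> * x + \<beta>) * deriv \<phi> x) has_integral - \<alpha> * integral\<^sup>L lborel \<phi>) S"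
    "(\<lambda>x. (\<alpha> * x + \<beta>) * deriv \<phi> x) absolutely_integrable_on S"
    "x \<notin> S \<Longrightarrow> \<phi> x = 0"
proof -
  define K where "K = closure {x. \<phi> x \<noteq> 0}"
  have K: "compact K" "K \<subseteq> S" using test by (auto simp: test_function_def K_def)
  have zero: "\<phi> x = 0" if "x \<notin> K" for x
    using that closure_subset[of "{x. \<phi> x \<noteq> 0}"] by (auto simp: K_def)
  show "\<phi> x = 0" if "x \<notin> S" for x using zero K(2) that by blast
  have diff: "(deriv ^^ n) \<phi> field_differentiable (at x)" for n x
    using test by (simp add: test_function_def)
  have D: "(\<phi> has_real_derivative deriv \<phi> x) (at x)" for x
    using diff[of 0 x] by (simp add: field_differentiable_derivI)
  have cont: "isCont \<phi> x" "isCont (deriv \<phi>) x" for x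
    using diff[of 0 x] diff[of 1 x] by (auto intro: field_differentiable_imp_continuous_at)
  then show cont_\<phi>: "continuous_on UNIV \<phi>" by (simp add: continuous_at_imp_continuous_on)
  have zero': "deriv \<phi> x = 0" if "x \<notin> K" for x
  proof -
    have "eventually (\<lambda>y. y \<in> - K) (nhds x)"
      using that compact_imp_closed[OF K(1)] by (intro eventually_nhds_in_open) auto
    then have "eventually (\<lambda>y. \<phi> y = 0) (nhds x)" by eventually_elim (simp add: zero)
    then have "deriv \<phi> x = deriv (\<lambda>_. 0) x" by (intro deriv_cong_ev) auto
    then show ?thesis by simp
  qed
  obtain B where B: "\<And>x. x \<in> K \<Longrightarrow> \<bar>x\<bar> < B"
    using compact_imp_bounded[OF K(1)] unfolding bounded_pos_less real_norm_def by blast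
  \<comment> \<open>The strict bound keeps p and q outside K, so the boundary terms vanish; the
    absolute values ensure p \<le> q also for empty K.\<close>
  define p q where "p = - \<bar>B\<bar>" and "q = \<bar>B\<bar>"
  have pq: "p \<le> q" "p \<notin> K" "q \<notin> K" "K \<subseteq> {p..q}" using B by (force simp: p_def q_def)+
  have "(\<lambda>x. indicator {p..q} x *\<^sub>R \<phi> x) = \<phi>"
  proof
    fix x
    show "indicator {p..q} x *\<^sub>R \<phi> x = \<phi> x"
      using zero[of x] pq(4) by (cases "x \<in> K") (auto simp: indicator_def)
  qed
  then show int: "integrable lborel \<phi>"
    using borel_integrable_compact[OF compact_Icc, of p q \<phi>] continuous_on_subset[OF cont_\<phi>] by simp
  define g where "g x = (\<alpha> * x + \<beta>) * deriv \<phi> x" for x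
  have g0: "g x = 0" if "x \<notin> K" for x using zero'[OF that] by (simp add: g_def)
  have "((\<lambda>x. \<alpha> * \<phi> x + g x) has_integral (\<alpha> * q + \<beta>) * \<phi> q - (\<alpha> * p + \<beta>) * \<phi> p) {p..q}"
  proof (rule fundamental_theorem_of_calculus[OF pq(1)])
    fix x
    have "((\<lambda>x. (\<alpha> * x + \<beta>) * \<phi> x) has_real_derivative \<alpha> * \<phi> x + g x) (at x)"
      unfolding g_def by (auto intro!: derivative_eq_intros D)
    then show "((\<lambda>x. (\<alpha> * x + \<beta>) * \<phi> x) has_vector_derivative \<alpha> * \<phi> x + g x) (at x within {p..q})"
      by (simp add: has_real_derivative_iff_has_vector_derivative has_vector_derivative_at_within)
  qed
  then have "((\<lambda>x. \<alpha> * \<phi> x + g x) has_integral 0) {p..q}"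
    using zero pq(2,3) by simp
  then have "((\<lambda>x. \<alpha> * \<phi> x + g x) has_integral 0) UNIV"
  proof (rule has_integral_on_superset)
    fix x assume "x \<notin> {p..q}"
    then have "x \<notin> K" using pq(4) by blast
    then show "\<alpha> * \<phi> x + g x = 0" by (simp add: zero g0)
  qed simp
  from has_integral_diff[OF this has_integral_mult_right[OF has_integral_integral_lborel[OF int], of \<alpha>]]
  have gU: "(g has_integral - \<alpha> * integral\<^sup>L lborel \<phi>) UNIV" by simp
  have ifS: "(\<lambda>x. if x \<in> S then g x else 0) = g" using g0 K(2) by force
  show "((\<lambda>x. (\<alpha> * x + \<beta>) * deriv \<phi> x) has_integral - \<alpha> * integral\<^sup>L lborel \<phi>) S"
    using gU has_integral_restrict_UNIV[of S g] unfolding ifS unfolding g_def by simp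
  have "g absolutely_integrable_on {p..q}"
    unfolding g_def by (intro absolutely_integrable_continuous_real continuous_intros continuous_at_imp_continuous_on ballI cont)
  moreover have "(\<lambda>x. if x \<in> {p..q} then g x else 0) = g" using g0 subsetD[OF pq(4)] by (intro ext) (metis (full_types))
  ultimately have "g absolutely_integrable_on S"
    using absolutely_integrable_restrict_UNIV[of "{p..q}" g] absolutely_integrable_restrict_UNIV[of S g] ifS by simp
  then show "(\<lambda>x. (\<alpha> * x + \<beta>) * deriv \<phi> x) absolutely_integrable_on S" by (simp add: g_def[abs_def])
qed

lemma LINT_deriv_test_function:
  assumes test: "test_function S \<phi>" and N: "negligible N" and f: "\<And>x. x \<in> S - N \<Longrightarrow> f x = \<alpha> * x + \<beta>"
  shows "(LINT x:S|lebesgue. f x * deriv \<phi> x) = - \<alpha> * integral\<^sup>L lborel \<phi>"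
proof -
  let ?g = "\<lambda>x. (\<alpha> * x + \<beta>) * deriv \<phi> x"
  have "(\<lambda>x. f x * deriv \<phi> x) absolutely_integrable_on S"
    by (rule absolutely_integrable_spike[OF test_function_integrals(4)[OF test, of \<alpha> \<beta>] N]) (simp add: f)
  then have "(LINT x:S|lebesgue. f x * deriv \<phi> x) = integral S (\<lambda>x. f x * deriv \<phi> x)"
    by (rule set_lebesgue_integral_eq_integral)
  also have "\<dots> = integral S ?g"
    by (rule integral_spike[OF N]) (simp add: f)
  also have "\<dots> = - \<alpha> * integral\<^sup>L lborel \<phi>"
    by (rule integral_unique[OF test_function_integrals(3)[OF test]])
  finally show ?thesis .
qed

text \<open>Integration by parts leaves - \<alpha> times the integral of the test function, and
  bumps multiplied by - sgn \<alpha> approach the bound.\<close>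

lemma total_variation_affine:
  assumes cd: "c < d" and N: "negligible N" and f: "\<And>x. x \<in> {c<..<d} - N \<Longrightarrow> f x = \<alpha> * x + \<beta>"
  shows "total_variation f {c<..<d} = ennreal (\<bar>\<alpha>\<bar> * (d - c))"
proof (rule antisym)
  have LINT: "(LINT x:{c<..<d}|lebesgue. f x * deriv \<phi> x) = - \<alpha> * integral\<^sup>L lborel \<phi>"
    if "test_function {c<..<d} \<phi>" for \<phi>
    by (rule LINT_deriv_test_function[OF that N f])
  show "total_variation f {c<..<d} \<le> ennreal (\<bar>\<alpha>\<bar> * (d - c))"
    unfolding total_variation_def
  proof (rule SUP_least)
    fix \<phi> assume "\<phi> \<in> {\<phi>. test_function {c<..<d} \<phi> \<and> (\<forall>x\<in>{c<..<d}. \<bar>\<phi> x\<bar> \<le> 1)}"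
    then have \<phi>: "test_function {c<..<d} \<phi>" "\<And>x. x \<in> {c<..<d} \<Longrightarrow> \<bar>\<phi> x\<bar> \<le> 1" by auto
    have "norm (integral\<^sup>L lborel \<phi>) \<le> integral\<^sup>L lborel (indicator {c<..<d} :: real \<Rightarrow> real)"
    proof (rule order_trans[OF integral_norm_bound integral_mono])
      show "integrable lborel (\<lambda>x. norm (\<phi> x))"
        by (intro integrable_norm test_function_integrals(2)[OF \<phi>(1)])
      show "norm (\<phi> x) \<le> indicator {c<..<d} x" for x
        using \<phi>(2)[of x] test_function_integrals(5)[OF \<phi>(1), of x] by (cases "x \<in> {c<..<d}") auto
    qed (rule integrable_indicator_Ioo)
    then have "\<bar>integral\<^sup>L lborel \<phi>\<bar> \<le> d - c" using cd by simp
    then have "\<bar>\<alpha>\<bar> * \<bar>integral\<^sup>L lborel \<phi>\<bar> \<le> \<bar>\<alpha>\<bar> * (d - c)" by (rule mult_left_mono) simp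
    then have "- \<alpha> * integral\<^sup>L lborel \<phi> \<le> \<bar>\<alpha>\<bar> * (d - c)"
      by (simp add: abs_mult[symmetric] abs_le_iff)
    then show "ennreal (LINT x:{c<..<d}|lebesgue. f x * deriv \<phi> x) \<le> ennreal (\<bar>\<alpha>\<bar> * (d - c))"
      unfolding LINT[OF \<phi>(1)] by (rule ennreal_leI)
  qed
  show "ennreal (\<bar>\<alpha>\<bar> * (d - c)) \<le> total_variation f {c<..<d}"
  proof (rule LIMSEQ_le_const2)
    show "(\<lambda>k. ennreal (\<bar>\<alpha>\<bar> * integral\<^sup>L lborel (bump c d (Suc k)))) \<longlonglongrightarrow> ennreal (\<bar>\<alpha>\<bar> * (d - c))"
      by (intro tendsto_ennrealI tendsto_mult tendsto_const integral_bump_tendsto cd)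
    have "ennreal (\<bar>\<alpha>\<bar> * integral\<^sup>L lborel (bump c d (Suc k))) \<le> total_variation f {c<..<d}" for k
    proof -
      define \<phi> where "\<phi> = (\<lambda>x. - sgn \<alpha> * bump c d (Suc k) x)"
      have test: "test_function {c<..<d} \<phi>" unfolding \<phi>_def by (rule test_function_bump) (use cd in auto)
      have "\<bar>\<phi> x\<bar> \<le> 1" for x
        using bump_bounds[of c d "Suc k" x] by (auto simp: \<phi>_def abs_mult sgn_if)
      then have "ennreal (LINT x:{c<..<d}|lebesgue. f x * deriv \<phi> x) \<le> total_variation f {c<..<d}"
        unfolding total_variation_def using test by (intro SUP_upper) auto
      moreover have "- \<alpha> * integral\<^sup>L lborel \<phi> = \<bar>\<alpha>\<bar> * integral\<^sup>L lborel (bump c d (Suc k))"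
        by (simp add: \<phi>_def abs_sgn mult.assoc)
      ultimately show ?thesis unfolding LINT[OF test] by (simp only:)
    qed
    then show "\<exists>M. \<forall>k\<ge>M. ennreal (\<bar>\<alpha>\<bar> * integral\<^sup>L lborel (bump c d (Suc k))) \<le> total_variation f {c<..<d}"
      by blast
  qed
qed

text \<open>The origin of the factor 1/4: the mean is attained at the midpoint e, and each half
  contributes (d - c)^2 / 8 to the integral of |x - e|.\<close>

lemma deviation_affine:
  assumes cd: "c < d"
  shows "deviation (\<lambda>x. \<alpha> * x + \<beta>) c d = \<bar>\<alpha>\<bar> * (d - c) / 4"
proof -
  define e where "e = (c + d) / 2"
  have ftc: "((\<lambda>x. p * x + q) has_integral (p * r\<^sup>2 / 2 + q * r) - (p * l\<^sup>2 / 2 + q * l)) {l..r}" if "l \<le> r" for p q l r :: real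
    by (rule fundamental_theorem_of_calculus[OF that])
      (auto intro!: derivative_eq_intros simp: has_real_derivative_iff_has_vector_derivative[symmetric])
  have avg: "average (\<lambda>x. \<alpha> * x + \<beta>) c d = \<alpha> * e + \<beta>"
    unfolding average_def integral_unique[OF ftc[OF less_imp_le[OF cd]]] using cd
    by (simp add: e_def field_simps power2_eq_square)
  have 1: "((\<lambda>x. \<bar>x - e\<bar>) has_integral (d - c)\<^sup>2 / 8) {c..e}"
  proof (rule has_integral_eq)
    have "(- 1 * e\<^sup>2 / 2 + e * e) - (- 1 * c\<^sup>2 / 2 + e * c) = (d - c)\<^sup>2 / 8"
      by (simp add: e_def field_simps power2_eq_square)
    moreover have "c \<le> e" using cd by (simp add: e_def)
    ultimately show "((\<lambda>x. - 1 * x + e) has_integral (d - c)\<^sup>2 / 8) {c..e}"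
      using ftc[of c e "- 1" e] by (simp only:)
  qed auto
  have 2: "((\<lambda>x. \<bar>x - e\<bar>) has_integral (d - c)\<^sup>2 / 8) {e..d}"
  proof (rule has_integral_eq)
    have "(1 * d\<^sup>2 / 2 + - e * d) - (1 * e\<^sup>2 / 2 + - e * e) = (d - c)\<^sup>2 / 8"
      by (simp add: e_def field_simps power2_eq_square)
    moreover have "e \<le> d" using cd by (simp add: e_def)
    ultimately show "((\<lambda>x. 1 * x + - e) has_integral (d - c)\<^sup>2 / 8) {e..d}"
      using ftc[of e d 1 "- e"] by (simp only:)
  qed auto
  have "((\<lambda>x. \<bar>x - e\<bar>) has_integral (d - c)\<^sup>2 / 8 + (d - c)\<^sup>2 / 8) {c..d}"
    by (rule has_integral_combine[OF _ _ 1 2]) (use cd in \<open>auto simp: e_def\<close>)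
  from has_integral_mult_right[OF this, of "\<bar>\<alpha>\<bar>"]
  have I: "((\<lambda>x. \<bar>\<alpha> * x + \<beta> - (\<alpha> * e + \<beta>)\<bar>) has_integral \<bar>\<alpha>\<bar> * ((d - c)\<^sup>2 / 4)) {c..d}"
    by (simp add: abs_mult[symmetric] right_diff_distrib)
  have alg: "x * (l\<^sup>2 / 4) / l = x * l / 4" if "l \<noteq> 0" for x l :: real
    using that by (simp add: power2_eq_square)
  show ?thesis
    unfolding deviation_def avg integral_unique[OF I] by (rule alg) (use cd in simp)
qed

lemma set_integrable_Ioo:
  fixes f :: "real \<Rightarrow> real"
  assumes "f absolutely_integrable_on {c..d}"
  shows "f absolutely_integrable_on {c<..<d}"
  by (rule set_integrable_subset[OF assms]) auto

lemma osc_eq_deviation: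
  assumes f: "f absolutely_integrable_on {c..d}" and cd: "c < d"
  shows "osc f {c<..<d} = deviation f c d"
proof -
  have "mean_value f {c<..<d} = average f c d"
    using set_lebesgue_integral_eq_integral(2)[OF set_integrable_Ioo[OF f]] cd
    by (simp add: mean_value_def average_def integral_open_interval_real)
  moreover have "(\<lambda>x. \<bar>f x - average f c d\<bar>) absolutely_integrable_on {c..d}"
    using f by (intro set_integrable_abs set_integral_diff) auto
  ultimately show ?thesis
    using set_lebesgue_integral_eq_integral(2)[OF set_integrable_Ioo] cd
    by (simp add: osc_def deviation_def integral_open_interval_real)
qed

section \<open>Affine functions\<close>

text \<open>Represents \<open>\<mu>\<close> as well as the positive and negative parts of Df, whose
  density is the constant \<alpha>.\<close>

definition lebesgue_multiple :: "real \<Rightarrow> real \<Rightarrow> real \<Rightarrow> real measure" where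
  "lebesgue_multiple a b k = density (restrict_space lborel {a<..<b}) (\<lambda>_. ennreal k)"

lemma sets_lebesgue_multiple: "sets (lebesgue_multiple a b k) = sets (restrict_space borel {a<..<b})"
  unfolding lebesgue_multiple_def sets_density by (rule sets_restrict_space_cong) simp

lemma in_sets_restrict_borel: "D \<in> sets (restrict_space borel {a<..<b::real}) \<longleftrightarrow> D \<in> sets borel \<and> D \<subseteq> {a<..<b}"
  by (subst sets_restrict_space_iff) auto

lemma emeasure_lebesgue_multiple:
  assumes "D \<in> sets borel" "D \<subseteq> {a<..<b}"
  shows "emeasure (lebesgue_multiple a b k) D = ennreal k * emeasure lborel D"
proof -
  have "D \<in> sets (restrict_space lborel {a<..<b})"
    using assms sets_lebesgue_multiple[of a b k] in_sets_restrict_borel[of D a b] by (simp add: lebesgue_multiple_def)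
  then show ?thesis
    unfolding lebesgue_multiple_def using assms by (simp add: emeasure_density_const emeasure_restrict_space)
qed

lemma emeasure_lborel_finite: "D \<subseteq> {a<..<b::real} \<Longrightarrow> emeasure lborel D < \<infinity>"
  by (intro emeasure_bounded_finite bounded_subset[OF bounded_closed_interval[of a b]]) auto

lemma measure_lebesgue_multiple:
  assumes "D \<in> sets borel" "D \<subseteq> {a<..<b}" "0 \<le> k"
  shows "measure (lebesgue_multiple a b k) D = k * measure lborel D"
  using assms by (simp add: measure_def emeasure_lebesgue_multiple enn2real_mult)

lemma integral_lebesgue_multiple:
  fixes \<phi> :: "real \<Rightarrow> real"
  assumes "continuous_on UNIV \<phi>" "\<And>x. x \<notin> {a<..<b} \<Longrightarrow> \<phi> x = 0" "0 \<le> k"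
  shows "integral\<^sup>L (lebesgue_multiple a b k) \<phi> = k * integral\<^sup>L lborel \<phi>"
proof -
  have meas: "\<phi> \<in> borel_measurable (restrict_space lborel {a<..<b})"
    by (rule measurable_restrict_space1) (simp add: borel_measurable_continuous_onI assms(1))
  have "integral\<^sup>L (lebesgue_multiple a b k) \<phi> = integral\<^sup>L (restrict_space lborel {a<..<b}) (\<lambda>x. k * \<phi> x)"
    unfolding lebesgue_multiple_def using integral_density[OF meas, of "\<lambda>_. k"] assms(3) by simp
  also have "\<dots> = k * integral\<^sup>L (restrict_space lborel {a<..<b}) \<phi>" by simp
  also have "integral\<^sup>L (restrict_space lborel {a<..<b}) \<phi> = integral\<^sup>L lborel (\<lambda>x. indicator {a<..<b} x *\<^sub>R \<phi> x)"
    by (rule integral_restrict_space) simp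
  also have "(\<lambda>x. indicator {a<..<b} x *\<^sub>R \<phi> x) = \<phi>"
    using assms(2) by (intro ext) (auto simp: indicator_def)
  finally show ?thesis .
qed

lemma radon_measure_lebesgue_multiple: "radon_measure_on a b (lebesgue_multiple a b k)"
  unfolding radon_measure_on_def borel_measure_on_def
proof (intro conjI allI impI)
  show "sets (lebesgue_multiple a b k) = sets (restrict_space borel {a<..<b})" by (rule sets_lebesgue_multiple)
  fix K assume "compact K \<and> K \<subseteq> {a<..<b}"
  then show "emeasure (lebesgue_multiple a b k) K < \<infinity>"
    using emeasure_lborel_finite[of K a b]
    by (simp add: emeasure_lebesgue_multiple borel_compact ennreal_mult_less_top)
qed

lemma has_distributional_derivative_affine:
  assumes N: "negligible N" and f: "\<And>x. x \<in> {a<..<b} - N \<Longrightarrow> f x = \<alpha> * x + \<beta>"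
  shows "has_distributional_derivative a b f (lebesgue_multiple a b (max \<alpha> 0)) (lebesgue_multiple a b (max (- \<alpha>) 0))"
  unfolding has_distributional_derivative_def
proof (intro conjI allI impI radon_measure_lebesgue_multiple)
  fix \<phi> assume test: "test_function {a<..<b} \<phi>"
  have int: "integral\<^sup>L (lebesgue_multiple a b k) \<phi> = k * integral\<^sup>L lborel \<phi>" if "0 \<le> k" for k
    by (rule integral_lebesgue_multiple[OF test_function_integrals(1,5)[OF test] that])
  have "max \<alpha> 0 * I - max (- \<alpha>) 0 * I = \<alpha> * I" for I :: real by (simp add: max_def)
  then show "(LINT x:{a<..<b}|lebesgue. f x * deriv \<phi> x) =
      - (integral\<^sup>L (lebesgue_multiple a b (max \<alpha> 0)) \<phi> - integral\<^sup>L (lebesgue_multiple a b (max (- \<alpha>) 0)) \<phi>)"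
    using LINT_deriv_test_function[OF test N f] by (simp add: int)
qed

lemma signed_variation_lebesgue_multiple:
  assumes B: "B \<in> sets borel" "B \<subseteq> {a<..<b}"
  shows "signed_variation a b (lebesgue_multiple a b (max \<alpha> 0)) (lebesgue_multiple a b (max (- \<alpha>) 0)) B =
    ennreal \<bar>\<alpha>\<bar> * emeasure lborel B"
proof (rule antisym)
  let ?P = "lebesgue_multiple a b (max \<alpha> 0)" and ?N = "lebesgue_multiple a b (max (- \<alpha>) 0)"
  have diff: "\<bar>measure ?P D - measure ?N D\<bar> = \<bar>\<alpha>\<bar> * measure lborel D" if "D \<in> sets borel" "D \<subseteq> {a<..<b}" for D
    using that by (simp add: measure_lebesgue_multiple max_def abs_mult)
  have B_eq: "ennreal \<bar>\<alpha>\<bar> * emeasure lborel B = ennreal (\<bar>\<alpha>\<bar> * measure lborel B)"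
    using emeasure_lborel_finite[OF B(2)] by (simp add: ennreal_mult emeasure_eq_ennreal_measure)
  have fm: "D \<in> fmeasurable lborel" if "D \<in> sets borel" "D \<subseteq> {a<..<b}" for D
    using that emeasure_lborel_finite by (auto intro: fmeasurableI)
  show "signed_variation a b ?P ?N B \<le> ennreal \<bar>\<alpha>\<bar> * emeasure lborel B"
    unfolding signed_variation_def B_eq
  proof (rule SUP_least)
    fix \<D> assume "\<D> \<in> {\<D>. finite \<D> \<and> disjoint \<D> \<and>
      (\<forall>D\<in>\<D>. D \<in> sets borel \<and> D \<subseteq> B \<and> compact (closure D) \<and> closure D \<subseteq> {a<..<b})}"
    then have \<D>: "finite \<D>" "disjoint \<D>" "\<And>D. D \<in> \<D> \<Longrightarrow> D \<in> sets borel" "\<And>D. D \<in> \<D> \<Longrightarrow> D \<subseteq> B" by auto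
    have fm_\<D>: "D \<in> fmeasurable lborel" if "D \<in> \<D>" for D
      by (rule fm[OF \<D>(3)[OF that] order_trans[OF \<D>(4)[OF that] B(2)]])
    have "(\<Sum>D\<in>\<D>. \<bar>measure ?P D - measure ?N D\<bar>) = (\<Sum>D\<in>\<D>. \<bar>\<alpha>\<bar> * measure lborel D)"
      using \<D> B by (intro sum.cong diff) auto
    also have "\<dots> = \<bar>\<alpha>\<bar> * measure lborel (\<Union>\<D>)"
      unfolding sum_distrib_left[symmetric] using \<D>(1,2) by (subst measure_Union') (auto intro: fm_\<D>)
    also have "\<dots> \<le> \<bar>\<alpha>\<bar> * measure lborel B"
      using \<D> B by (intro mult_left_mono measure_mono_fmeasurable fm sets.finite_Union) auto
    finally show "ennreal (\<Sum>D\<in>\<D>. \<bar>measure ?P D - measure ?N D\<bar>) \<le> ennreal (\<bar>\<alpha>\<bar> * measure lborel B)"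
      by (rule ennreal_leI)
  qed
  show "ennreal \<bar>\<alpha>\<bar> * emeasure lborel B \<le> signed_variation a b ?P ?N B"
    unfolding B_eq
  proof (rule LIMSEQ_le_const2)
    \<comment> \<open>B need not be relatively compact in (a, b), so it is exhausted from inside.
      One-element families suffice, because the difference of the two measures has constant
      sign.\<close>
    define D where "D n = B \<inter> {a + 1 / real (Suc n)..b - 1 / real (Suc n)}" for n
    have mono: "D m \<subseteq> D n" if "m \<le> n" for m n
    proof -
      have "1 / real (Suc n) \<le> 1 / real (Suc m)" using that by (intro divide_left_mono) auto
      then show ?thesis unfolding D_def by (intro Int_mono) auto
    qed
    have "(\<Union>n. D n) = B"
    proof (intro equalityI subsetI)
      fix x assume x: "x \<in> B"
      then have "0 < min (x - a) (b - x)" using B by auto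
      then obtain n where "1 / real (Suc n) < min (x - a) (b - x)" using nat_approx_posE by blast
      then show "x \<in> (\<Union>n. D n)" using x by (auto simp: D_def intro!: exI[of _ n])
    qed (auto simp: D_def)
    moreover have "range D \<subseteq> sets lborel" using B by (auto simp: D_def)
    moreover have "incseq D" unfolding incseq_def using mono by blast
    ultimately have "(\<lambda>n. measure lborel (D n)) \<longlonglongrightarrow> measure lborel B"
      using Lim_measure_incseq[of D lborel] emeasure_lborel_finite[OF B(2)] by simp
    then show "(\<lambda>n. ennreal (\<bar>\<alpha>\<bar> * measure lborel (D n))) \<longlonglongrightarrow> ennreal (\<bar>\<alpha>\<bar> * measure lborel B)"
      by (intro tendsto_ennrealI tendsto_mult tendsto_const)
    have "ennreal (\<bar>\<alpha>\<bar> * measure lborel (D n)) \<le> signed_variation a b ?P ?N B" for n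
    proof -
      have D: "D n \<in> sets borel" "D n \<subseteq> B" using B by (auto simp: D_def)
      have "closure (D n) \<subseteq> {a + 1 / real (Suc n)..b - 1 / real (Suc n)}"
        by (rule closure_minimal) (auto simp: D_def)
      also have "\<dots> \<subseteq> {a<..<b}" by (rule inner_Icc_subset) simp
      finally have "closure (D n) \<subseteq> {a<..<b}" .
      moreover have "compact (closure (D n))"
        unfolding compact_closure by (rule bounded_subset[OF bounded_closed_interval]) (auto simp: D_def)
      ultimately have "ennreal (\<Sum>D\<in>{D n}. \<bar>measure ?P D - measure ?N D\<bar>) \<le> signed_variation a b ?P ?N B"
        unfolding signed_variation_def using D by (intro SUP_upper) auto
      then show ?thesis using diff[of "D n"] D B by simp
    qed
    then show "\<exists>M. \<forall>n\<ge>M. ennreal (\<bar>\<alpha>\<bar> * measure lborel (D n)) \<le> signed_variation a b ?P ?N B" by blast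
  qed
qed

text \<open>The hypothesis covers only intervals away from a and b. Exhaustion extends it to those
  touching the ends, in particular to (a, b) itself, which serves as the cover of finite measure for
  the uniqueness theorem.\<close>

lemma emeasure_eq_if_eq_on_inner_intervals:
  fixes \<mu> \<nu> :: "real measure"
  assumes ab: "a < b" and \<mu>: "sets \<mu> = sets (restrict_space borel {a<..<b})"
    and \<nu>: "sets \<nu> = sets (restrict_space borel {a<..<b})"
    and fin: "emeasure \<nu> {a<..<b} \<noteq> \<infinity>"
    and eq: "\<And>c d. a < c \<Longrightarrow> c < d \<Longrightarrow> d < b \<Longrightarrow> emeasure \<mu> {c<..<d} = emeasure \<nu> {c<..<d}"
  shows "\<mu> = \<nu>"
proof (rule measure_eqI_generator_eq)
  define E where "E = (\<inter>) {a<..<b} ` range (\<lambda>(c, d). {c<..<d})"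
  have E_iff: "X \<in> E \<longleftrightarrow> (\<exists>c d. a \<le> c \<and> d \<le> b \<and> X = {c<..<d})" for X
  proof
    assume "X \<in> E"
    then obtain c d where "X = {a<..<b} \<inter> {c<..<d}" by (auto simp: E_def)
    then have "X = {max a c<..<min b d}" by auto
    then show "\<exists>c d. a \<le> c \<and> d \<le> b \<and> X = {c<..<d}" by (metis max.cobounded1 min.cobounded1)
  next
    assume "\<exists>c d. a \<le> c \<and> d \<le> b \<and> X = {c<..<d}"
    then obtain c d where "a \<le> c" "d \<le> b" "X = {c<..<d}" by blast
    then have "X = {a<..<b} \<inter> {c<..<d}" by auto
    moreover have "{c<..<d} \<in> range (\<lambda>(c, d). {c<..<d})" by (rule range_eqI[of _ _ "(c, d)"]) simp
    ultimately show "X \<in> E" unfolding E_def by (rule image_eqI)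
  qed
  show "Int_stable E"
  proof (rule Int_stableI)
    fix X Y assume "X \<in> E" "Y \<in> E"
    then obtain c d c' d' where *: "a \<le> c" "d \<le> b" "X = {c<..<d}" "a \<le> c'" "d' \<le> b" "Y = {c'<..<d'}"
      unfolding E_iff by blast
    then have "X \<inter> Y = {max c c'<..<min d d'}" by auto
    then show "X \<inter> Y \<in> E" unfolding E_iff using * by (metis max.coboundedI1 min.coboundedI1)
  qed
  show "E \<subseteq> Pow {a<..<b}" by (auto simp: E_def)
  have "borel = sigma UNIV (range (\<lambda>(c, d). {c<..<d::real}))"
    using borel_eq_box[where 'a = real] by simp
  from arg_cong[OF this, of sets] have "sets (restrict_space borel {a<..<b}) = (\<inter>) {a<..<b} ` sigma_sets UNIV (range (\<lambda>(c, d). {c<..<d::real}))"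
    unfolding sets_restrict_space by simp
  also have "\<dots> = sigma_sets {a<..<b} E"
    unfolding E_def by (rule sigma_sets_Int) (auto intro!: sigma_sets.Basic)
  finally show "sets \<mu> = sigma_sets {a<..<b} E" "sets \<nu> = sigma_sets {a<..<b} E"
    using \<mu> \<nu> by auto
  show "range (\<lambda>i::nat. {a<..<b}) \<subseteq> E" using E_iff by blast
  show "(\<Union>i::nat. {a<..<b}) = {a<..<b}" by simp
  show EQ: "emeasure \<mu> X = emeasure \<nu> X" if X: "X \<in> E" for X
  proof -
    obtain c d where cd: "a \<le> c" "d \<le> b" "X = {c<..<d}" using X unfolding E_iff by blast
    define A where "A n = {c + 1 / real (Suc n)<..<d - 1 / real (Suc n)}" for n
    have A_sub: "A n \<subseteq> {c<..<d}" for n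
      unfolding A_def by (rule order_trans[OF greaterThanLessThan_subseteq_atLeastAtMost_iff[THEN iffD2] inner_Icc_subset]) auto
    have "(\<Union>n. A n) = X"
    proof (intro equalityI subsetI)
      fix x assume x: "x \<in> X"
      then have "0 < min (x - c) (d - x)" using cd by auto
      then obtain n where "1 / real (Suc n) < min (x - c) (d - x)" using nat_approx_posE by blast
      then show "x \<in> (\<Union>n. A n)" by (auto simp: A_def intro!: exI[of _ n])
    qed (use A_sub cd in blast)
    moreover have "incseq A"
      unfolding incseq_def
    proof (intro allI impI)
      fix m n :: nat assume "m \<le> n"
      then have "1 / real (Suc n) \<le> 1 / real (Suc m)" by (intro divide_left_mono) auto
      then show "A m \<subseteq> A n" by (auto simp: A_def)
    qed
    moreover have sets: "range A \<subseteq> sets (restrict_space borel {a<..<b})"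
      using A_sub cd by (force simp: in_sets_restrict_borel A_def)
    ultimately have "(SUP n. emeasure \<mu> (A n)) = emeasure \<mu> X" "(SUP n. emeasure \<nu> (A n)) = emeasure \<nu> X"
      using SUP_emeasure_incseq[of A \<mu>] SUP_emeasure_incseq[of A \<nu>] \<mu> \<nu> by auto
    moreover have "emeasure \<mu> (A n) = emeasure \<nu> (A n)" for n
    proof (cases "c + 1 / real (Suc n) < d - 1 / real (Suc n)")
      case True
      have "0 < 1 / real (Suc n)" by simp
      then show ?thesis unfolding A_def using True cd by (intro eq) linarith+
    next
      case False
      then have "A n = {}" by (auto simp: A_def)
      then show ?thesis by simp
    qed
    ultimately show ?thesis by simp
  qed
  have "{a<..<b} \<in> E" unfolding E_iff by blast
  then show "emeasure \<mu> {a<..<b} \<noteq> \<infinity>" for i :: nat using EQ fin by simp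
qed

theorem theorem2:
  fixes a b :: real and f :: "real \<Rightarrow> real" and \<mu> :: "real measure"
  assumes "a < b"
    and "locally_integrable a b f"
    and "borel_measure_on a b \<mu>"
    and "\<And>I. I \<in> inner_intervals a b \<Longrightarrow> emeasure \<mu> I = ennreal (osc f I)"
  shows "BV_loc a b f \<and>
         (\<forall>I\<in>inner_intervals a b. emeasure \<mu> I = total_variation f I / 4) \<and>
         (\<exists>P N. has_distributional_derivative a b f P N \<and>
                (\<forall>B\<in>sets \<mu>. emeasure \<mu> B = signed_variation a b P N B / 4)) \<and>
         is_affine_on a b f"
proof -
  have f_int: "f absolutely_integrable_on {c..d}" if "a < c" "d < b" for c d
  proof -
    have "compact {c..d} \<and> {c..d} \<subseteq> {a<..<b}" using that by auto
    then show ?thesis using assms(2) unfolding locally_integrable_def by blast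
  qed
  have sets_\<mu>: "sets \<mu> = sets (restrict_space borel {a<..<b})"
    using assms(3) by (simp add: borel_measure_on_def)
  have dev: "emeasure \<mu> {c<..<d} = ennreal (deviation f c d)" if "a < c" "c < d" "d < b" for c d
    using assms(4)[of "{c<..<d}"] osc_eq_deviation[OF f_int] that by (auto simp: inner_intervals_def)
  interpret deviation_measure a b f \<mu>
    by unfold_locales (use assms(1) f_int sets_\<mu> dev in auto)
  obtain \<alpha> \<beta> N where N: "negligible N" and f: "\<And>x. x \<in> {a<..<b} - N \<Longrightarrow> f x = \<alpha> * x + \<beta>"
    using ae_affine by blast
  define k where "k = \<bar>\<alpha>\<bar> / 4"
  have k: "0 \<le> k" by (simp add: k_def)
  have \<mu>_ivl: "emeasure \<mu> {c<..<d} = ennreal (k * (d - c))" if "a < c" "c < d" "d < b" for c d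
  proof -
    have "deviation f c d = deviation (\<lambda>x. \<alpha> * x + \<beta>) c d"
      using that by (intro deviation_cong_ae[OF N] f) auto
    also have "\<dots> = k * (d - c)" unfolding deviation_affine[OF that(2)] by (simp add: k_def)
    finally show ?thesis using dev[OF that] by (simp only:)
  qed
  have TV: "total_variation f {c<..<d} = ennreal (\<bar>\<alpha>\<bar> * (d - c))" if "a < c" "c < d" "d < b" for c d
    by (rule total_variation_affine[OF that(2) N f]) (use that in auto)
  have quarter: "ennreal (x / 4) = ennreal x / 4" if "0 \<le> x" for x
    using divide_ennreal[OF that, of 4] by simp
  \<comment> \<open>\<open>\<mu>\<close> was assumed to agree with the oscillation on inner
    intervals only; this identifies it on all Borel subsets of (a, b), including those not
    relatively compact.\<close>
  have "\<mu> = lebesgue_multiple a b k"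
  proof (rule emeasure_eq_if_eq_on_inner_intervals[OF assms(1) sets_\<mu> sets_lebesgue_multiple])
    show "emeasure (lebesgue_multiple a b k) {a<..<b} \<noteq> \<infinity>"
      using assms(1) by (simp add: emeasure_lebesgue_multiple ennreal_mult_eq_top_iff)
    show "emeasure \<mu> {c<..<d} = emeasure (lebesgue_multiple a b k) {c<..<d}" if "a < c" "c < d" "d < b" for c d
    proof -
      have "{c<..<d} \<subseteq> {a<..<b}" using that by auto
      then show ?thesis using that k by (simp add: \<mu>_ivl emeasure_lebesgue_multiple ennreal_mult)
    qed
  qed
  then have \<mu>_B: "emeasure \<mu> B = signed_variation a b (lebesgue_multiple a b (max \<alpha> 0)) (lebesgue_multiple a b (max (- \<alpha>) 0)) B / 4"
    if "B \<in> sets \<mu>" for B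
  proof -
    have B: "B \<in> sets borel" "B \<subseteq> {a<..<b}"
      using that sets_\<mu> in_sets_restrict_borel by auto
    have "ennreal k * emeasure lborel B = ennreal \<bar>\<alpha>\<bar> * emeasure lborel B / 4"
      by (simp add: k_def quarter ennreal_times_divide mult.commute)
    then show ?thesis
      using \<open>\<mu> = _\<close> emeasure_lebesgue_multiple[OF B, of k] signed_variation_lebesgue_multiple[OF B, of \<alpha>] by simp
  qed
  have "is_affine_on a b f"
    unfolding is_affine_on_def
  proof (intro exI)
    show "AE x in lebesgue. x \<in> {a<..<b} \<longrightarrow> f x = \<alpha> * x + \<beta>"
      by (rule AE_I'[of N]) (use N f in \<open>auto simp: negligible_iff_null_sets\<close>)
  qed
  moreover have "BV_loc a b f"
    unfolding BV_loc_def inner_intervals_def using assms(2) TV by auto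
  moreover have "\<forall>I\<in>inner_intervals a b. emeasure \<mu> I = total_variation f I / 4"
    unfolding inner_intervals_def using TV \<mu>_ivl quarter by (force simp: k_def)
  ultimately show ?thesis
    using has_distributional_derivative_affine[OF N f] \<mu>_B by blast
qed

end
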